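(* The Riemannian manifold $\Sigma$ has nonpositive sectional curvature.
   Context: Let $H$ be a complex, infinite dimensional, separable Hilbert space, $\mathsf{HS}\subset B(H)$ the ideal of Hilbert-Schmidt operators. Let $\mathcal H_{\mathbb C}=\{a+\lambda: a\in\mathsf{HS},\lambda\in\mathbb C\}$ with inner product $\langle a+\lambda,b+\beta\rangle_2=4\,\mathrm{tr}(ab^* )+\lambda\overline\beta$, and $\mathcal H_{\mathbb R}=\{a+\lambda: a=a^*\in\mathsf{HS},\lambda\in\mathbb R\}$, a real Hilbert space. $\Sigma$ is the set of positive invertible operators in $\mathcal H_{\mathbb R}$, an open subset of $\mathcal H_{\mathbb R}$ with $T_p\Sigma=\mathcal H_{\mathbb R}$, and with Riemannian metric $\langle x,y\rangle_p=\langle xp^{-1},p^{-1}y\rangle_2$, i.e. $\|x\|_p=\|p^{-1/2}xp^{-1/2}\|_2$. The sectional curvature at $p$ of the plane spanned by vectors $x,y$ orthonormal for $\langle\cdot,\cdot\rangle_p$ is $\langle\mathfrak R_p(x,y)y,x\rangle_p$, where $\mathfrak R(x,y)=\nabla_x\nabla_y-\nabla_y\nabla_x-\nabla_{[x,y]}$ and $\nabla$ is the Levi-Civita connection. *)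

theory Defs
  imports "HOL-Analysis.Analysis"
begin

section \<open>Complex Hilbert spaces\<close>

text \<open>
  The class below is a complete complex inner
  product space: \<open>cinner\<close> is linear in the first and conjugate linear in the second argument, and
  the real inner product of the superclass is its real part (so that
  \<open>cinner x x = (norm x)\<^sup>2\<close>).  \<close>

class complex_hilbert_space = real_inner + complete_space +
  fixes scaleC :: "complex \<Rightarrow> 'a \<Rightarrow> 'a" (infixr "*\<^sub>C" 75)
    and cinner :: "'a \<Rightarrow> 'a \<Rightarrow> complex"
  assumes scaleC_add_right: "c *\<^sub>C (x + y) = c *\<^sub>C x + c *\<^sub>C y"
    and scaleC_add_left: "(c + d) *\<^sub>C x = c *\<^sub>C x + d *\<^sub>C x"
    and scaleC_scaleC: "c *\<^sub>C (d *\<^sub>C x) = (c * d) *\<^sub>C x"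
    and scaleC_of_real: "complex_of_real r *\<^sub>C x = r *\<^sub>R x"
    and cinner_commute: "cinner x y = cnj (cinner y x)"
    and cinner_add_left: "cinner (x + y) z = cinner x z + cinner y z"
    and cinner_scaleC_left: "cinner (c *\<^sub>C x) y = c * cinner x y"
    and inner_eq_Re_cinner: "x \<bullet> y = Re (cinner x y)"

class separable_hilbert_space = complex_hilbert_space +
  assumes infinite_dimensional: "finite B \<Longrightarrow> \<exists>x. \<forall>c. x \<noteq> (\<Sum>b\<in>B. c b *\<^sub>C b)"
    and separable: "\<exists>D. countable D \<and> (\<forall>x. \<forall>\<epsilon>>0. \<exists>d\<in>D. dist x d < \<epsilon>)"

interpretation complex_span: vector_space "(*\<^sub>C) :: complex \<Rightarrow> 'h \<Rightarrow> 'h::complex_hilbert_space"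
proof
  show "1 *\<^sub>C x = x" for x :: 'h
    using scaleC_of_real[of 1 x] by simp
qed (simp_all add: scaleC_add_right scaleC_add_left scaleC_scaleC)

definition orthonormal_set :: "'h::complex_hilbert_space set \<Rightarrow> bool"
  where "orthonormal_set B \<longleftrightarrow> (\<forall>e\<in>B. \<forall>f\<in>B. cinner e f = (if e = f then 1 else 0))"

definition orthonormal_basis :: "'h::complex_hilbert_space set \<Rightarrow> bool"
  where "orthonormal_basis B \<longleftrightarrow> orthonormal_set B \<and> closure (complex_span.span B) = UNIV"

lemma cinner_add_right: "cinner x (y + z) = cinner x y + cinner x (z::'h::complex_hilbert_space)"
  by (metis cinner_add_left cinner_commute complex_cnj_add)

lemma cinner_scaleC_right: "cinner x (c *\<^sub>C y) = cnj c * cinner x (y::'h::complex_hilbert_space)"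
  by (metis cinner_commute cinner_scaleC_left complex_cnj_mult)

lemma cinner_zero_left [simp]: "cinner 0 (y::'h::complex_hilbert_space) = 0"
  using cinner_add_left[of 0 0 y] by simp

lemma cinner_zero_right [simp]: "cinner (y::'h::complex_hilbert_space) 0 = 0"
  using cinner_add_right[of y 0 0] by simp

lemma cinner_minus_left [simp]: "cinner (- x) (y::'h::complex_hilbert_space) = - cinner x y"
  using cinner_add_left[of x "-x" y] by (simp add: add_eq_0_iff2)

lemma cinner_minus_right [simp]: "cinner x (- y::'h::complex_hilbert_space) = - cinner x y"
  using cinner_add_right[of x y "-y"] by (simp add: add_eq_0_iff2)

lemma cinner_diff_left: "cinner (x - y) (z::'h::complex_hilbert_space) = cinner x z - cinner y z"
  using cinner_add_left[of x "-y" z] by simp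

lemma cinner_diff_right: "cinner x (y - z::'h::complex_hilbert_space) = cinner x y - cinner x z"
  using cinner_add_right[of x y "-z"] by simp

lemma cinner_scaleR_left: "cinner (r *\<^sub>R x) (y::'h::complex_hilbert_space) = of_real r * cinner x y"
  by (metis cinner_scaleC_left scaleC_of_real)

lemma cinner_scaleR_right: "cinner x (r *\<^sub>R y::'h::complex_hilbert_space) = of_real r * cinner x y"
  by (metis cinner_scaleC_right scaleC_of_real complex_cnj_complex_of_real)

lemma cinner_self: "cinner x x = of_real ((norm (x::'h::complex_hilbert_space))\<^sup>2)"
proof (rule complex_eqI)
  show "Re (cinner x x) = Re (complex_of_real ((norm x)\<^sup>2))"
    by (simp add: inner_eq_Re_cinner[symmetric] power2_norm_eq_inner)
  have "Im (cinner x x) = - Im (cinner x x)"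
    by (metis cinner_commute cnj.simps(2))
  then show "Im (cinner x x) = Im (complex_of_real ((norm x)\<^sup>2))" by simp
qed

lemma Im_cinner: "Im (cinner x y) = x \<bullet> (\<i> *\<^sub>C (y::'h::complex_hilbert_space))"
  by (simp add: inner_eq_Re_cinner cinner_scaleC_right)

lemma norm_scaleC: "norm (c *\<^sub>C x) = cmod c * norm (x::'h::complex_hilbert_space)"
proof -
  have "complex_of_real ((norm (c *\<^sub>C x))\<^sup>2) = cinner (c *\<^sub>C x) (c *\<^sub>C x)"
    by (simp only: cinner_self)
  also have "\<dots> = c * cnj c * cinner x x"
    by (simp add: cinner_scaleC_left cinner_scaleC_right)
  also have "\<dots> = of_real ((cmod c * norm x)\<^sup>2)"
    by (simp only: cinner_self complex_norm_square[symmetric] power_mult_distrib of_real_mult of_real_power)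
  finally have "(norm (c *\<^sub>C x))\<^sup>2 = (cmod c * norm x)\<^sup>2"
    using of_real_eq_iff by blast
  then show ?thesis by (simp add: power2_eq_iff_nonneg)
qed

lemma bounded_linear_scaleC: "bounded_linear (\<lambda>x. c *\<^sub>C (x::'h::complex_hilbert_space))"
proof (rule bounded_linear_intro[where K = "cmod c"])
  show "c *\<^sub>C (r *\<^sub>R x) = r *\<^sub>R c *\<^sub>C x" for r and x :: 'h
    by (simp add: scaleC_of_real[symmetric] scaleC_scaleC mult.commute)
qed (simp_all add: scaleC_add_right norm_scaleC mult.commute)

lemma cmod_cinner_le: "cmod (cinner x y) \<le> norm x * norm (y::'h::complex_hilbert_space)"
proof (cases "cinner x y = 0")
  case False
  define u where "u = cnj (cinner x y) / of_real (cmod (cinner x y))"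
  have u: "cmod u = 1" using False by (simp add: u_def norm_divide)
  have "u * cinner x y = of_real ((cmod (cinner x y))\<^sup>2) / of_real (cmod (cinner x y))"
    unfolding complex_norm_square by (simp add: u_def mult.commute)
  also have "\<dots> = of_real (cmod (cinner x y))"
    using False by (simp add: power2_eq_square)
  finally have "u * cinner x y = of_real (cmod (cinner x y))" .
  then have "cmod (cinner x y) = (u *\<^sub>C x) \<bullet> y"
    by (simp add: inner_eq_Re_cinner cinner_scaleC_left)
  also have "\<dots> \<le> norm (u *\<^sub>C x) * norm y" by (rule norm_cauchy_schwarz)
  finally show ?thesis by (simp add: norm_scaleC u)
qed simp

lemma bounded_linear_cinner_left: "bounded_linear (\<lambda>x. cinner x (y::'h::complex_hilbert_space))"
  by (rule bounded_linear_intro[where K = "norm y"])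
    (simp_all add: cinner_add_left cinner_scaleR_left scaleR_conv_of_real cmod_cinner_le)

lemma csubspace_closure:
  fixes V :: "'h::complex_hilbert_space set"
  assumes "complex_span.subspace V"
  shows "complex_span.subspace (closure V)"
proof (rule complex_span.subspaceI)
  show "0 \<in> closure V"
    using assms closure_subset complex_span.subspace_0 by blast
  fix x y assume xy: "x \<in> closure V" "y \<in> closure V"
  then obtain f g where f: "\<And>n. f n \<in> V" "f \<longlonglongrightarrow> x" and g: "\<And>n. g n \<in> V" "g \<longlonglongrightarrow> y"
    unfolding closure_sequential by blast
  have "(\<lambda>n. f n + g n) \<longlonglongrightarrow> x + y" by (intro tendsto_add f g)
  moreover have "\<forall>n. f n + g n \<in> V" using f g complex_span.subspace_add[OF assms] by simp
  ultimately show "x + y \<in> closure V"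
    unfolding closure_sequential by (intro exI[of _ "\<lambda>n. f n + g n"] conjI)
next
  fix c x assume "x \<in> closure V"
  then obtain f where f: "\<And>n. f n \<in> V" "f \<longlonglongrightarrow> x"
    unfolding closure_sequential by blast
  have "(\<lambda>n. c *\<^sub>C f n) \<longlonglongrightarrow> c *\<^sub>C x"
    by (rule bounded_linear.tendsto[OF bounded_linear_scaleC f(2)])
  moreover have "\<forall>n. c *\<^sub>C f n \<in> V" using f complex_span.subspace_scale[OF assms] by simp
  ultimately show "c *\<^sub>C x \<in> closure V"
    unfolding closure_sequential by (intro exI[of _ "\<lambda>n. c *\<^sub>C f n"] conjI)
qed

lemma ex_orthogonal_vector:
  fixes V :: "'h::complex_hilbert_space set"
  assumes V: "complex_span.subspace V" and cl: "closed V" and x: "x \<notin> V"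
  shows "\<exists>z. z \<noteq> 0 \<and> (\<forall>v\<in>V. cinner z v = 0)"
proof -
  have V0: "0 \<in> V" and Vadd: "\<And>u v. u \<in> V \<Longrightarrow> v \<in> V \<Longrightarrow> u + v \<in> V"
    and VC: "\<And>c v. v \<in> V \<Longrightarrow> c *\<^sub>C v \<in> V"
    using V by (auto simp: complex_span.subspace_def)
  have VR: "\<And>r v. v \<in> V \<Longrightarrow> r *\<^sub>R v \<in> V"
    using VC by (metis scaleC_of_real)
  define d where "d = infdist x V"
  have d0: "d \<ge> 0" unfolding d_def by (rule infdist_nonneg)
  have dle: "d \<le> norm (x - v)" if "v \<in> V" for v
    unfolding d_def using infdist_le[OF that, of x] by (simp add: dist_norm)
  have "\<exists>v\<in>V. norm (x - v) < d + 1 / real (Suc n)" for n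
  proof (rule ccontr)
    assume "\<not> ?thesis"
    then have "d + 1 / real (Suc n) \<le> dist x v" if "v \<in> V" for v
      using that by (auto simp: dist_norm not_less)
    then have "d + 1 / real (Suc n) \<le> infdist x V"
      using V0 unfolding infdist_def by (auto intro!: cINF_greatest)
    then show False by (simp add: d_def)
  qed
  then obtain y where yV: "\<And>n. y n \<in> V" and y: "\<And>n. norm (x - y n) < d + 1 / real (Suc n)"
    by metis
  have par: "(norm (u - v))\<^sup>2 \<le> 2 * (norm (x - u))\<^sup>2 + 2 * (norm (x - v))\<^sup>2 - 4 * d\<^sup>2"
    if "u \<in> V" "v \<in> V" for u v
  proof -
    have m: "(1/2) *\<^sub>R (u + v) \<in> V" using that by (intro VR Vadd)
    have "d\<^sup>2 \<le> (norm (x - (1/2) *\<^sub>R (u + v)))\<^sup>2"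
      using dle[OF m] d0 by (intro power_mono)
    moreover have "(norm (u - v))\<^sup>2 = 2 * (norm (x - u))\<^sup>2 + 2 * (norm (x - v))\<^sup>2
        - 4 * (norm (x - (1/2) *\<^sub>R (u + v)))\<^sup>2"
      by (simp add: power2_norm_eq_inner inner_diff_left inner_diff_right inner_add_left
          inner_add_right inner_commute algebra_simps)
    ultimately show ?thesis by simp
  qed
  have lim: "(\<lambda>n. norm (x - y n)) \<longlonglongrightarrow> d"
  proof (rule tendsto_sandwich[where f = "\<lambda>_. d" and h = "\<lambda>n. d + 1 / real (Suc n)"])
    show "(\<lambda>n. d + 1 / real (Suc n)) \<longlonglongrightarrow> d"
      using tendsto_add[OF tendsto_const[of d] LIMSEQ_Suc[OF lim_inverse_n']] by simp
  qed (use dle[OF yV] y in \<open>auto intro!: always_eventually less_imp_le\<close>)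
  have "Cauchy y"
  proof (rule metric_CauchyI)
    fix e :: real assume e: "e > 0"
    have "(\<lambda>n. (norm (x - y n))\<^sup>2) \<longlonglongrightarrow> d\<^sup>2" by (intro tendsto_power lim)
    moreover have "d\<^sup>2 < d\<^sup>2 + e\<^sup>2 / 4" using e by simp
    ultimately have "\<forall>\<^sub>F n in sequentially. (norm (x - y n))\<^sup>2 < d\<^sup>2 + e\<^sup>2 / 4"
      by (rule order_tendstoD(2))
    then obtain N where N: "\<And>n. n \<ge> N \<Longrightarrow> (norm (x - y n))\<^sup>2 < d\<^sup>2 + e\<^sup>2 / 4"
      by (auto simp: eventually_sequentially)
    have "dist (y m) (y n) < e" if "m \<ge> N" "n \<ge> N" for m n
    proof -
      have "(norm (y m - y n))\<^sup>2 < e\<^sup>2"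
        using par[OF yV yV, of m n] N[OF that(1)] N[OF that(2)] by argo
      then show ?thesis using e by (simp add: dist_norm power2_less_imp_less)
    qed
    then show "\<exists>M. \<forall>m\<ge>M. \<forall>n\<ge>M. dist (y m) (y n) < e" by blast
  qed
  then obtain l where l: "y \<longlonglongrightarrow> l" using Cauchy_convergent convergent_def by blast
  have lV: "l \<in> V" using cl yV l closed_sequentially by blast
  have nl: "norm (x - l) = d"
    using LIMSEQ_unique[OF tendsto_norm[OF tendsto_diff[OF tendsto_const[of x] l]] lim] .
  have orth: "(x - l) \<bullet> v = 0" if v: "v \<in> V" for v
  proof (rule ccontr)
    assume ne: "(x - l) \<bullet> v \<noteq> 0"
    then have v0: "v \<bullet> v > 0" by auto
    define t where "t = ((x - l) \<bullet> v) / (v \<bullet> v)"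
    have "l + t *\<^sub>R v \<in> V" using lV v by (intro Vadd VR)
    then have "d\<^sup>2 \<le> (norm (x - (l + t *\<^sub>R v)))\<^sup>2" using dle d0 by (intro power_mono)
    also have "x - (l + t *\<^sub>R v) = (x - l) - t *\<^sub>R v" by simp
    also have "(norm ((x - l) - t *\<^sub>R v))\<^sup>2 = (norm (x - l))\<^sup>2 - 2 * t * ((x - l) \<bullet> v) + t * t * (v \<bullet> v)"
      unfolding power2_norm_eq_inner inner_diff_left[of "x - l"] inner_diff_right[of _ "x - l"]
      by (simp add: inner_commute)
    also have "\<dots> = d\<^sup>2 - ((x - l) \<bullet> v)\<^sup>2 / (v \<bullet> v)"
      using v0 by (simp add: nl t_def power2_eq_square)
    finally show False using ne v0 by (simp add: divide_le_0_iff)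
  qed
  have "cinner (x - l) v = 0" if "v \<in> V" for v
    by (rule complex_eqI)
      (use orth[OF that] orth[OF VC[OF that, of "\<i>"]] in
        \<open>simp_all add: inner_eq_Re_cinner Im_cinner\<close>)
  moreover have "x - l \<noteq> 0" using lV x by auto
  ultimately show ?thesis by blast
qed

lemma ex_orthonormal_basis: "\<exists>B :: 'h::complex_hilbert_space set. orthonormal_basis B"
proof -
  have "\<exists>M\<in>{B :: 'h set. orthonormal_set B}. \<forall>X\<in>{B. orthonormal_set B}. M \<subseteq> X \<longrightarrow> X = M"
  proof (rule subset_Zorn')
    fix C assume C: "subset.chain {B :: 'h set. orthonormal_set B} C"
    have "orthonormal_set (\<Union>C)"
      unfolding orthonormal_set_def
    proof (intro ballI)
      fix e f assume "e \<in> \<Union>C" "f \<in> \<Union>C"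
      then obtain X Y where XY: "X \<in> C" "e \<in> X" "Y \<in> C" "f \<in> Y" by blast
      then have "X \<subseteq> Y \<or> Y \<subseteq> X" using C unfolding subset.chain_def by blast
      then obtain Z where "Z \<in> C" "e \<in> Z" "f \<in> Z" using XY by blast
      moreover from this have "orthonormal_set Z" using C unfolding subset.chain_def by blast
      ultimately show "cinner e f = (if e = f then 1 else 0)"
        unfolding orthonormal_set_def by blast
    qed
    then show "\<Union>C \<in> {B. orthonormal_set B}" by simp
  qed
  then obtain M :: "'h set" where M: "orthonormal_set M"
    and max: "\<And>X. orthonormal_set X \<Longrightarrow> M \<subseteq> X \<Longrightarrow> X = M" by blast
  have "closure (complex_span.span M) = UNIV"
  proof (rule ccontr)
    assume "closure (complex_span.span M) \<noteq> UNIV"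
    then obtain x where "x \<notin> closure (complex_span.span M)" by blast
    then obtain z where z: "z \<noteq> 0" and orth: "\<And>v. v \<in> closure (complex_span.span M) \<Longrightarrow> cinner z v = 0"
      using ex_orthogonal_vector[of "closure (complex_span.span M)" x]
      by (auto simp: csubspace_closure)
    define u where "u = (1 / norm z) *\<^sub>R z"
    have uu: "cinner u u = 1" using z by (simp add: u_def cinner_self)
    have ue: "cinner u e = 0" if "e \<in> M" for e
      using orth[of e] that complex_span.span_base closure_subset
      by (fastforce simp: u_def cinner_scaleR_left)
    have eu: "cinner e u = 0" if "e \<in> M" for e
      using ue[OF that] cinner_commute[of e u] by simp
    have "u \<notin> M" using ue uu by force
    moreover have "orthonormal_set (insert u M)"
      using M uu ue eu \<open>u \<notin> M\<close> unfolding orthonormal_set_def by auto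
    ultimately show False using max[of "insert u M"] by blast
  qed
  with M show ?thesis unfolding orthonormal_basis_def by blast
qed

lemma infinite_orthonormal_basis:
  fixes B :: "'h::separable_hilbert_space set"
  assumes "orthonormal_basis B"
  shows "infinite B"
proof
  assume fin: "finite B"
  have on: "orthonormal_set B" and dense: "closure (complex_span.span B) = UNIV"
    using assms by (auto simp: orthonormal_basis_def)
  have "x \<in> complex_span.span B" for x
  proof -
    define w where "w = (\<Sum>e\<in>B. cinner x e *\<^sub>C e)"
    have wspan: "w \<in> complex_span.span B"
      unfolding w_def by (intro complex_span.span_sum complex_span.span_scale complex_span.span_base)
    have we: "cinner e w = cinner e x" if e: "e \<in> B" for e
    proof -
      have "cinner w e = (\<Sum>f\<in>B. cinner (cinner x f *\<^sub>C f) e)"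
        unfolding w_def by (rule bounded_linear.linear[OF bounded_linear_cinner_left, THEN linear_sum])
      also have "\<dots> = (\<Sum>f\<in>B. if f = e then cinner x e else 0)"
        using on e by (intro sum.cong) (auto simp: orthonormal_set_def cinner_scaleC_left)
      also have "\<dots> = cinner x e" using fin e by simp
      finally show ?thesis by (metis cinner_commute)
    qed
    have we': "cinner e (x - w) = 0" if "e \<in> B" for e
      using we[OF that] by (simp add: cinner_diff_right)
    have "closed {v. cinner v (x - w) = 0}"
      by (rule closed_Collect_eq[OF linear_continuous_on[OF bounded_linear_cinner_left] continuous_on_const])
    moreover have "complex_span.span B \<subseteq> {v. cinner v (x - w) = 0}"
      by (rule complex_span.span_minimal)
        (auto simp: we' complex_span.subspace_def cinner_add_left cinner_scaleC_left)
    ultimately have "closure (complex_span.span B) \<subseteq> {v. cinner v (x - w) = 0}"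
      by (rule closure_minimal[rotated])
    then have "cinner (x - w) (x - w) = 0" using dense by blast
    then have "x = w" by (simp add: cinner_self)
    then show ?thesis using wspan by simp
  qed
  then have "\<exists>c. x = (\<Sum>e\<in>B. c e *\<^sub>C e)" for x
    using complex_span.span_finite[OF fin] by (metis (no_types, lifting) imageE)
  then show False using infinite_dimensional[OF fin] by blast
qed


section \<open>Hilbert-Schmidt operators\<close>

text \<open>
  Bounded operators are elements of \<open>'h \<Rightarrow>\<^sub>L 'h\<close>, which are only real linear; complex linearity is
  part of the definition of a Hilbert-Schmidt operator.  Orthonormal bases exist
  (\<open>ex_orthonormal_basis\<close>), and square summability over one of them is equivalent to square
  summability over all of them.
\<close>

definition complex_linear_op :: "('h::complex_hilbert_space \<Rightarrow>\<^sub>L 'h) \<Rightarrow> bool"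
  where "complex_linear_op a \<longleftrightarrow> (\<forall>c x. a (c *\<^sub>C x) = c *\<^sub>C a x)"

definition hilbert_schmidt :: "('h::complex_hilbert_space \<Rightarrow>\<^sub>L 'h) \<Rightarrow> bool"
  where "hilbert_schmidt a \<longleftrightarrow> complex_linear_op a \<and>
    (\<forall>B. orthonormal_basis B \<longrightarrow> (\<lambda>e. (norm (a e))\<^sup>2) summable_on B)"

definition self_adjoint :: "('h::complex_hilbert_space \<Rightarrow>\<^sub>L 'h) \<Rightarrow> bool"
  where "self_adjoint a \<longleftrightarrow> (\<forall>x y. cinner (a x) y = cinner x (a y))"

definition op_adjoint :: "('h::complex_hilbert_space \<Rightarrow>\<^sub>L 'h) \<Rightarrow> 'h \<Rightarrow>\<^sub>L 'h"
  where "op_adjoint a = (THE b :: 'h \<Rightarrow>\<^sub>L 'h. \<forall>x y. cinner (a x) y = cinner x (b y))"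

text \<open>The trace of a trace class operator does not depend on the orthonormal basis.\<close>

definition op_trace :: "('h::complex_hilbert_space \<Rightarrow>\<^sub>L 'h) \<Rightarrow> complex"
  where "op_trace t = (\<Sum>\<^sub>\<infinity>e\<in>(SOME B. orthonormal_basis B). cinner (t e) e)"

lift_definition scalar_op :: "complex \<Rightarrow> 'h::complex_hilbert_space \<Rightarrow>\<^sub>L 'h"
  is "\<lambda>c x. c *\<^sub>C x" by (rule bounded_linear_scaleC)

text \<open>
  \<open>scalar_part A\<close> is the \<open>\<lambda>\<close> of a decomposition \<open>A = a + \<lambda>\<close> with \<open>a\<close> Hilbert-Schmidt; it is unique
  since the space is infinite dimensional.  \<open>inner2\<close> is then
  \<open>\<langle>a + \<lambda>, b + \<beta>\<rangle>\<^sub>2 = 4 tr (a b\<^sup>*) + \<lambda> \<beta>\<^sup>-\<close>.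
\<close>

definition scalar_part :: "('h::separable_hilbert_space \<Rightarrow>\<^sub>L 'h) \<Rightarrow> complex"
  where "scalar_part A = (THE c. hilbert_schmidt (A - scalar_op c))"

definition hs_part :: "('h::separable_hilbert_space \<Rightarrow>\<^sub>L 'h) \<Rightarrow> 'h \<Rightarrow>\<^sub>L 'h"
  where "hs_part A = A - scalar_op (scalar_part A)"

definition inner2 :: "('h::separable_hilbert_space \<Rightarrow>\<^sub>L 'h) \<Rightarrow> ('h \<Rightarrow>\<^sub>L 'h) \<Rightarrow> complex"
  where "inner2 A B =
    4 * op_trace (hs_part A o\<^sub>L op_adjoint (hs_part B)) + scalar_part A * cnj (scalar_part B)"

lemma complex_linear_scalar_op: "complex_linear_op (scalar_op c)"
  by (simp add: complex_linear_op_def scalar_op.rep_eq scaleC_scaleC mult.commute)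

lemma complex_linear_op_add: "complex_linear_op a \<Longrightarrow> complex_linear_op b \<Longrightarrow> complex_linear_op (a + b)"
  by (simp add: complex_linear_op_def blinfun.add_left scaleC_add_right)

lemma complex_linear_op_scaleR: "complex_linear_op a \<Longrightarrow> complex_linear_op (r *\<^sub>R a)"
  by (simp add: complex_linear_op_def blinfun.scaleR_left scaleC_of_real[symmetric] scaleC_scaleC
      mult.commute)

lemma summable_on_square_add:
  fixes f g :: "'b \<Rightarrow> 'a::real_inner"
  assumes "(\<lambda>e. (norm (f e))\<^sup>2) summable_on B" "(\<lambda>e. (norm (g e))\<^sup>2) summable_on B"
  shows "(\<lambda>e. (norm (f e + g e))\<^sup>2) summable_on B"
proof (rule summable_on_comparison_test)
  show "(\<lambda>e. 2 * (norm (f e))\<^sup>2 + 2 * (norm (g e))\<^sup>2) summable_on B"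
    by (intro summable_on_add summable_on_cmult_right assms)
  fix e
  have "(norm (f e + g e))\<^sup>2 + (norm (f e - g e))\<^sup>2 = 2 * (norm (f e))\<^sup>2 + 2 * (norm (g e))\<^sup>2"
    by (simp add: power2_norm_eq_inner inner_add_left inner_add_right inner_diff_left
        inner_diff_right)
  then show "(norm (f e + g e))\<^sup>2 \<le> 2 * (norm (f e))\<^sup>2 + 2 * (norm (g e))\<^sup>2"
    using zero_le_power2[of "norm (f e - g e)"] by linarith
qed simp

lemma hilbert_schmidt_zero: "hilbert_schmidt 0"
  by (simp add: hilbert_schmidt_def complex_linear_op_def)

lemma hilbert_schmidt_add: "hilbert_schmidt a \<Longrightarrow> hilbert_schmidt b \<Longrightarrow> hilbert_schmidt (a + b)"
  by (simp add: hilbert_schmidt_def complex_linear_op_add blinfun.add_left summable_on_square_add)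

lemma hilbert_schmidt_scaleR: "hilbert_schmidt a \<Longrightarrow> hilbert_schmidt (r *\<^sub>R a)"
  by (simp add: hilbert_schmidt_def complex_linear_op_scaleR blinfun.scaleR_left power_mult_distrib
      summable_on_cmult_right)

lemma hilbert_schmidt_diff: "hilbert_schmidt a \<Longrightarrow> hilbert_schmidt b \<Longrightarrow> hilbert_schmidt (a - b)"
  using hilbert_schmidt_add[of a "- 1 *\<^sub>R b"] hilbert_schmidt_scaleR[of b "- 1"] by simp

lemma scalar_op_diff: "scalar_op c - scalar_op d = scalar_op (c - d)"
  by (rule blinfun_eqI)
    (simp add: blinfun.diff_left scalar_op.rep_eq complex_span.scale_left_diff_distrib)

lemma scalar_op_add: "scalar_op c + scalar_op d = scalar_op (c + d)"
  by (rule blinfun_eqI) (simp add: blinfun.add_left scalar_op.rep_eq scaleC_add_left)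

lemma scalar_op_scaleR: "r *\<^sub>R scalar_op c = scalar_op (of_real r * c)"
  by (rule blinfun_eqI)
    (simp add: blinfun.scaleR_left scalar_op.rep_eq scaleC_of_real[symmetric] scaleC_scaleC)

lemma scalar_op_zero: "scalar_op 0 = 0"
  by (rule blinfun_eqI) (simp add: scalar_op.rep_eq)

lemma hilbert_schmidt_scalar_op:
  assumes "hilbert_schmidt (scalar_op c :: 'h::separable_hilbert_space \<Rightarrow>\<^sub>L 'h)"
  shows "c = 0"
proof (rule ccontr)
  assume c: "c \<noteq> 0"
  obtain B :: "'h set" where B: "orthonormal_basis B" using ex_orthonormal_basis by blast
  have "norm e = 1" if "e \<in> B" for e
  proof -
    have "complex_of_real ((norm e)\<^sup>2) = 1"
      using B that cinner_self[of e] by (simp add: orthonormal_basis_def orthonormal_set_def)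
    then have "(norm e)\<^sup>2 = 1" using of_real_eq_1_iff by blast
    then show ?thesis using norm_ge_zero[of e] by (auto simp: power2_eq_1_iff)
  qed
  then have "(\<lambda>e. (norm (scalar_op c e))\<^sup>2) summable_on B \<longleftrightarrow> (\<lambda>e. (cmod c)\<^sup>2) summable_on B"
    by (intro summable_on_cong) (simp add: scalar_op.rep_eq norm_scaleC)
  then have "(\<lambda>e. (cmod c)\<^sup>2) summable_on B"
    using assms B by (simp add: hilbert_schmidt_def)
  moreover obtain n :: nat where n: "(\<Sum>\<^sub>\<infinity>e\<in>B. (cmod c)\<^sup>2) < real n * (cmod c)\<^sup>2"
    using reals_Archimedean3[of "(cmod c)\<^sup>2"] c by auto
  moreover obtain F where "finite F" "card F = n" "F \<subseteq> B"
    using infinite_arbitrarily_large[OF infinite_orthonormal_basis[OF B]] by blast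
  ultimately show False
    using finite_sum_le_infsum[of "\<lambda>_. (cmod c)\<^sup>2" B F] by simp
qed

lemma scalar_part_eq:
  assumes "hilbert_schmidt a"
  shows "scalar_part (a + scalar_op c) = c"
  unfolding scalar_part_def
proof (rule the_equality)
  show "hilbert_schmidt (a + scalar_op c - scalar_op c)" using assms by simp
  fix d assume "hilbert_schmidt (a + scalar_op c - scalar_op d)"
  from hilbert_schmidt_diff[OF this assms] have "hilbert_schmidt (scalar_op c - scalar_op d :: 'a \<Rightarrow>\<^sub>L 'a)"
    by simp
  then have "c - d = 0"
    unfolding scalar_op_diff by (rule hilbert_schmidt_scalar_op)
  then show "d = c" by simp
qed

lemma hs_part_eq: "hilbert_schmidt a \<Longrightarrow> hs_part (a + scalar_op c) = a"
  by (simp add: hs_part_def scalar_part_eq)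

lemma op_adjoint_self_adjoint:
  assumes "self_adjoint a"
  shows "op_adjoint a = a"
  unfolding op_adjoint_def
proof (rule the_equality)
  show a: "\<forall>x y. cinner (a x) y = cinner x (a y)" using assms by (simp add: self_adjoint_def)
  fix b :: "'a \<Rightarrow>\<^sub>L 'a" assume b: "\<forall>x y. cinner (a x) y = cinner x (b y)"
  show "b = a"
  proof (rule blinfun_eqI)
    fix y
    have "cinner (b y - a y) (b y - a y) = 0" using a b by (metis cinner_diff_right right_minus_eq)
    then show "b y = a y" by (simp add: cinner_self)
  qed
qed

lemma summable_on_cinner:
  fixes f g :: "'b \<Rightarrow> 'h::complex_hilbert_space"
  assumes "(\<lambda>e. (norm (f e))\<^sup>2) summable_on B" "(\<lambda>e. (norm (g e))\<^sup>2) summable_on B"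
  shows "(\<lambda>e. cinner (f e) (g e)) summable_on B"
proof (rule abs_summable_summable, rule summable_on_comparison_test)
  show "(\<lambda>e. (norm (f e))\<^sup>2 + (norm (g e))\<^sup>2) summable_on B"
    by (intro summable_on_add assms)
  fix e
  have "0 \<le> (norm (f e) - norm (g e))\<^sup>2" by simp
  then have "2 * (norm (f e) * norm (g e)) \<le> (norm (f e))\<^sup>2 + (norm (g e))\<^sup>2"
    by (simp add: power2_diff)
  moreover have "0 \<le> norm (f e) * norm (g e)" by simp
  ultimately show "norm (cinner (f e) (g e)) \<le> (norm (f e))\<^sup>2 + (norm (g e))\<^sup>2"
    using cmod_cinner_le[of "f e" "g e"] by linarith
qed simp

section \<open>The real Hilbert space of self-adjoint Hilbert-Schmidt operators plus real scalars\<close>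

definition hs_real_ops :: "('h::separable_hilbert_space \<Rightarrow>\<^sub>L 'h) set"
  where "hs_real_ops =
    {a + scalar_op (complex_of_real r) | a r. hilbert_schmidt a \<and> self_adjoint a}"

lemma self_adjoint_zero: "self_adjoint 0"
  by (simp add: self_adjoint_def)

lemma self_adjoint_add: "self_adjoint a \<Longrightarrow> self_adjoint b \<Longrightarrow> self_adjoint (a + b)"
  by (simp add: self_adjoint_def blinfun.add_left cinner_add_left cinner_add_right)

lemma self_adjoint_scaleR: "self_adjoint a \<Longrightarrow> self_adjoint (r *\<^sub>R a)"
  by (simp add: self_adjoint_def blinfun.scaleR_left cinner_scaleR_left cinner_scaleR_right)

lemma hs_real_ops_scaleR:
  assumes "A \<in> hs_real_ops"
  shows "s *\<^sub>R A \<in> hs_real_ops"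
proof -
  from assms obtain a r where A: "A = a + scalar_op (complex_of_real r)" "hilbert_schmidt a" "self_adjoint a"
    unfolding hs_real_ops_def by blast
  then have "s *\<^sub>R A = s *\<^sub>R a + scalar_op (complex_of_real (s * r))"
    by (simp add: scaleR_add_right scalar_op_scaleR)
  then show ?thesis using A hilbert_schmidt_scaleR self_adjoint_scaleR unfolding hs_real_ops_def by blast
qed

lemma hs_real_ops_add:
  assumes "A \<in> hs_real_ops"
    and "A' \<in> hs_real_ops"
  shows "A + A' \<in> hs_real_ops"
proof -
  from assms obtain a r a' r' where A: "A = a + scalar_op (complex_of_real r)" "hilbert_schmidt a" "self_adjoint a"
    and A': "A' = a' + scalar_op (complex_of_real r')" "hilbert_schmidt a'" "self_adjoint a'"
    unfolding hs_real_ops_def by blast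
  then have "A + A' = (a + a') + scalar_op (complex_of_real (r + r'))"
    by (simp add: scalar_op_add[symmetric])
  then show ?thesis using A A' hilbert_schmidt_add self_adjoint_add unfolding hs_real_ops_def by blast
qed

lemma hs_real_ops_zero: "0 \<in> hs_real_ops"
  unfolding hs_real_ops_def using hilbert_schmidt_zero self_adjoint_zero scalar_op_zero
  by (metis (mono_tags, lifting) add_0 mem_Collect_eq of_real_0)

typedef (overloaded) 'h hs_real = "hs_real_ops :: ('h::separable_hilbert_space \<Rightarrow>\<^sub>L 'h) set"
  morphisms op_of Abs_hs_real
  using hs_real_ops_zero by blast

setup_lifting type_definition_hs_real

lemma hs_real_cases:
  obtains a r where "op_of x = a + scalar_op (complex_of_real r)" "hilbert_schmidt a" "self_adjoint a"
  using op_of[of x] unfolding hs_real_ops_def by blast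

instantiation hs_real :: (separable_hilbert_space) real_vector
begin

lift_definition zero_hs_real :: "'a hs_real" is 0
  by (rule hs_real_ops_zero)

lift_definition plus_hs_real :: "'a hs_real \<Rightarrow> 'a hs_real \<Rightarrow> 'a hs_real" is "(+)"
  by (rule hs_real_ops_add)

lift_definition uminus_hs_real :: "'a hs_real \<Rightarrow> 'a hs_real" is uminus
  using hs_real_ops_scaleR[of _ "- 1"] by simp

lift_definition minus_hs_real :: "'a hs_real \<Rightarrow> 'a hs_real \<Rightarrow> 'a hs_real" is "(-)"
  using hs_real_ops_add[OF _ hs_real_ops_scaleR[of _ "- 1"]] by simp

lift_definition scaleR_hs_real :: "real \<Rightarrow> 'a hs_real \<Rightarrow> 'a hs_real" is scaleR
  by (rule hs_real_ops_scaleR)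

instance
  by standard (transfer, simp add: algebra_simps)+

end

instantiation hs_real :: (separable_hilbert_space) real_inner
begin

text \<open>
  On self-adjoint arguments with real scalars \<open>inner2\<close> is real valued, so \<open>Re\<close> is only a type conversion.
\<close>

definition inner_hs_real :: "'a hs_real \<Rightarrow> 'a hs_real \<Rightarrow> real"
  where "inner_hs_real x y = Re (inner2 (op_of x) (op_of y))"

definition norm_hs_real :: "'a hs_real \<Rightarrow> real"
  where "norm_hs_real x = sqrt (x \<bullet> x)"

definition sgn_hs_real :: "'a hs_real \<Rightarrow> 'a hs_real"
  where "sgn_hs_real x = x /\<^sub>R norm x"

definition dist_hs_real :: "'a hs_real \<Rightarrow> 'a hs_real \<Rightarrow> real"
  where "dist_hs_real x y = norm (x - y)"

definition uniformity_hs_real :: "('a hs_real \<times> 'a hs_real) filter"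
  where "uniformity_hs_real = (INF e\<in>{0 <..}. principal {(x, y). dist x y < e})"

definition open_hs_real :: "'a hs_real set \<Rightarrow> bool"
  where "open_hs_real U = (\<forall>x\<in>U. eventually (\<lambda>(x', y). x' = x \<longrightarrow> y \<in> U) uniformity)"

instance
proof
  define B where "B = (SOME B :: 'a set. orthonormal_basis B)"
  have B: "orthonormal_basis B"
    unfolding B_def by (rule someI_ex[OF ex_orthonormal_basis])
  have inner_eq: "x \<bullet> y = 4 * (\<Sum>\<^sub>\<infinity>e\<in>B. b e \<bullet> a e) + r * s"
    and summ: "(\<lambda>e. b e \<bullet> a e) summable_on B"
    if x: "op_of x = a + scalar_op (complex_of_real r)" "hilbert_schmidt a" "self_adjoint a"
      and y: "op_of y = b + scalar_op (complex_of_real s)" "hilbert_schmidt b" "self_adjoint b"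
    for x y :: "'a hs_real" and a b r s
  proof -
    have sa: "cinner (a (b e)) e = cinner (b e) (a e)" for e
      using x(3) by (simp add: self_adjoint_def)
    have s: "(\<lambda>e. cinner (b e) (a e)) summable_on B"
      using x(2) y(2) B by (intro summable_on_cinner) (auto simp: hilbert_schmidt_def)
    have "inner2 (op_of x) (op_of y) = 4 * (\<Sum>\<^sub>\<infinity>e\<in>B. cinner (b e) (a e)) + of_real (r * s)"
      by (simp add: inner2_def x y hs_part_eq scalar_part_eq op_adjoint_self_adjoint op_trace_def
          B_def[symmetric] sa)
    moreover have "Re (\<Sum>\<^sub>\<infinity>e\<in>B. cinner (b e) (a e)) = (\<Sum>\<^sub>\<infinity>e\<in>B. b e \<bullet> a e)"
      using infsum_Re[OF s] by (simp add: inner_eq_Re_cinner)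
    ultimately show "x \<bullet> y = 4 * (\<Sum>\<^sub>\<infinity>e\<in>B. b e \<bullet> a e) + r * s"
      by (simp add: inner_hs_real_def)
    show "(\<lambda>e. b e \<bullet> a e) summable_on B"
      using summable_on_Re[OF s] by (simp add: inner_eq_Re_cinner)
  qed
  fix x y z :: "'a hs_real" and t :: real
  obtain a r where x: "op_of x = a + scalar_op (complex_of_real r)" "hilbert_schmidt a" "self_adjoint a"
    by (rule hs_real_cases)
  obtain b s where y: "op_of y = b + scalar_op (complex_of_real s)" "hilbert_schmidt b" "self_adjoint b"
    by (rule hs_real_cases)
  obtain c u where z: "op_of z = c + scalar_op (complex_of_real u)" "hilbert_schmidt c" "self_adjoint c"
    by (rule hs_real_cases)
  show "dist x y = norm (x - y)" by (rule dist_hs_real_def)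
  show "sgn x = x /\<^sub>R norm x" by (rule sgn_hs_real_def)
  show "norm x = sqrt (x \<bullet> x)" by (rule norm_hs_real_def)
  show "x \<bullet> y = y \<bullet> x"
    by (simp add: inner_eq[OF x y] inner_eq[OF y x] inner_commute mult.commute)
  have xy: "op_of (x + y) = (a + b) + scalar_op (complex_of_real (r + s))"
    by (simp add: plus_hs_real.rep_eq x y scalar_op_add[symmetric])
  show "(x + y) \<bullet> z = x \<bullet> z + y \<bullet> z"
    unfolding inner_eq[OF xy hilbert_schmidt_add[OF x(2) y(2)] self_adjoint_add[OF x(3) y(3)] z]
      inner_eq[OF x z] inner_eq[OF y z]
    by (simp add: blinfun.add_left inner_add_right infsum_add[OF summ[OF x z] summ[OF y z]]
        algebra_simps)
  have tx: "op_of (t *\<^sub>R x) = (t *\<^sub>R a) + scalar_op (complex_of_real (t * r))"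
    by (simp add: scaleR_hs_real.rep_eq x scalar_op_scaleR scaleR_add_right)
  show "(t *\<^sub>R x) \<bullet> y = t * (x \<bullet> y)"
    unfolding inner_eq[OF tx hilbert_schmidt_scaleR[OF x(2)] self_adjoint_scaleR[OF x(3)] y]
      inner_eq[OF x y]
    by (simp add: blinfun.scaleR_left infsum_cmult_right' algebra_simps)
  have nn: "0 \<le> (\<Sum>\<^sub>\<infinity>e\<in>B. a e \<bullet> a e)" by (intro infsum_nonneg) simp
  show "0 \<le> x \<bullet> x" using nn by (simp add: inner_eq[OF x x])
  show "x \<bullet> x = 0 \<longleftrightarrow> x = 0"
  proof
    assume "x \<bullet> x = 0"
    then have 0: "(\<Sum>\<^sub>\<infinity>e\<in>B. a e \<bullet> a e) = 0" "r * r = 0"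
      using nn zero_le_square[of r] unfolding inner_eq[OF x x] by linarith+
    have "a e \<bullet> a e = 0" if "e \<in> B" for e
      using nonneg_infsum_le_0D[OF _ summ[OF x x], of e] 0(1) that by simp
    then have "a e = 0" if "e \<in> B" for e using that by simp
    moreover have "complex_span.subspace {v. a v = 0}"
      using x(2) by (auto simp: complex_span.subspace_def blinfun.add_right hilbert_schmidt_def
          complex_linear_op_def)
    ultimately have "complex_span.span B \<subseteq> {v. a v = 0}"
      by (intro complex_span.span_minimal) auto
    moreover have "closed {v. a v = 0}"
      by (rule closed_Collect_eq[OF linear_continuous_on[OF blinfun.bounded_linear_right] continuous_on_const])
    ultimately have "closure (complex_span.span B) \<subseteq> {v. a v = 0}"
      by (rule closure_minimal)
    then have "a = 0" using B by (intro blinfun_eqI) (auto simp: orthonormal_basis_def)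
    then have "op_of x = op_of 0" using x(1) 0(2) by (simp add: zero_hs_real.rep_eq scalar_op_zero)
    then show "x = 0" by (simp add: op_of_inject)
  next
    assume "x = 0"
    then have "op_of x = 0 + scalar_op (complex_of_real 0)"
      by (simp add: zero_hs_real.rep_eq scalar_op_zero)
    from inner_eq[OF this hilbert_schmidt_zero self_adjoint_zero this hilbert_schmidt_zero self_adjoint_zero]
    show "x \<bullet> x = 0" by simp
  qed
qed (simp_all only: uniformity_hs_real_def open_hs_real_def)

end

section \<open>Smooth maps, vector fields and the Levi-Civita connection\<close>

text \<open>
  \<open>D n x [v\<^sub>1, \<dots>, v\<^sub>n]\<close> is the \<open>n\<close>-th Frechet derivative at \<open>x\<close> in the directions \<open>v\<^sub>i\<close>.  The recursive
  definition with iterated spaces of bounded linear maps is not typable, so bounded \<open>n\<close>-linear maps are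
  functions on lists of length \<open>n\<close>, and the last condition says that \<open>D (n + 1)\<close> is the derivative of
  \<open>D n\<close> with respect to the norm of bounded \<open>n\<close>-linear maps.
\<close>

definition bounded_multilinear ::
    "nat \<Rightarrow> ('a::real_normed_vector list \<Rightarrow> 'b::real_normed_vector) \<Rightarrow> bool"
  where "bounded_multilinear n m \<longleftrightarrow>
    (\<forall>vs. length vs = n \<longrightarrow> (\<forall>i<n. linear (\<lambda>v. m (vs[i := v])))) \<and>
    (\<exists>K. \<forall>vs. length vs = n \<longrightarrow> norm (m vs) \<le> K * prod_list (map norm vs))"

definition smooth_on :: "'a::real_normed_vector set \<Rightarrow> ('a \<Rightarrow> 'b::real_normed_vector) \<Rightarrow> bool"
  where "smooth_on U f \<longleftrightarrow> (\<exists>D :: nat \<Rightarrow> 'a \<Rightarrow> 'a list \<Rightarrow> 'b.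
    (\<forall>x\<in>U. D 0 x [] = f x) \<and>
    (\<forall>n. \<forall>x\<in>U. bounded_multilinear n (D n x)) \<and>
    (\<forall>n. \<forall>x\<in>U. \<forall>\<epsilon>>0. \<exists>\<delta>>0. \<forall>y\<in>U. norm (y - x) < \<delta> \<longrightarrow>
      (\<forall>vs. length vs = n \<longrightarrow>
        norm (D n y vs - D n x vs - D (Suc n) x ((y - x) # vs))
          \<le> \<epsilon> * norm (y - x) * prod_list (map norm vs))))"

text \<open>
  Let \<open>U\<close> be an open subset of a normed space \<open>'a\<close>, regarded as a manifold with tangent space \<open>'a\<close> at
  every point.  Vector fields are functions \<open>'a \<Rightarrow> 'a\<close> of which only the values on \<open>U\<close> matter, and
  \<open>g p\<close> is the inner product on the tangent space at \<open>p\<close>.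
\<close>

definition dir_deriv :: "('a::real_normed_vector \<Rightarrow> 'a) \<Rightarrow> ('a \<Rightarrow> 'b::real_normed_vector) \<Rightarrow> 'a \<Rightarrow> 'b"
  where "dir_deriv X f p = frechet_derivative f (at p) (X p)"

definition lie_bracket :: "('a::real_normed_vector \<Rightarrow> 'a) \<Rightarrow> ('a \<Rightarrow> 'a) \<Rightarrow> 'a \<Rightarrow> 'a"
  where "lie_bracket X Y p = dir_deriv X Y p - dir_deriv Y X p"

definition is_levi_civita ::
    "'a::real_normed_vector set \<Rightarrow> ('a \<Rightarrow> 'a \<Rightarrow> 'a \<Rightarrow> real) \<Rightarrow>
      (('a \<Rightarrow> 'a) \<Rightarrow> ('a \<Rightarrow> 'a) \<Rightarrow> 'a \<Rightarrow> 'a) \<Rightarrow> bool"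
  where "is_levi_civita U g nabla \<longleftrightarrow>
    (\<forall>X Y. smooth_on U X \<longrightarrow> smooth_on U Y \<longrightarrow> smooth_on U (nabla X Y)) \<and>
    (\<forall>X X' Y. smooth_on U X \<longrightarrow> smooth_on U X' \<longrightarrow> smooth_on U Y \<longrightarrow>
      (\<forall>p\<in>U. nabla (\<lambda>q. X q + X' q) Y p = nabla X Y p + nabla X' Y p)) \<and>
    (\<forall>f X Y. smooth_on U f \<longrightarrow> smooth_on U X \<longrightarrow> smooth_on U Y \<longrightarrow>
      (\<forall>p\<in>U. nabla (\<lambda>q. f q *\<^sub>R X q) Y p = f p *\<^sub>R nabla X Y p)) \<and>
    (\<forall>X Y Y'. smooth_on U X \<longrightarrow> smooth_on U Y \<longrightarrow> smooth_on U Y' \<longrightarrow>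
      (\<forall>p\<in>U. nabla X (\<lambda>q. Y q + Y' q) p = nabla X Y p + nabla X Y' p)) \<and>
    (\<forall>f X Y. smooth_on U f \<longrightarrow> smooth_on U X \<longrightarrow> smooth_on U Y \<longrightarrow>
      (\<forall>p\<in>U. nabla X (\<lambda>q. f q *\<^sub>R Y q) p = dir_deriv X f p *\<^sub>R Y p + f p *\<^sub>R nabla X Y p)) \<and>
    (\<forall>X Y. smooth_on U X \<longrightarrow> smooth_on U Y \<longrightarrow>
      (\<forall>p\<in>U. nabla X Y p - nabla Y X p = lie_bracket X Y p)) \<and>
    (\<forall>X Y Z. smooth_on U X \<longrightarrow> smooth_on U Y \<longrightarrow> smooth_on U Z \<longrightarrow>
      (\<forall>p\<in>U. dir_deriv X (\<lambda>q. g q (Y q) (Z q)) p = g p (nabla X Y p) (Z p) + g p (Y p) (nabla X Z p)))"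

text \<open>
  By Koszul's formula \<open>nabla X Y p\<close> is determined for smooth \<open>X\<close>, \<open>Y\<close> and \<open>p \<in> U\<close>; the choice only concerns
  the remaining arguments.
\<close>

definition levi_civita ::
    "'a::real_normed_vector set \<Rightarrow> ('a \<Rightarrow> 'a \<Rightarrow> 'a \<Rightarrow> real) \<Rightarrow> ('a \<Rightarrow> 'a) \<Rightarrow> ('a \<Rightarrow> 'a) \<Rightarrow> 'a \<Rightarrow> 'a"
  where "levi_civita U g = (SOME nabla. is_levi_civita U g nabla)"

definition curvature_op ::
    "(('a \<Rightarrow> 'a) \<Rightarrow> ('a \<Rightarrow> 'a) \<Rightarrow> 'a \<Rightarrow> 'a) \<Rightarrow>
      ('a::real_normed_vector \<Rightarrow> 'a) \<Rightarrow> ('a \<Rightarrow> 'a) \<Rightarrow> ('a \<Rightarrow> 'a) \<Rightarrow> 'a \<Rightarrow> 'a"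
  where "curvature_op nabla X Y Z p = nabla X (nabla Y Z) p - nabla Y (nabla X Z) p - nabla (lie_bracket X Y) Z p"

text \<open>The common value of \<open>\<RR>(X, Y) Z\<close> at \<open>p\<close> for all smooth extensions \<open>X\<close>, \<open>Y\<close>, \<open>Z\<close> of \<open>x\<close>, \<open>y\<close>, \<open>z\<close>.\<close>

definition curvature_tensor ::
    "'a::real_normed_vector set \<Rightarrow> ('a \<Rightarrow> 'a \<Rightarrow> 'a \<Rightarrow> real) \<Rightarrow> 'a \<Rightarrow> 'a \<Rightarrow> 'a \<Rightarrow> 'a \<Rightarrow> 'a"
  where "curvature_tensor U g p x y z = (THE w. \<forall>X Y Z.
    smooth_on U X \<longrightarrow> smooth_on U Y \<longrightarrow> smooth_on U Z \<longrightarrow> X p = x \<longrightarrow> Y p = y \<longrightarrow> Z p = z \<longrightarrow>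
      curvature_op (levi_civita U g) X Y Z p = w)"

text \<open>Sectional curvature of the plane spanned by \<open>x\<close> and \<open>y\<close>, for \<open>g p\<close>-orthonormal \<open>x\<close>, \<open>y\<close>.\<close>

definition sectional_curvature ::
    "'a::real_normed_vector set \<Rightarrow> ('a \<Rightarrow> 'a \<Rightarrow> 'a \<Rightarrow> real) \<Rightarrow> 'a \<Rightarrow> 'a \<Rightarrow> 'a \<Rightarrow> real"
  where "sectional_curvature U g p x y = g p (curvature_tensor U g p x y y) x"

section \<open>The manifold of positive invertible operators\<close>

definition positive_op :: "('h::complex_hilbert_space \<Rightarrow>\<^sub>L 'h) \<Rightarrow> bool"
  where "positive_op a \<longleftrightarrow> (\<forall>x. cinner (a x) x \<in> \<real>\<^sub>\<ge>\<^sub>0)"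

definition invertible_op :: "('a::real_normed_vector \<Rightarrow>\<^sub>L 'a) \<Rightarrow> bool"
  where "invertible_op a \<longleftrightarrow> (\<exists>b. a o\<^sub>L b = id_blinfun \<and> b o\<^sub>L a = id_blinfun)"

definition op_inverse :: "('a::real_normed_vector \<Rightarrow>\<^sub>L 'a) \<Rightarrow> 'a \<Rightarrow>\<^sub>L 'a"
  where "op_inverse a = (THE b. a o\<^sub>L b = id_blinfun \<and> b o\<^sub>L a = id_blinfun)"

definition Sigma_manifold :: "'h::separable_hilbert_space hs_real set"
  where "Sigma_manifold = {p. positive_op (op_of p) \<and> invertible_op (op_of p)}"

text \<open>\<open>\<langle>x, y\<rangle>\<^sub>p = \<langle>x p\<^sup>-\<^sup>1, p\<^sup>-\<^sup>1 y\<rangle>\<^sub>2\<close>; this is real for \<open>p\<close> in \<open>Sigma_manifold\<close>.\<close>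

definition Sigma_metric ::
    "'h::separable_hilbert_space hs_real \<Rightarrow> 'h hs_real \<Rightarrow> 'h hs_real \<Rightarrow> real"
  where "Sigma_metric p x y =
    Re (inner2 (op_of x o\<^sub>L op_inverse (op_of p)) (op_inverse (op_of p) o\<^sub>L op_of y))"

end

theory Submission
  imports Defs
begin

text \<open>
  In the flat chart of the manifold all tangent spaces are the same Hilbert space of self-adjoint operators,
  and the metric at \<open>p\<close> is \<open>\<langle>x p\<^sup>-\<^sup>1, p\<^sup>-\<^sup>1 y\<rangle>\<^sub>2\<close>.  Its Levi-Civita connection is
  \<open>\<nabla>\<^sub>X Y = D Y (X) - (X p\<^sup>-\<^sup>1 Y + Y p\<^sup>-\<^sup>1 X) / 2\<close>: the correction term is symmetric in \<open>X\<close> and \<open>Y\<close>, and it is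
  compatible with the metric because the inner product is invariant under commutators,
  \<open>\<langle>[c, a], b\<rangle>\<^sub>2 = \<langle>a, [c\<^sup>*, b]\<rangle>\<^sub>2\<close> (\<open>inner_commutator\<close>, \<open>Sigma_metric_has_derivative\<close>).  Inserting the
  derivative \<open>- p\<^sup>-\<^sup>1 h p\<^sup>-\<^sup>1\<close> of the inverse into the coordinate formula for the curvature shows that
  \<open>\<RR>(x, y) z p\<^sup>-\<^sup>1\<close> is \<open>- [[a, b], c] / 4\<close> with \<open>a = x p\<^sup>-\<^sup>1\<close>, \<open>b = y p\<^sup>-\<^sup>1\<close>, \<open>c = z p\<^sup>-\<^sup>1\<close>
  (\<open>alg_of_curvature_tensor\<close>).  By invariance the sectional curvature is \<open>\<langle>[a, b], [a, b]\<^sup>*\<rangle>\<^sub>2 / 4\<close>.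
  Conjugation by \<open>p\<^sup>1\<^sup>/\<^sup>2\<close> makes \<open>[a, b]\<close> skew-adjoint without changing the value, which is
  therefore minus a square (\<open>inner_mult_positive\<close>).

  Three further points need an argument.  The connection is given as some operation with the properties
  of a Levi-Civita connection and the curvature tensor as the unique common value over all
  extensions to vector fields; that both are what the coordinate formula says is shown for
  any metric with a smooth symmetric Christoffel form (\<open>levi_civita_unique\<close>, \<open>curvature_tensor_eq\<close>), where the
  symmetry of second derivatives enters.  The connection must map smooth fields to smooth fields, so
  smoothness has to be preserved by products and derivatives and has to hold for the inverse, which is
  smooth because its derivative is a quadratic expression in itself
  (\<open>smooth_on_quadratic_ode\<close>).  Finally, Hilbert-Schmidt operators must be closed under
  products, adjoints and the inverse modulo scalars, and positive invertible operators need square roots;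
  the trace identities are all derived from Parseval's identity and the fact that an operator and its adjoint
  have the same Hilbert-Schmidt norm (\<open>adjoint_square_has_sum\<close>), the square root from
  a contraction (\<open>self_adjoint_contraction_sqrt\<close>).
\<close>

section \<open>Jets and smooth maps\<close>

definition slotwise_linear :: "nat \<Rightarrow> ('a::real_normed_vector list \<Rightarrow> 'b::real_normed_vector) \<Rightarrow> bool"
  where "slotwise_linear n m \<longleftrightarrow> (\<forall>vs. length vs = n \<longrightarrow> (\<forall>i<n. linear (\<lambda>v. m (vs[i := v]))))"

text \<open>
  New directions of differentiation enter a list at its head, so linearity in all slots is needed in a form
  that peels off the first slot.
\<close>

lemma slotwise_linear_Suc:
  "slotwise_linear (Suc n) m \<longleftrightarrow>
    (\<forall>vs. length vs = n \<longrightarrow> linear (\<lambda>v. m (v # vs))) \<and> (\<forall>v. slotwise_linear n (\<lambda>vs. m (v # vs)))"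
proof (intro iffI conjI allI impI)
  assume m: "slotwise_linear (Suc n) m"
  fix vs :: "'a list" assume "length vs = n"
  then show "linear (\<lambda>v. m (v # vs))"
    using m[unfolded slotwise_linear_def, rule_format, of "undefined # vs" 0] by simp
next
  fix v assume m: "slotwise_linear (Suc n) m"
  show "slotwise_linear n (\<lambda>vs. m (v # vs))"
    unfolding slotwise_linear_def
  proof (intro allI impI)
    fix vs :: "'a list" and i assume "length vs = n" "i < n"
    then show "linear (\<lambda>w. m (v # vs[i := w]))"
      using m[unfolded slotwise_linear_def, rule_format, of "v # vs" "Suc i"] by simp
  qed
next
  assume m: "(\<forall>vs. length vs = n \<longrightarrow> linear (\<lambda>v. m (v # vs))) \<and> (\<forall>v. slotwise_linear n (\<lambda>vs. m (v # vs)))"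
  show "slotwise_linear (Suc n) m"
    unfolding slotwise_linear_def
  proof (intro allI impI)
    fix vs :: "'a list" and i assume "length vs = Suc n" and i: "i < Suc n"
    then obtain w ws where "vs = w # ws" "length ws = n" by (cases vs) auto
    then show "linear (\<lambda>v. m (vs[i := v]))"
      using m i by (cases i) (auto simp: slotwise_linear_def)
  qed
qed

text \<open>
  A family of candidates for the derivatives of all orders up to \<open>k\<close>.  The order is the length of the list,
  so one function holds the whole jet.  Smoothness is established order by order, because a smooth inverse
  is obtained by bootstrapping from order \<open>k\<close> to order \<open>k + 1\<close>.
\<close>

definition smooth_jet ::
    "nat \<Rightarrow> 'a::real_normed_vector set \<Rightarrow> ('a \<Rightarrow> 'a list \<Rightarrow> 'b::real_normed_vector) \<Rightarrow> bool"
  where "smooth_jet k U D \<longleftrightarrow> (\<forall>x\<in>U. (\<forall>n\<le>k. bounded_multilinear n (D x)) \<and>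
    (\<forall>\<epsilon>>0. \<exists>\<delta>>0. \<forall>y\<in>U. norm (y - x) < \<delta> \<longrightarrow> (\<forall>vs. length vs < k \<longrightarrow>
      norm (D y vs - D x vs - D x ((y - x) # vs)) \<le> \<epsilon> * norm (y - x) * prod_list (map norm vs))))"

definition smooth_upto ::
    "nat \<Rightarrow> 'a::real_normed_vector set \<Rightarrow> ('a \<Rightarrow> 'b::real_normed_vector) \<Rightarrow> bool"
  where "smooth_upto k U f \<longleftrightarrow> (\<exists>D. smooth_jet k U D \<and> (\<forall>x\<in>U. D x [] = f x))"

lemma prod_list_norm_nonneg: "0 \<le> prod_list (map norm (vs :: 'a::real_normed_vector list))"
  by (induction vs) auto

lemma smooth_jetD_multilinear: "smooth_jet k U D \<Longrightarrow> x \<in> U \<Longrightarrow> n \<le> k \<Longrightarrow> bounded_multilinear n (D x)"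
  by (auto simp: smooth_jet_def)

lemma smooth_jetD_linear:
  "smooth_jet k U D \<Longrightarrow> x \<in> U \<Longrightarrow> n \<le> k \<Longrightarrow> slotwise_linear n (D x)"
  by (auto simp: smooth_jet_def bounded_multilinear_def slotwise_linear_def)

lemma smooth_jetD_estimate:
  assumes "smooth_jet k U D" "x \<in> U" "\<epsilon> > 0"
  obtains \<delta> where "\<delta> > 0" "\<And>y vs. y \<in> U \<Longrightarrow> norm (y - x) < \<delta> \<Longrightarrow> length vs < k \<Longrightarrow>
      norm (D y vs - D x vs - D x ((y - x) # vs)) \<le> \<epsilon> * norm (y - x) * prod_list (map norm vs)"
  using assms unfolding smooth_jet_def by meson

lemma smooth_jet_bound:
  assumes "smooth_jet k U D" "x \<in> U"
  obtains K where "K \<ge> 0" "\<And>vs. length vs \<le> k \<Longrightarrow> norm (D x vs) \<le> K * prod_list (map norm vs)"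
proof -
  have "\<exists>K\<ge>0. \<forall>vs. length vs \<le> n \<longrightarrow> norm (D x vs) \<le> K * prod_list (map norm vs)" if "n \<le> k" for n
    using that
  proof (induction n)
    case 0
    show ?case by (intro exI[of _ "norm (D x [])"]) auto
  next
    case (Suc n)
    then obtain K where K: "K \<ge> 0" "\<And>vs. length vs \<le> n \<Longrightarrow> norm (D x vs) \<le> K * prod_list (map norm vs)"
      by auto
    obtain L where L: "\<And>vs. length vs = Suc n \<Longrightarrow> norm (D x vs) \<le> L * prod_list (map norm vs)"
      using smooth_jetD_multilinear[OF assms Suc.prems] unfolding bounded_multilinear_def by auto
    show ?case
    proof (intro exI[of _ "max K L"] conjI allI impI)
      fix vs :: "'a list" assume "length vs \<le> Suc n"
      then have "norm (D x vs) \<le> K * prod_list (map norm vs) \<or> norm (D x vs) \<le> L * prod_list (map norm vs)"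
        using K(2) L by (metis le_Suc_eq)
      moreover have "K * prod_list (map norm vs) \<le> max K L * prod_list (map norm vs)"
        "L * prod_list (map norm vs) \<le> max K L * prod_list (map norm vs)"
        by (intro mult_right_mono prod_list_norm_nonneg; simp)+
      ultimately show "norm (D x vs) \<le> max K L * prod_list (map norm vs)" by linarith
    qed (use K in auto)
  qed
  then show ?thesis using that by blast
qed

lemma smooth_jetI:
  assumes lin: "\<And>x n. x \<in> U \<Longrightarrow> n \<le> k \<Longrightarrow> slotwise_linear n (D x)"
    and bd: "\<And>x. x \<in> U \<Longrightarrow> \<exists>K. \<forall>vs. length vs \<le> k \<longrightarrow> norm (D x vs) \<le> K * prod_list (map norm vs)"
    and est: "\<And>x \<epsilon>. x \<in> U \<Longrightarrow> \<epsilon> > 0 \<Longrightarrow> \<exists>\<delta>>0. \<forall>y\<in>U. norm (y - x) < \<delta> \<longrightarrow> (\<forall>vs. length vs < k \<longrightarrow>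
      norm (D y vs - D x vs - D x ((y - x) # vs)) \<le> \<epsilon> * norm (y - x) * prod_list (map norm vs))"
  shows "smooth_jet k U D"
  unfolding smooth_jet_def
proof (intro ballI conjI allI impI)
  fix x n assume x: "x \<in> U" and n: "n \<le> k"
  obtain K where "\<forall>vs. length vs \<le> k \<longrightarrow> norm (D x vs) \<le> K * prod_list (map norm vs)"
    using bd[OF x] by blast
  then have "\<exists>K. \<forall>vs. length vs = n \<longrightarrow> norm (D x vs) \<le> K * prod_list (map norm vs)"
    using n by (intro exI[of _ K]) auto
  then show "bounded_multilinear n (D x)"
    using lin[OF x n] by (auto simp: bounded_multilinear_def slotwise_linear_def)
qed (use est in blast)

lemma smooth_uptoI:
  "smooth_jet k U D \<Longrightarrow> (\<And>x. x \<in> U \<Longrightarrow> D x [] = f x) \<Longrightarrow> smooth_upto k U f"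
  unfolding smooth_upto_def by blast

lemma smooth_upto_cong:
  "smooth_upto k U f \<Longrightarrow> (\<And>x. x \<in> U \<Longrightarrow> f x = g x) \<Longrightarrow> smooth_upto k U g"
  unfolding smooth_upto_def by (metis (no_types, lifting))

lemma smooth_upto_const: "smooth_upto k U (\<lambda>_. c)"
  unfolding smooth_upto_def
proof (intro exI conjI ballI)
  let ?D = "\<lambda>x vs. if vs = [] then c else 0"
  show "smooth_jet k U ?D"
  proof (rule smooth_jetI)
    show "slotwise_linear n (?D x)" for n x
      unfolding slotwise_linear_def by (auto intro!: linearI)
    show "\<exists>K. \<forall>vs. length vs \<le> k \<longrightarrow> norm (?D x vs) \<le> K * prod_list (map norm vs)" for x :: 'a
      by (intro exI[of _ "norm c"]) (auto intro!: mult_nonneg_nonneg prod_list_norm_nonneg)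
    show "\<exists>\<delta>>0. \<forall>y\<in>U. norm (y - x) < \<delta> \<longrightarrow> (\<forall>vs. length vs < k \<longrightarrow>
      norm (?D y vs - ?D x vs - ?D x ((y - x) # vs)) \<le> \<epsilon> * norm (y - x) * prod_list (map norm vs))"
      if "\<epsilon> > 0" for x :: 'a and \<epsilon> :: real
      using that by (intro exI[of _ 1]) (auto intro!: mult_nonneg_nonneg prod_list_norm_nonneg)
  qed
qed auto

lemma smooth_upto_bounded_linear:
  fixes f :: "'a::real_normed_vector \<Rightarrow> 'b::real_normed_vector"
  assumes "bounded_linear l" and "smooth_upto k U f"
  shows "smooth_upto k U (\<lambda>x. l (f x))"
proof -
  interpret l: bounded_linear l by fact
  obtain D where D: "smooth_jet k U D" and D0: "\<And>x. x \<in> U \<Longrightarrow> D x [] = f x"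
    using assms unfolding smooth_upto_def by blast
  obtain C where C: "C > 0" "\<And>x. norm (l x) \<le> norm x * C" using l.pos_bounded by blast
  have "smooth_jet k U (\<lambda>x vs. l (D x vs))"
  proof (rule smooth_jetI)
    show "slotwise_linear n (\<lambda>vs. l (D x vs))" if "x \<in> U" "n \<le> k" for x n
      using smooth_jetD_linear[OF D that]
      by (auto simp: slotwise_linear_def intro!: linear_compose[OF _ l.linear, unfolded o_def])
  next
    fix x assume x: "x \<in> U"
    obtain K where "K \<ge> 0" and K: "\<And>vs. length vs \<le> k \<Longrightarrow> norm (D x vs) \<le> K * prod_list (map norm vs)"
      using smooth_jet_bound[OF D x] by blast
    have "norm (l (D x vs)) \<le> (K * C) * prod_list (map norm vs)" if "length vs \<le> k" for vs
      using order_trans[OF C(2) mult_right_mono[OF K[OF that]]] C(1) by (simp add: mult_ac)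
    then show "\<exists>K. \<forall>vs. length vs \<le> k \<longrightarrow> norm (l (D x vs)) \<le> K * prod_list (map norm vs)" by blast
  next
    fix x and \<epsilon> :: real assume x: "x \<in> U" and \<epsilon>: "\<epsilon> > 0"
    then have "\<epsilon> / C > 0" using C by simp
    then obtain \<delta> where \<delta>: "\<delta> > 0" and est: "\<And>y vs. y \<in> U \<Longrightarrow> norm (y - x) < \<delta> \<Longrightarrow> length vs < k \<Longrightarrow>
      norm (D y vs - D x vs - D x ((y - x) # vs)) \<le> \<epsilon> / C * norm (y - x) * prod_list (map norm vs)"
      using smooth_jetD_estimate[OF D x] by metis
    show "\<exists>\<delta>>0. \<forall>y\<in>U. norm (y - x) < \<delta> \<longrightarrow> (\<forall>vs. length vs < k \<longrightarrow>
      norm (l (D y vs) - l (D x vs) - l (D x ((y - x) # vs))) \<le> \<epsilon> * norm (y - x) * prod_list (map norm vs))"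
    proof (intro exI[of _ \<delta>] conjI \<delta> ballI impI allI)
      fix y and vs :: "'a list" assume y: "y \<in> U" "norm (y - x) < \<delta>" "length vs < k"
      have "norm (l (D y vs - D x vs - D x ((y - x) # vs)))
        \<le> \<epsilon> / C * norm (y - x) * prod_list (map norm vs) * C"
        using order_trans[OF C(2) mult_right_mono[OF est[OF y]]] C(1) by simp
      then show "norm (l (D y vs) - l (D x vs) - l (D x ((y - x) # vs))) \<le> \<epsilon> * norm (y - x) * prod_list (map norm vs)"
        using C(1) by (simp add: l.diff)
    qed
  qed
  then show ?thesis by (rule smooth_uptoI) (simp add: D0)
qed

text \<open>
  \<open>leibniz B \<phi> \<psi> vs\<close> is the sum of \<open>B (\<phi> us) (\<psi> ws)\<close> over all ways to split \<open>vs\<close> into complementary sublists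
  \<open>us\<close> and \<open>ws\<close>: the higher product rule.  The recursion is itself the product rule for the first direction.
\<close>

fun leibniz :: "('b \<Rightarrow> 'c \<Rightarrow> 'd::ab_group_add) \<Rightarrow> ('a list \<Rightarrow> 'b) \<Rightarrow> ('a list \<Rightarrow> 'c) \<Rightarrow> 'a list \<Rightarrow> 'd"
  where "leibniz B \<phi> \<psi> [] = B (\<phi> []) (\<psi> [])"
  | "leibniz B \<phi> \<psi> (v # vs) =
      leibniz B (\<lambda>us. \<phi> (v # us)) \<psi> vs + leibniz B \<phi> (\<lambda>us. \<psi> (v # us)) vs"

context bounded_bilinear
begin

lemma leibniz_diff_left: "leibniz prod (\<lambda>us. \<phi> us - \<phi>' us) \<psi> vs = leibniz prod \<phi> \<psi> vs - leibniz prod \<phi>' \<psi> vs"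
  by (induction vs arbitrary: \<phi> \<phi>' \<psi>) (simp_all add: diff_left)

lemma leibniz_diff_right: "leibniz prod \<phi> (\<lambda>us. \<psi> us - \<psi>' us) vs = leibniz prod \<phi> \<psi> vs - leibniz prod \<phi> \<psi>' vs"
  by (induction vs arbitrary: \<phi> \<psi>' \<psi>) (simp_all add: diff_right)

lemma linear_leibniz_left:
  assumes "\<And>us. length us \<le> length vs \<Longrightarrow> linear (\<lambda>v. \<phi> v us)"
  shows "linear (\<lambda>v. leibniz prod (\<phi> v) \<psi> vs)"
  using assms
proof (induction vs arbitrary: \<phi> \<psi>)
  case Nil
  then show ?case
    using linear_compose[OF Nil[of "[]"] bounded_linear.linear[OF bounded_linear_left]] by (simp add: o_def)
next
  case (Cons a vs)
  show ?case by (simp, intro linear_compose_add Cons.IH Cons.prems) auto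
qed

lemma linear_leibniz_right:
  assumes "\<And>us. length us \<le> length vs \<Longrightarrow> linear (\<lambda>v. \<psi> v us)"
  shows "linear (\<lambda>v. leibniz prod \<phi> (\<psi> v) vs)"
  using assms
proof (induction vs arbitrary: \<phi> \<psi>)
  case Nil
  then show ?case
    using linear_compose[OF Nil[of "[]"] bounded_linear.linear[OF bounded_linear_right]] by (simp add: o_def)
next
  case (Cons a vs)
  show ?case by (simp, intro linear_compose_add Cons.IH Cons.prems) auto
qed

lemma slotwise_linear_leibniz:
  assumes "\<And>m. m \<le> n \<Longrightarrow> slotwise_linear m \<phi>" "\<And>m. m \<le> n \<Longrightarrow> slotwise_linear m \<psi>"
  shows "slotwise_linear n (leibniz prod \<phi> \<psi>)"
  using assms
proof (induction n arbitrary: \<phi> \<psi>)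
  case 0
  then show ?case by (simp add: slotwise_linear_def)
next
  case (Suc n)
  have \<phi>: "linear (\<lambda>v. \<phi> (v # us))" "slotwise_linear m (\<lambda>us. \<phi> (v # us))"
    and \<psi>: "linear (\<lambda>v. \<psi> (v # us))" "slotwise_linear m (\<lambda>us. \<psi> (v # us))"
    if "length us \<le> n" "m \<le> n" for us m v
    using Suc.prems(1)[of "Suc (length us)"] Suc.prems(2)[of "Suc (length us)"]
      Suc.prems(1)[of "Suc m"] Suc.prems(2)[of "Suc m"] that
    by (auto simp: slotwise_linear_Suc)
  have IH: "slotwise_linear n (leibniz prod (\<lambda>us. \<phi> (v # us)) \<psi>)"
      "slotwise_linear n (leibniz prod \<phi> (\<lambda>us. \<psi> (v # us)))" for v
    using Suc.prems \<phi>(2)[of "[]"] \<psi>(2)[of "[]"] by (intro Suc.IH; simp)+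
  show ?case
    unfolding slotwise_linear_Suc
  proof (intro conjI allI impI)
    show "linear (\<lambda>v. leibniz prod \<phi> \<psi> (v # vs))" if "length vs = n" for vs
      using that \<phi>(1)[of _ 0] \<psi>(1)[of _ 0]
      by (simp, intro linear_compose_add linear_leibniz_left linear_leibniz_right) auto
    show "slotwise_linear n (\<lambda>vs. leibniz prod \<phi> \<psi> (v # vs))" for v
      using IH[of v] by (auto simp: slotwise_linear_def intro!: linear_compose_add)
  qed
qed

text \<open>
  There are \<open>2 ^ length vs\<close> ways to split the list.
\<close>

lemma norm_leibniz_le:
  assumes "\<And>b c. norm (prod b c) \<le> C * norm b * norm c" "C \<ge> 0" "K \<ge> 0" "L \<ge> 0"
    and "\<And>us. length us \<le> length vs \<Longrightarrow> norm (\<phi> us) \<le> K * prod_list (map norm us)"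
    and "\<And>us. length us \<le> length vs \<Longrightarrow> norm (\<psi> us) \<le> L * prod_list (map norm us)"
  shows "norm (leibniz prod \<phi> \<psi> vs) \<le> C * 2 ^ length vs * K * L * prod_list (map norm vs)"
  using assms(3-)
proof (induction vs arbitrary: \<phi> \<psi> K L)
  case Nil
  have "norm (prod (\<phi> []) (\<psi> [])) \<le> C * norm (\<phi> []) * norm (\<psi> [])" by (rule assms(1))
  also have "\<dots> \<le> C * K * L"
    using Nil(3)[of "[]"] Nil(4)[of "[]"] Nil(1,2) assms(2) by (intro mult_mono) auto
  finally show ?case by simp
next
  case (Cons v vs)
  have 1: "norm (leibniz prod (\<lambda>us. \<phi> (v # us)) \<psi> vs)
      \<le> C * 2 ^ length vs * (K * norm v) * L * prod_list (map norm vs)"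
    using Cons.prems(1,2) Cons.prems(3)[of "v # _"] Cons.prems(4)
    by (intro Cons.IH) (auto simp: mult_ac)
  have 2: "norm (leibniz prod \<phi> (\<lambda>us. \<psi> (v # us)) vs)
      \<le> C * 2 ^ length vs * K * (L * norm v) * prod_list (map norm vs)"
    using Cons.prems(1,2) Cons.prems(4)[of "v # _"] Cons.prems(3)
    by (intro Cons.IH) (auto simp: mult_ac)
  show ?case
    using order_trans[OF norm_triangle_ineq add_mono[OF 1 2]] by (simp add: algebra_simps)
qed

text \<open>
  The jet of a product is the Leibniz sum of the jets.  As that sum is bilinear in the two jets, its
  increment at \<open>y\<close> minus its derivative splits exactly as for first derivatives: a remainder of one factor times
  the other factor, twice, plus a product of two increments, which is of second order in \<open>y - x\<close>.
\<close>

lemma smooth_upto_prod: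
  assumes "smooth_upto k U f" "smooth_upto k U g"
  shows "smooth_upto k U (\<lambda>x. prod (f x) (g x))"
proof -
  obtain F G where F: "smooth_jet k U F" and F0: "\<And>x. x \<in> U \<Longrightarrow> F x [] = f x"
    and G: "smooth_jet k U G" and G0: "\<And>x. x \<in> U \<Longrightarrow> G x [] = g x"
    using assms unfolding smooth_upto_def by blast
  obtain C where C: "C > 0" "\<And>b c. norm (prod b c) \<le> C * norm b * norm c"
    using pos_bounded by (auto simp: mult_ac)
  define L where "L x = leibniz prod (F x) (G x)" for x
  have "smooth_jet k U L"
  proof (rule smooth_jetI)
    show "slotwise_linear n (L x)" if "x \<in> U" "n \<le> k" for x n
      unfolding L_def using that
      by (intro slotwise_linear_leibniz smooth_jetD_linear[OF F] smooth_jetD_linear[OF G]) auto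
  next
    fix x assume x: "x \<in> U"
    obtain K where K: "K \<ge> 0" "\<And>vs. length vs \<le> k \<Longrightarrow> norm (F x vs) \<le> K * prod_list (map norm vs)"
      using smooth_jet_bound[OF F x] by blast
    obtain M where M: "M \<ge> 0" "\<And>vs. length vs \<le> k \<Longrightarrow> norm (G x vs) \<le> M * prod_list (map norm vs)"
      using smooth_jet_bound[OF G x] by blast
    have pow: "c * 2 ^ length vs * a * b * prod_list (map norm vs) \<le> c * 2 ^ k * a * b * prod_list (map norm vs)"
      if "length vs \<le> k" "a \<ge> 0" "b \<ge> 0" "c \<ge> 0" for a b c :: real and vs :: "'d list"
      using that by (intro mult_right_mono mult_left_mono) (auto intro: prod_list_norm_nonneg)
    have bd: "norm (leibniz prod \<phi> \<psi> vs) \<le> C * 2 ^ k * a * b * prod_list (map norm vs)"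
      if "length vs \<le> k" "a \<ge> 0" "b \<ge> 0"
        "\<And>us. length us \<le> length vs \<Longrightarrow> norm (\<phi> us) \<le> a * prod_list (map norm us)"
        "\<And>us. length us \<le> length vs \<Longrightarrow> norm (\<psi> us) \<le> b * prod_list (map norm us)"
      for \<phi> \<psi> a b and vs :: "'d list"
      using order_trans[OF norm_leibniz_le[OF C(2) less_imp_le[OF C(1)] that(2-5)]
          pow[OF that(1-3) less_imp_le[OF C(1)]]] .
    show "\<exists>K. \<forall>vs. length vs \<le> k \<longrightarrow> norm (L x vs) \<le> K * prod_list (map norm vs)"
      unfolding L_def using K M by (intro exI[of _ "C * 2 ^ k * K * M"] allI impI bd) auto
    fix \<epsilon> :: real assume \<epsilon>: "\<epsilon> > 0"
    (* \<open>A\<close> dominates the constants of all three terms of the decomposition \<open>eq\<close> below; the first two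
         together and the third each get half of \<open>\<epsilon>\<close>. *)
    define A where "A = C * 2 ^ k * (1 + K) * (1 + M)"
    have A: "A > 0" using C K M by (simp add: A_def)
    define e where "e = min 1 (\<epsilon> / (4 * A))"
    have e: "e > 0" "e \<le> 1" "4 * A * e \<le> \<epsilon>" using A \<epsilon> by (auto simp: e_def min_def field_simps)
    obtain d1 where d1: "d1 > 0" "\<And>y vs. y \<in> U \<Longrightarrow> norm (y - x) < d1 \<Longrightarrow> length vs < k \<Longrightarrow>
      norm (F y vs - F x vs - F x ((y - x) # vs)) \<le> e * norm (y - x) * prod_list (map norm vs)"
      using smooth_jetD_estimate[OF F x e(1)] by metis
    obtain d2 where d2: "d2 > 0" "\<And>y vs. y \<in> U \<Longrightarrow> norm (y - x) < d2 \<Longrightarrow> length vs < k \<Longrightarrow>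
      norm (G y vs - G x vs - G x ((y - x) # vs)) \<le> e * norm (y - x) * prod_list (map norm vs)"
      using smooth_jetD_estimate[OF G x e(1)] by metis
    define \<delta> where "\<delta> = min (min d1 d2) (\<epsilon> / (2 * A))"
    have \<delta>: "\<delta> > 0" using d1 d2 A \<epsilon> by (simp add: \<delta>_def)
    show "\<exists>\<delta>>0. \<forall>y\<in>U. norm (y - x) < \<delta> \<longrightarrow> (\<forall>vs. length vs < k \<longrightarrow>
      norm (L y vs - L x vs - L x ((y - x) # vs)) \<le> \<epsilon> * norm (y - x) * prod_list (map norm vs))"
    proof (intro exI[of _ \<delta>] conjI \<delta> ballI impI allI)
      fix y and vs :: "'d list" assume y: "y \<in> U" "norm (y - x) < \<delta>" and vs: "length vs < k"
      define h where "h = y - x"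
      define H where "H = norm h"
      have H: "H \<ge> 0" "H < d1" "H < d2" "2 * A * H \<le> \<epsilon>"
        using y A by (auto simp: H_def h_def \<delta>_def field_simps)
      let ?P = "\<lambda>us. prod_list (map norm us)"
      have rf: "norm (F y us - F x us - F x (h # us)) \<le> (e * H) * ?P us"
        and rg: "norm (G y us - G x us - G x (h # us)) \<le> (e * H) * ?P us" if "length us \<le> length vs" for us
        using d1(2)[OF y(1)] d2(2)[OF y(1)] H that vs by (auto simp: H_def h_def)
      have df: "norm (F y us - F x us) \<le> ((1 + K) * H) * ?P us" if "length us \<le> length vs" for us
      proof -
        have "norm (F y us - F x us) \<le> norm (F y us - F x us - F x (h # us)) + norm (F x (h # us))"
          using norm_triangle_ineq[of "F y us - F x us - F x (h # us)" "F x (h # us)"] by simp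
        also have "\<dots> \<le> (e * H) * ?P us + K * ?P (h # us)"
          using rf[OF that] K(2)[of "h # us"] that vs by (intro add_mono) auto
        also have "\<dots> \<le> (1 * H) * ?P us + K * ?P (h # us)"
          using e H by (intro add_right_mono mult_right_mono) (auto intro: prod_list_norm_nonneg)
        finally show ?thesis by (simp add: H_def algebra_simps)
      qed
      have dg: "norm (G y us - G x us) \<le> ((1 + M) * H) * ?P us" if "length us \<le> length vs" for us
      proof -
        have "norm (G y us - G x us) \<le> norm (G y us - G x us - G x (h # us)) + norm (G x (h # us))"
          using norm_triangle_ineq[of "G y us - G x us - G x (h # us)" "G x (h # us)"] by simp
        also have "\<dots> \<le> (e * H) * ?P us + M * ?P (h # us)"
          using rg[OF that] M(2)[of "h # us"] that vs by (intro add_mono) auto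
        also have "\<dots> \<le> (1 * H) * ?P us + M * ?P (h # us)"
          using e H by (intro add_right_mono mult_right_mono) (auto intro: prod_list_norm_nonneg)
        finally show ?thesis by (simp add: H_def algebra_simps)
      qed
      have eq: "L y vs - L x vs - L x (h # vs) =
          leibniz prod (\<lambda>us. F y us - F x us - F x (h # us)) (G x) vs
        + leibniz prod (F x) (\<lambda>us. G y us - G x us - G x (h # us)) vs
        + leibniz prod (\<lambda>us. F y us - F x us) (\<lambda>us. G y us - G x us) vs"
        by (simp add: L_def leibniz_diff_left leibniz_diff_right)
      have k: "length vs \<le> k" using vs by simp
      have "norm (L y vs - L x vs - L x (h # vs)) \<le> C * 2 ^ k * (e * H) * M * ?P vs
          + C * 2 ^ k * K * (e * H) * ?P vs + C * 2 ^ k * ((1 + K) * H) * ((1 + M) * H) * ?P vs"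
        unfolding eq using K M H e k
        by (intro order_trans[OF norm_triangle_ineq] add_mono bd rf rg df dg) auto
      also have "\<dots> = (C * 2 ^ k * M * e + C * 2 ^ k * K * e + A * H) * (H * ?P vs)"
        by (simp add: A_def algebra_simps)
      also have "\<dots> \<le> (A * e + A * e + A * H) * (H * ?P vs)"
      proof (intro mult_right_mono add_mono)
        have "C * 2 ^ k * 1 * M \<le> C * 2 ^ k * (1 + K) * (1 + M)"
          using C K M by (intro mult_mono) auto
        then show "C * 2 ^ k * M \<le> A" by (simp add: A_def)
        have "C * 2 ^ k * K * 1 \<le> C * 2 ^ k * (1 + K) * (1 + M)"
          using C K M by (intro mult_mono) auto
        then show "C * 2 ^ k * K \<le> A" by (simp add: A_def)
      qed (use H e in \<open>auto intro: mult_nonneg_nonneg prod_list_norm_nonneg\<close>)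
      also have "\<dots> \<le> \<epsilon> * (H * ?P vs)"
        using H e by (intro mult_right_mono mult_nonneg_nonneg prod_list_norm_nonneg) auto
      finally show "norm (L y vs - L x vs - L x ((y - x) # vs)) \<le> \<epsilon> * norm (y - x) * ?P vs"
        by (simp add: h_def H_def mult_ac)
    qed
  qed
  then show ?thesis by (rule smooth_uptoI) (simp add: L_def F0 G0)
qed

end


lemma smooth_upto_add:
  fixes f g :: "'a::real_normed_vector \<Rightarrow> 'b::real_normed_vector"
  assumes "smooth_upto k U f" "smooth_upto k U g"
  shows "smooth_upto k U (\<lambda>x. f x + g x)"
proof -
  obtain F G where F: "smooth_jet k U F" and F0: "\<And>x. x \<in> U \<Longrightarrow> F x [] = f x"
    and G: "smooth_jet k U G" and G0: "\<And>x. x \<in> U \<Longrightarrow> G x [] = g x"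
    using assms unfolding smooth_upto_def by blast
  have "smooth_jet k U (\<lambda>x vs. F x vs + G x vs)"
  proof (rule smooth_jetI)
    show "slotwise_linear n (\<lambda>vs. F x vs + G x vs)" if "x \<in> U" "n \<le> k" for x n
      using smooth_jetD_linear[OF F that] smooth_jetD_linear[OF G that]
      by (auto simp: slotwise_linear_def intro!: linear_compose_add)
  next
    fix x assume x: "x \<in> U"
    obtain K where K: "K \<ge> 0" "\<And>vs. length vs \<le> k \<Longrightarrow> norm (F x vs) \<le> K * prod_list (map norm vs)"
      using smooth_jet_bound[OF F x] by blast
    obtain M where M: "M \<ge> 0" "\<And>vs. length vs \<le> k \<Longrightarrow> norm (G x vs) \<le> M * prod_list (map norm vs)"
      using smooth_jet_bound[OF G x] by blast
    have "norm (F x vs + G x vs) \<le> (K + M) * prod_list (map norm vs)" if "length vs \<le> k" for vs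
      using order_trans[OF norm_triangle_ineq add_mono[OF K(2)[OF that] M(2)[OF that]]]
      by (simp add: algebra_simps)
    then show "\<exists>K. \<forall>vs. length vs \<le> k \<longrightarrow> norm (F x vs + G x vs) \<le> K * prod_list (map norm vs)" by blast
  next
    fix x and \<epsilon> :: real assume x: "x \<in> U" and \<epsilon>: "\<epsilon> > 0"
    then have e: "\<epsilon> / 2 > 0" by simp
    obtain d1 where d1: "d1 > 0" "\<And>y vs. y \<in> U \<Longrightarrow> norm (y - x) < d1 \<Longrightarrow> length vs < k \<Longrightarrow>
      norm (F y vs - F x vs - F x ((y - x) # vs)) \<le> \<epsilon> / 2 * norm (y - x) * prod_list (map norm vs)"
      using smooth_jetD_estimate[OF F x e(1)] by metis
    obtain d2 where d2: "d2 > 0" "\<And>y vs. y \<in> U \<Longrightarrow> norm (y - x) < d2 \<Longrightarrow> length vs < k \<Longrightarrow>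
      norm (G y vs - G x vs - G x ((y - x) # vs)) \<le> \<epsilon> / 2 * norm (y - x) * prod_list (map norm vs)"
      using smooth_jetD_estimate[OF G x e(1)] by metis
    show "\<exists>\<delta>>0. \<forall>y\<in>U. norm (y - x) < \<delta> \<longrightarrow> (\<forall>vs. length vs < k \<longrightarrow>
      norm (F y vs + G y vs - (F x vs + G x vs) - (F x ((y - x) # vs) + G x ((y - x) # vs)))
        \<le> \<epsilon> * norm (y - x) * prod_list (map norm vs))"
    proof (intro exI[of _ "min d1 d2"] conjI ballI impI allI)
      fix y and vs :: "'a list" assume y: "y \<in> U" "norm (y - x) < min d1 d2" and vs: "length vs < k"
      have "norm ((F y vs - F x vs - F x ((y - x) # vs)) + (G y vs - G x vs - G x ((y - x) # vs)))
          \<le> \<epsilon> / 2 * norm (y - x) * prod_list (map norm vs) + \<epsilon> / 2 * norm (y - x) * prod_list (map norm vs)"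
        using y vs d1 d2 by (intro order_trans[OF norm_triangle_ineq] add_mono) auto
      then show "norm (F y vs + G y vs - (F x vs + G x vs) - (F x ((y - x) # vs) + G x ((y - x) # vs)))
          \<le> \<epsilon> * norm (y - x) * prod_list (map norm vs)"
        by (simp add: algebra_simps)
    qed (use d1 d2 in auto)
  qed
  then show ?thesis by (rule smooth_uptoI) (simp add: F0 G0)
qed

lemma smooth_jet_has_derivative:
  assumes D: "smooth_jet k U D" and x: "x \<in> U" and U: "open U" and vs: "length vs < k"
  shows "((\<lambda>y. D y vs) has_derivative (\<lambda>h. D x (h # vs))) (at x)"
proof -
  have lin: "linear (\<lambda>h. D x (h # vs))"
    using smooth_jetD_linear[OF D x, of "Suc (length vs)"] vs by (simp add: slotwise_linear_Suc)
  obtain K where K: "\<And>ws. length ws \<le> k \<Longrightarrow> norm (D x ws) \<le> K * prod_list (map norm ws)"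
    using smooth_jet_bound[OF D x] by metis
  have "norm (D x (h # vs)) \<le> norm h * (K * prod_list (map norm vs))" for h
    using K[of "h # vs"] vs by (simp add: mult_ac)
  then have bl: "bounded_linear (\<lambda>h. D x (h # vs))"
    using lin by (intro bounded_linear.intro bounded_linear_axioms.intro) blast+
  show ?thesis
    unfolding has_derivative_at_alt
  proof (intro conjI bl allI impI)
    fix e :: real assume e: "e > 0"
    define P where "P = prod_list (map norm vs) + 1"
    have P: "P > 0" using prod_list_norm_nonneg[of vs] by (simp add: P_def)
    obtain r where r: "r > 0" "ball x r \<subseteq> U" using U x openE by blast
    obtain d where d: "d > 0" "\<And>y vs. y \<in> U \<Longrightarrow> norm (y - x) < d \<Longrightarrow> length vs < k \<Longrightarrow>
      norm (D y vs - D x vs - D x ((y - x) # vs)) \<le> e / P * norm (y - x) * prod_list (map norm vs)"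
      using smooth_jetD_estimate[OF D x, of "e / P"] e P by (metis divide_pos_pos)
    show "\<exists>d>0. \<forall>y. norm (y - x) < d \<longrightarrow> norm (D y vs - D x vs - D x ((y - x) # vs)) \<le> e * norm (y - x)"
    proof (intro exI[of _ "min d r"] conjI allI impI)
      fix y assume y: "norm (y - x) < min d r"
      then have "y \<in> U" using r(2) by (auto simp: ball_def dist_norm norm_minus_commute)
      then have "norm (D y vs - D x vs - D x ((y - x) # vs)) \<le> e / P * norm (y - x) * prod_list (map norm vs)"
        using d(2) y vs by simp
      also have "\<dots> \<le> e / P * norm (y - x) * P"
        using e P by (intro mult_left_mono) (auto simp: P_def)
      finally show "norm (D y vs - D x vs - D x ((y - x) # vs)) \<le> e * norm (y - x)"
        using P by simp
    qed (use d r in auto)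
  qed
qed

text \<open>
  On an open set each order of a jet is the derivative of the previous one, hence determined by it.
\<close>

lemma smooth_jet_unique:
  assumes D: "smooth_jet k U D" and E: "smooth_jet l U E" and U: "open U"
    and eq: "\<And>x. x \<in> U \<Longrightarrow> D x [] = E x []"
  shows "x \<in> U \<Longrightarrow> length vs \<le> k \<Longrightarrow> length vs \<le> l \<Longrightarrow> D x vs = E x vs"
proof (induction vs arbitrary: x)
  case Nil
  then show ?case by (simp add: eq)
next
  case (Cons v vs)
  have "((\<lambda>y. E y vs) has_derivative (\<lambda>h. D x (h # vs))) (at x)"
    by (rule has_derivative_transform_within_open[OF smooth_jet_has_derivative[OF D Cons.prems(1) U] U Cons.prems(1)])
      (use Cons in auto)
  moreover have "((\<lambda>y. E y vs) has_derivative (\<lambda>h. E x (h # vs))) (at x)"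
    by (rule smooth_jet_has_derivative[OF E Cons.prems(1) U]) (use Cons in auto)
  ultimately show ?case using has_derivative_unique by metis
qed

text \<open>
  Jets of different orders agree where both are defined, so they combine into a single jet of infinite order.
\<close>

lemma smooth_on_iff_smooth_upto:
  fixes f :: "'a::real_normed_vector \<Rightarrow> 'b::real_normed_vector"
  assumes U: "open U"
  shows "smooth_on U f \<longleftrightarrow> (\<forall>k. smooth_upto k U f)"
proof
  assume "smooth_on U f"
  then obtain D :: "nat \<Rightarrow> 'a \<Rightarrow> 'a list \<Rightarrow> 'b" where D0: "\<And>x. x \<in> U \<Longrightarrow> D 0 x [] = f x"
    and ml: "\<And>n x. x \<in> U \<Longrightarrow> bounded_multilinear n (D n x)"
    and est: "\<And>n x \<epsilon>. x \<in> U \<Longrightarrow> \<epsilon> > 0 \<Longrightarrow> \<exists>\<delta>>0. \<forall>y\<in>U. norm (y - x) < \<delta> \<longrightarrow>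
      (\<forall>vs. length vs = n \<longrightarrow> norm (D n y vs - D n x vs - D (Suc n) x ((y - x) # vs))
          \<le> \<epsilon> * norm (y - x) * prod_list (map norm vs))"
    unfolding smooth_on_def by metis
  define E where "E x vs = D (length vs) x vs" for x vs
  have "smooth_jet k U E" for k
    unfolding smooth_jet_def
  proof (intro ballI conjI allI impI)
    show "bounded_multilinear n (E x)" if "x \<in> U" for x n
      using ml[OF that, of n] by (auto simp: bounded_multilinear_def E_def)
    fix x and \<epsilon> :: real assume x: "x \<in> U" and \<epsilon>: "\<epsilon> > 0"
    show "\<exists>\<delta>>0. \<forall>y\<in>U. norm (y - x) < \<delta> \<longrightarrow> (\<forall>vs. length vs < k \<longrightarrow>
      norm (E y vs - E x vs - E x ((y - x) # vs)) \<le> \<epsilon> * norm (y - x) * prod_list (map norm vs))"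
    proof (induction k)
      case 0
      show ?case by (intro exI[of _ 1]) auto
    next
      case (Suc k)
      then obtain d where d: "d > 0" "\<And>y vs. y\<in>U \<Longrightarrow> norm (y - x) < d \<Longrightarrow> length vs < k \<Longrightarrow>
        norm (E y vs - E x vs - E x ((y - x) # vs)) \<le> \<epsilon> * norm (y - x) * prod_list (map norm vs)" by metis
      obtain d' where d': "d' > 0" "\<And>y vs. y\<in>U \<Longrightarrow> norm (y - x) < d' \<Longrightarrow> length vs = k \<Longrightarrow>
        norm (E y vs - E x vs - E x ((y - x) # vs)) \<le> \<epsilon> * norm (y - x) * prod_list (map norm vs)"
        using est[OF x \<epsilon>, of k] unfolding E_def by auto
      show ?case
        using d d' by (intro exI[of _ "min d d'"]) (auto simp: less_Suc_eq)
    qed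
  qed
  then show "\<forall>k. smooth_upto k U f"
    unfolding smooth_upto_def using D0 by (auto intro!: exI[of _ E] simp: E_def)
next
  assume "\<forall>k. smooth_upto k U f"
  then obtain D where D: "\<And>k. smooth_jet k U (D k)" and D0: "\<And>k x. x \<in> U \<Longrightarrow> D k x [] = f x"
    unfolding smooth_upto_def by metis
  have eq: "D k x vs = D l x vs" if "x \<in> U" "length vs \<le> k" "length vs \<le> l" for k l x vs
    using smooth_jet_unique[OF D D U _ that] D0 by simp
  show "smooth_on U f"
    unfolding smooth_on_def
  proof (intro exI[of _ D] conjI allI ballI impI)
    show "D 0 x [] = f x" if "x \<in> U" for x using D0[OF that] .
    show "bounded_multilinear n (D n x)" if "x \<in> U" for x n
      using smooth_jetD_multilinear[OF D that] by simp
    fix n x and \<epsilon> :: real assume x: "x \<in> U" and \<epsilon>: "\<epsilon> > 0"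
    obtain d where d: "d > 0" "\<And>y vs. y\<in>U \<Longrightarrow> norm (y - x) < d \<Longrightarrow> length vs < Suc n \<Longrightarrow>
        norm (D (Suc n) y vs - D (Suc n) x vs - D (Suc n) x ((y - x) # vs)) \<le> \<epsilon> * norm (y - x) * prod_list (map norm vs)"
      using smooth_jetD_estimate[OF D x \<epsilon>] by metis
    show "\<exists>\<delta>>0. \<forall>y\<in>U. norm (y - x) < \<delta> \<longrightarrow> (\<forall>vs. length vs = n \<longrightarrow>
        norm (D n y vs - D n x vs - D (Suc n) x ((y - x) # vs)) \<le> \<epsilon> * norm (y - x) * prod_list (map norm vs))"
    proof (intro exI[of _ d] conjI d ballI impI allI)
      fix y and vs :: "'a list" assume y: "y \<in> U" "norm (y - x) < d" and vs: "length vs = n"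
      have "D n y vs = D (Suc n) y vs" "D n x vs = D (Suc n) x vs"
        using vs by (auto intro!: eq y x)
      then show "norm (D n y vs - D n x vs - D (Suc n) x ((y - x) # vs)) \<le> \<epsilon> * norm (y - x) * prod_list (map norm vs)"
        using d(2)[OF y, of vs] vs by simp
    qed
  qed
qed

lemma smooth_upto_differentiable:
  assumes "smooth_upto (Suc k) U f" "x \<in> U" "open U"
  shows "f differentiable (at x)"
proof -
  obtain D where D: "smooth_jet (Suc k) U D" and D0: "\<And>x. x \<in> U \<Longrightarrow> D x [] = f x"
    using assms(1) unfolding smooth_upto_def by blast
  have "(f has_derivative (\<lambda>h. D x (h # []))) (at x)"
    by (rule has_derivative_transform_within_open[OF smooth_jet_has_derivative[OF D assms(2,3), of "[]"] assms(3,2)])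
      (use D0 in auto)
  then show ?thesis by (auto simp: differentiable_def)
qed

text \<open>
  The jet of \<open>f'\<close> is that of \<open>f\<close> with the last argument, which is the direction of the first differentiation,
  split off.
\<close>

lemma smooth_upto_derivative:
  fixes f :: "'a::real_normed_vector \<Rightarrow> 'b::real_normed_vector" and f' :: "'a \<Rightarrow> 'a \<Rightarrow>\<^sub>L 'b"
  assumes f: "smooth_upto (Suc k) U f" and U: "open U"
    and f': "\<And>x. x \<in> U \<Longrightarrow> (f has_derivative blinfun_apply (f' x)) (at x)"
  shows "smooth_upto k U f'"
proof -
  obtain D where D: "smooth_jet (Suc k) U D" and D0: "\<And>x. x \<in> U \<Longrightarrow> D x [] = f x"
    using f unfolding smooth_upto_def by blast
  define E where "E x vs = Blinfun (\<lambda>v. D x (vs @ [v]))" for x vs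
  have bl: "bounded_linear (\<lambda>v. D x (vs @ [v]))" if x: "x \<in> U" and vs: "length vs \<le> k" for x vs
  proof -
    obtain K where K: "\<And>ws. length ws \<le> Suc k \<Longrightarrow> norm (D x ws) \<le> K * prod_list (map norm ws)"
      using smooth_jet_bound[OF D x] by metis
    have "linear (\<lambda>v. D x ((vs @ [0])[length vs := v]))"
      using smooth_jetD_linear[OF D x, of "Suc (length vs)", unfolded slotwise_linear_def,
          rule_format, of "vs @ [0]" "length vs"] vs by (simp del: list_update_length)
    then have "linear (\<lambda>v. D x (vs @ [v]))" by simp
    moreover have "norm (D x (vs @ [v])) \<le> norm v * (K * prod_list (map norm vs))" for v
      using K[of "vs @ [v]"] vs by (simp add: mult_ac)
    ultimately show ?thesis
      by (intro bounded_linear.intro bounded_linear_axioms.intro) blast+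
  qed
  have E: "blinfun_apply (E x vs) v = D x (vs @ [v])" if "x \<in> U" "length vs \<le> k" for x vs v
    unfolding E_def using bl[OF that] by (simp add: bounded_linear_Blinfun_apply)
  have "smooth_jet k U E"
  proof (rule smooth_jetI)
    show "slotwise_linear n (E x)" if x: "x \<in> U" and n: "n \<le> k" for x n
      unfolding slotwise_linear_def
    proof (intro allI impI)
      fix vs :: "'a list" and i assume vs: "length vs = n" and i: "i < n"
      have lin: "linear (\<lambda>w. D x ((vs @ [v])[i := w]))" for v
        using smooth_jetD_linear[OF D x, of "Suc n", unfolded slotwise_linear_def,
          rule_format, of "vs @ [v]" i] vs n i by simp
      show "linear (\<lambda>w. E x (vs[i := w]))"
        using linear_add[OF lin] linear_scale[OF lin] vs i n x
        by (intro linearI blinfun_eqI) (simp_all add: E blinfun.add_left blinfun.scaleR_left list_update_append)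
    qed
  next
    fix x assume x: "x \<in> U"
    obtain K where K: "K \<ge> 0" "\<And>ws. length ws \<le> Suc k \<Longrightarrow> norm (D x ws) \<le> K * prod_list (map norm ws)"
      using smooth_jet_bound[OF D x] by metis
    have "norm (E x vs) \<le> K * prod_list (map norm vs)" if "length vs \<le> k" for vs
    proof (rule norm_blinfun_bound)
      show "norm (blinfun_apply (E x vs) v) \<le> K * prod_list (map norm vs) * norm v" for v
        using K(2)[of "vs @ [v]"] that x by (simp add: E mult_ac)
    qed (use K in \<open>auto intro: mult_nonneg_nonneg prod_list_norm_nonneg\<close>)
    then show "\<exists>K. \<forall>vs. length vs \<le> k \<longrightarrow> norm (E x vs) \<le> K * prod_list (map norm vs)" by blast
  next
    fix x and \<epsilon> :: real assume x: "x \<in> U" and \<epsilon>: "\<epsilon> > 0"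
    obtain d where d: "d > 0" "\<And>y vs. y\<in>U \<Longrightarrow> norm (y - x) < d \<Longrightarrow> length vs < Suc k \<Longrightarrow>
        norm (D y vs - D x vs - D x ((y - x) # vs)) \<le> \<epsilon> * norm (y - x) * prod_list (map norm vs)"
      using smooth_jetD_estimate[OF D x \<epsilon>] by metis
    show "\<exists>\<delta>>0. \<forall>y\<in>U. norm (y - x) < \<delta> \<longrightarrow> (\<forall>vs. length vs < k \<longrightarrow>
        norm (E y vs - E x vs - E x ((y - x) # vs)) \<le> \<epsilon> * norm (y - x) * prod_list (map norm vs))"
    proof (intro exI[of _ d] conjI d ballI impI allI)
      fix y and vs :: "'a list" assume y: "y \<in> U" "norm (y - x) < d" and vs: "length vs < k"
      show "norm (E y vs - E x vs - E x ((y - x) # vs)) \<le> \<epsilon> * norm (y - x) * prod_list (map norm vs)"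
      proof (rule norm_blinfun_bound)
        show "norm (blinfun_apply (E y vs - E x vs - E x ((y - x) # vs)) v)
            \<le> \<epsilon> * norm (y - x) * prod_list (map norm vs) * norm v" for v
          using d(2)[OF y, of "vs @ [v]"] vs x y(1) by (simp add: E blinfun.diff_left mult_ac)
      qed (use \<epsilon> in \<open>auto intro: mult_nonneg_nonneg prod_list_norm_nonneg\<close>)
    qed
  qed
  moreover have "E x [] = f' x" if x: "x \<in> U" for x
  proof (rule blinfun_eqI)
    fix v
    have "(f has_derivative (\<lambda>h. D x (h # []))) (at x)"
      by (rule has_derivative_transform_within_open[OF smooth_jet_has_derivative[OF D x U, of "[]"] U x])
        (use D0 in auto)
    then show "blinfun_apply (E x []) v = blinfun_apply (f' x) v"
      using has_derivative_unique[OF _ f'[OF x]] x by (metis E append_Nil le0 list.size(3))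
  qed
  ultimately show ?thesis unfolding smooth_upto_def by blast
qed

text \<open>
  The converse of \<open>smooth_upto_derivative\<close>; it gains one order of smoothness.
\<close>

lemma smooth_upto_SucI:
  fixes f :: "'a::real_normed_vector \<Rightarrow> 'b::real_normed_vector" and f' :: "'a \<Rightarrow> 'a \<Rightarrow>\<^sub>L 'b"
  assumes f': "smooth_upto k U f'"
    and der: "\<And>x. x \<in> U \<Longrightarrow> (f has_derivative blinfun_apply (f' x)) (at x)"
  shows "smooth_upto (Suc k) U f"
proof -
  obtain D where D: "smooth_jet k U D" and D0: "\<And>x. x \<in> U \<Longrightarrow> D x [] = f' x"
    using f' unfolding smooth_upto_def by blast
  define E where "E x vs = (if vs = [] then f x else blinfun_apply (D x (butlast vs)) (last vs))" for x vs
  have "smooth_jet (Suc k) U E"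
  proof (rule smooth_jetI)
    show "slotwise_linear n (E x)" if x: "x \<in> U" and n: "n \<le> Suc k" for x n
      unfolding slotwise_linear_def
    proof (intro allI impI)
      fix vs :: "'a list" and i assume vs: "length vs = n" and i: "i < n"
      then obtain ws w where ws: "vs = ws @ [w]" by (cases vs rule: rev_cases) auto
      show "linear (\<lambda>v. E x (vs[i := v]))"
      proof (cases "i = length ws")
        case True
        then show ?thesis
          using ws by (auto intro!: linearI simp: E_def list_update_append blinfun.add_right blinfun.scaleR_right)
      next
        case False
        then have i': "i < length ws" using i vs ws by simp
        have lin: "linear (\<lambda>v. D x (ws[i := v]))"
          using smooth_jetD_linear[OF D x, of "length ws"] i' ws vs n by (simp add: slotwise_linear_def)
        show ?thesis
          using linear_add[OF lin] linear_scale[OF lin] ws i'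
          by (auto intro!: linearI simp: E_def list_update_append blinfun.add_left blinfun.scaleR_left)
      qed
    qed
  next
    fix x assume x: "x \<in> U"
    obtain K where K: "K \<ge> 0" "\<And>ws. length ws \<le> k \<Longrightarrow> norm (D x ws) \<le> K * prod_list (map norm ws)"
      using smooth_jet_bound[OF D x] by metis
    have "norm (E x vs) \<le> (K + norm (f x)) * prod_list (map norm vs)" if vs: "length vs \<le> Suc k" for vs
    proof (cases vs rule: rev_cases)
      case Nil
      then show ?thesis using K by (simp add: E_def)
    next
      case (snoc ws w)
      have "norm (E x vs) \<le> norm (D x ws) * norm w" using snoc by (simp add: E_def norm_blinfun)
      also have "\<dots> \<le> (K * prod_list (map norm ws)) * norm w"
        using K(2)[of ws] snoc vs by (intro mult_right_mono) auto
      also have "\<dots> \<le> (K + norm (f x)) * prod_list (map norm vs)"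
        using snoc by (simp add: mult_ac distrib_left prod_list_norm_nonneg)
      finally show ?thesis .
    qed
    then show "\<exists>K. \<forall>vs. length vs \<le> Suc k \<longrightarrow> norm (E x vs) \<le> K * prod_list (map norm vs)" by blast
  next
    fix x and \<epsilon> :: real assume x: "x \<in> U" and \<epsilon>: "\<epsilon> > 0"
    obtain d where d: "d > 0" "\<And>y vs. y\<in>U \<Longrightarrow> norm (y - x) < d \<Longrightarrow> length vs < k \<Longrightarrow>
        norm (D y vs - D x vs - D x ((y - x) # vs)) \<le> \<epsilon> * norm (y - x) * prod_list (map norm vs)"
      using smooth_jetD_estimate[OF D x \<epsilon>] by metis
    obtain d' where d': "d' > 0" "\<And>y. norm (y - x) < d' \<Longrightarrow>
        norm (f y - f x - blinfun_apply (f' x) (y - x)) \<le> \<epsilon> * norm (y - x)"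
      using der[OF x] \<epsilon> unfolding has_derivative_at_alt by blast
    show "\<exists>\<delta>>0. \<forall>y\<in>U. norm (y - x) < \<delta> \<longrightarrow> (\<forall>vs. length vs < Suc k \<longrightarrow>
        norm (E y vs - E x vs - E x ((y - x) # vs)) \<le> \<epsilon> * norm (y - x) * prod_list (map norm vs))"
    proof (intro exI[of _ "min d d'"] conjI ballI impI allI)
      fix y and vs :: "'a list" assume y: "y \<in> U" "norm (y - x) < min d d'" and vs: "length vs < Suc k"
      show "norm (E y vs - E x vs - E x ((y - x) # vs)) \<le> \<epsilon> * norm (y - x) * prod_list (map norm vs)"
      proof (cases vs rule: rev_cases)
        case Nil
        then show ?thesis using d'(2)[of y] y D0[OF x] by (simp add: E_def)
      next
        case (snoc ws w)
        have "norm (E y vs - E x vs - E x ((y - x) # vs)) = norm (blinfun_apply (D y ws - D x ws - D x ((y - x) # ws)) w)"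
          using snoc by (simp add: E_def blinfun.diff_left)
        also have "\<dots> \<le> norm (D y ws - D x ws - D x ((y - x) # ws)) * norm w" by (rule norm_blinfun)
        also have "\<dots> \<le> (\<epsilon> * norm (y - x) * prod_list (map norm ws)) * norm w"
          using d(2)[OF y(1), of ws] y vs snoc by (intro mult_right_mono) auto
        finally show ?thesis using snoc by (simp add: mult_ac)
      qed
    qed (use d d' in auto)
  qed
  then show ?thesis by (rule smooth_uptoI) (simp add: E_def)
qed

lemma smooth_on_differentiable: "smooth_on U f \<Longrightarrow> open U \<Longrightarrow> x \<in> U \<Longrightarrow> f differentiable (at x)"
  using smooth_on_iff_smooth_upto smooth_upto_differentiable by blast

lemma smooth_on_cong:
  "smooth_on U f \<Longrightarrow> open U \<Longrightarrow> (\<And>x. x \<in> U \<Longrightarrow> f x = g x) \<Longrightarrow> smooth_on U g"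
  by (simp add: smooth_on_iff_smooth_upto smooth_upto_cong[of _ U f g])

lemma smooth_on_const: "open U \<Longrightarrow> smooth_on U (\<lambda>_. c)"
  by (simp add: smooth_on_iff_smooth_upto smooth_upto_const)

lemma smooth_on_add:
  "open U \<Longrightarrow> smooth_on U f \<Longrightarrow> smooth_on U g \<Longrightarrow> smooth_on U (\<lambda>x. f x + g x)"
  by (simp add: smooth_on_iff_smooth_upto smooth_upto_add)

lemma smooth_on_bounded_linear:
  "open U \<Longrightarrow> bounded_linear l \<Longrightarrow> smooth_on U f \<Longrightarrow> smooth_on U (\<lambda>x. l (f x))"
  by (simp add: smooth_on_iff_smooth_upto smooth_upto_bounded_linear)

lemma smooth_on_bounded_bilinear:
  "open U \<Longrightarrow> bounded_bilinear B \<Longrightarrow> smooth_on U f \<Longrightarrow> smooth_on U g \<Longrightarrow> smooth_on U (\<lambda>x. B (f x) (g x))"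
  by (simp add: smooth_on_iff_smooth_upto bounded_bilinear.smooth_upto_prod)

lemma smooth_on_derivative:
  fixes f :: "'a::real_normed_vector \<Rightarrow> 'b::real_normed_vector"
  assumes "smooth_on U f" "open U"
  obtains f' :: "'a \<Rightarrow> 'a \<Rightarrow>\<^sub>L 'b"
  where "smooth_on U f'" "\<And>x. x \<in> U \<Longrightarrow> (f has_derivative blinfun_apply (f' x)) (at x)"
proof
  let ?f' = "\<lambda>x. Blinfun (frechet_derivative f (at x))"
  show der: "(f has_derivative blinfun_apply (?f' x)) (at x)" if "x \<in> U" for x
    using smooth_on_differentiable[OF assms that]
    by (metis bounded_linear_Blinfun_apply frechet_derivative_works has_derivative_bounded_linear)
  show "smooth_on U ?f'"
    using assms smooth_upto_derivative[OF _ assms(2) der] by (auto simp: smooth_on_iff_smooth_upto)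
qed

text \<open>
  Bootstrapping: if \<open>f\<close> has a jet of order \<open>k\<close>, so has its derivative \<open>\<Phi> (f x) (f x)\<close>, hence \<open>f\<close> has one of order
  \<open>k + 1\<close>.  This applies to \<open>p \<mapsto> p\<^sup>-\<^sup>1\<close>, whose derivative at \<open>p\<close> is \<open>h \<mapsto> - p\<^sup>-\<^sup>1 h p\<^sup>-\<^sup>1\<close>.
\<close>

lemma smooth_on_quadratic_ode:
  fixes f :: "'a::real_normed_vector \<Rightarrow> 'b::real_normed_vector" and \<Phi> :: "'b \<Rightarrow> 'b \<Rightarrow> 'a \<Rightarrow>\<^sub>L 'b"
  assumes U: "open U" and \<Phi>: "bounded_bilinear \<Phi>"
    and der: "\<And>x. x \<in> U \<Longrightarrow> (f has_derivative blinfun_apply (\<Phi> (f x) (f x))) (at x)"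
  shows "smooth_on U f"
proof -
  have "smooth_upto k U f" for k
  proof (induction k)
    case 0
    have "smooth_jet 0 U (\<lambda>x vs. f x)"
      by (rule smooth_jetI) (auto simp: slotwise_linear_def intro: exI[of _ 1])
    then show ?case unfolding smooth_upto_def by blast
  next
    case (Suc k)
    show ?case
      by (rule smooth_upto_SucI[OF bounded_bilinear.smooth_upto_prod[OF \<Phi> Suc Suc] der])
  qed
  then show ?thesis by (simp add: smooth_on_iff_smooth_upto[OF U])
qed

section \<open>Metrics whose connection has a Christoffel form\<close>

text \<open>
  The second difference of \<open>f\<close> over the parallelogram spanned by \<open>t h\<close> and \<open>t k\<close> is the increment over
  \<open>[0, 1]\<close> of \<open>s \<mapsto> f (p + s t h + t k) - f (p + s t h)\<close>.  The derivative of that function is \<open>t\<^sup>2\<close> times the second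
  derivative of \<open>f\<close> up to \<open>o(t\<^sup>2)\<close>, so the mean value inequality applies.
\<close>

lemma second_difference_estimate:
  fixes f :: "'a::real_normed_vector \<Rightarrow> 'b::real_normed_vector" and f' :: "'a \<Rightarrow> 'a \<Rightarrow>\<^sub>L 'b"
  assumes U: "open U" "p \<in> U" and f': "\<And>x. x \<in> U \<Longrightarrow> (f has_derivative blinfun_apply (f' x)) (at x)"
    and A: "(f' has_derivative A) (at p)" and e: "e > 0"
  shows "\<exists>t0>0. \<forall>t. 0 < t \<and> t < t0 \<longrightarrow>
    norm (f (p + t *\<^sub>R h + t *\<^sub>R k) - f (p + t *\<^sub>R h) - f (p + t *\<^sub>R k) + f p - t\<^sup>2 *\<^sub>R blinfun_apply (A k) h)
      \<le> e * t\<^sup>2 * ((2 * norm h + norm k) * norm h)"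
proof -
  interpret A: bounded_linear A using A by (rule has_derivative_bounded_linear)
  obtain d where d: "d > 0" "\<And>y. norm (y - p) < d \<Longrightarrow> norm (f' y - f' p - A (y - p)) \<le> e * norm (y - p)"
    using A e unfolding has_derivative_at_alt by blast
  obtain r where r: "r > 0" "ball p r \<subseteq> U" using U openE by blast
  define t0 where "t0 = min d r / (1 + norm h + norm k)"
  have n0: "1 + norm h + norm k > 0" by (simp add: add_pos_nonneg)
  then have t0: "t0 > 0" using d r by (simp add: t0_def)
  have "norm (f (p + t *\<^sub>R h + t *\<^sub>R k) - f (p + t *\<^sub>R h) - f (p + t *\<^sub>R k) + f p - t\<^sup>2 *\<^sub>R blinfun_apply (A k) h)
      \<le> e * t\<^sup>2 * ((2 * norm h + norm k) * norm h)" if t: "0 < t" "t < t0" for t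
  proof -
    have tn: "t * (1 + norm h + norm k) < min d r"
      using t n0 by (simp add: t0_def pos_less_divide_eq)
    have near: "norm ((s * t) *\<^sub>R h + u *\<^sub>R k) < min d r"
      if "s \<in> {0..1}" "u \<in> {0, t}" for s u
    proof -
      have "norm ((s * t) *\<^sub>R h + u *\<^sub>R k) \<le> norm ((s * t) *\<^sub>R h) + norm (u *\<^sub>R k)"
        by (rule norm_triangle_ineq)
      also have "\<dots> \<le> t * norm h + t * norm k"
        using that t by (auto intro!: add_mono mult_right_mono simp: mult_left_le_one_le)
      also have "\<dots> \<le> t * (1 + norm h + norm k)" using t by (simp add: algebra_simps)
      finally show ?thesis using tn by simp
    qed
    have inU: "p + (s * t) *\<^sub>R h + u *\<^sub>R k \<in> U" if "s \<in> {0..1}" "u \<in> {0, t}" for s u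
    proof -
      have "dist p (p + (s * t) *\<^sub>R h + u *\<^sub>R k) = norm ((s * t) *\<^sub>R h + u *\<^sub>R k)"
        by (metis add.assoc add_diff_cancel_left' dist_commute dist_norm)
      then show ?thesis using near[OF that] r by (auto simp: subset_iff)
    qed
    define R where "R y = f' y - f' p - A (y - p)" for y
    have R: "norm (R (p + (s * t) *\<^sub>R h + u *\<^sub>R k)) \<le> e * norm ((s * t) *\<^sub>R h + u *\<^sub>R k)"
      if "s \<in> {0..1}" "u \<in> {0, t}" for s u
      unfolding R_def using d(2)[of "p + (s * t) *\<^sub>R h + u *\<^sub>R k"] near[OF that] by (simp add: add.assoc)
    (* The second difference, minus its expected value, as an increment of \<open>q\<close> over \<open>[0, 1]\<close>. *)
    define q where "q s = f (p + (s * t) *\<^sub>R h + t *\<^sub>R k) - f (p + (s * t) *\<^sub>R h) - s *\<^sub>R t\<^sup>2 *\<^sub>R blinfun_apply (A k) h"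
      for s
    define q' where "q' s = blinfun_apply (f' (p + (s * t) *\<^sub>R h + t *\<^sub>R k)) (t *\<^sub>R h)
        - blinfun_apply (f' (p + (s * t) *\<^sub>R h)) (t *\<^sub>R h) - t\<^sup>2 *\<^sub>R blinfun_apply (A k) h" for s
    have der: "(q has_derivative (\<lambda>r. r *\<^sub>R q' s)) (at s within {0..1})" if s: "s \<in> {0..1}" for s
    proof -
      have 1: "((\<lambda>s. f (p + (s * t) *\<^sub>R h + u *\<^sub>R k)) has_derivative
          (\<lambda>r. blinfun_apply (f' (p + (s * t) *\<^sub>R h + u *\<^sub>R k)) ((r * t) *\<^sub>R h))) (at s within {0..1})"
        if "u \<in> {0, t}" for u
        by (rule has_derivative_compose[where f = "\<lambda>s. p + (s * t) *\<^sub>R h + u *\<^sub>R k" and g = f,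
              OF _ f'[OF inU[OF s that]]])
          (auto intro!: derivative_eq_intros)
      have "(q has_derivative (\<lambda>r. blinfun_apply (f' (p + (s * t) *\<^sub>R h + t *\<^sub>R k)) ((r * t) *\<^sub>R h)
          - blinfun_apply (f' (p + (s * t) *\<^sub>R h)) ((r * t) *\<^sub>R h) - r *\<^sub>R t\<^sup>2 *\<^sub>R blinfun_apply (A k) h)) (at s within {0..1})"
        unfolding q_def using 1[of t] 1[of 0]
        by (intro has_derivative_diff has_derivative_scaleR_left) (auto intro!: derivative_intros)
      then show ?thesis
        by (rule has_derivative_eq_rhs)
          (simp add: q'_def fun_eq_iff blinfun.scaleR_right scaleR_diff_right)
    qed
    have bd: "norm (q' s) \<le> e * t\<^sup>2 * ((2 * norm h + norm k) * norm h)" if s: "s \<in> {0..1}" for s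
    proof -
      have "q' s = blinfun_apply (R (p + (s * t) *\<^sub>R h + t *\<^sub>R k) - R (p + (s * t) *\<^sub>R h + 0 *\<^sub>R k)) (t *\<^sub>R h)"
        by (simp add: q'_def R_def A.add A.scaleR blinfun.diff_left blinfun.add_left blinfun.scaleR_left
            blinfun.scaleR_right power2_eq_square algebra_simps)
      then have "norm (q' s) \<le> norm (R (p + (s * t) *\<^sub>R h + t *\<^sub>R k) - R (p + (s * t) *\<^sub>R h + 0 *\<^sub>R k)) * norm (t *\<^sub>R h)"
        by (simp only: norm_blinfun)
      also have "\<dots> \<le> (e * norm ((s * t) *\<^sub>R h + t *\<^sub>R k) + e * norm ((s * t) *\<^sub>R h + 0 *\<^sub>R k)) * norm (t *\<^sub>R h)"
        using s by (intro mult_right_mono order_trans[OF norm_triangle_ineq4] add_mono R) auto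
      also have "\<dots> \<le> (e * (t * norm h + t * norm k) + e * (t * norm h)) * norm (t *\<^sub>R h)"
      proof (intro mult_right_mono add_mono mult_left_mono)
        have st: "s * t * norm h \<le> t * norm h"
          using s t by (intro mult_right_mono) (auto simp: mult_left_le_one_le)
        then show "norm ((s * t) *\<^sub>R h + t *\<^sub>R k) \<le> t * norm h + t * norm k"
          using s t by (intro order_trans[OF norm_triangle_ineq]) (simp add: abs_mult)
        show "norm ((s * t) *\<^sub>R h + 0 *\<^sub>R k) \<le> t * norm h"
          using st s t by (simp add: abs_mult)
      qed (use e in auto)
      also have "\<dots> = e * t\<^sup>2 * ((2 * norm h + norm k) * norm h)"
        using t by (simp add: power2_eq_square algebra_simps)
      finally show ?thesis .
    qed
    have "norm (q 1 - q 0) \<le> e * t\<^sup>2 * ((2 * norm h + norm k) * norm h) * norm (1 - 0 :: real)"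
    proof (rule differentiable_bound[OF convex_real_interval(5)[of 0 1] der])
      show "onorm (\<lambda>r. r *\<^sub>R q' s) \<le> e * t\<^sup>2 * ((2 * norm h + norm k) * norm h)" if "s \<in> {0..1}" for s
        using bd[OF that] e t
        by (intro onorm_bound) (auto simp: mult.commute intro!: mult_left_mono mult_nonneg_nonneg)
    qed auto
    then show ?thesis by (simp add: q_def algebra_simps)
  qed
  then show ?thesis using t0 by blast
qed

text \<open>
  The second difference is symmetric in the two sides of the parallelogram.
\<close>

lemma symmetric_second_derivative:
  fixes f :: "'a::real_normed_vector \<Rightarrow> 'b::real_normed_vector" and f' :: "'a \<Rightarrow> 'a \<Rightarrow>\<^sub>L 'b"
  assumes U: "open U" "p \<in> U" and f': "\<And>x. x \<in> U \<Longrightarrow> (f has_derivative blinfun_apply (f' x)) (at x)"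
    and A: "(f' has_derivative A) (at p)"
  shows "blinfun_apply (A h) k = blinfun_apply (A k) h"
proof -
  define C where "C = (2 * norm h + norm k) * norm h + (2 * norm k + norm h) * norm k"
  have C: "C \<ge> 0" by (simp add: C_def)
  have "norm (blinfun_apply (A h) k - blinfun_apply (A k) h) \<le> e" if e: "e > 0" for e
  proof -
    have e': "e / (C + 1) > 0" using e C by (simp add: add_nonneg_pos)
    obtain t1 where t1: "t1 > 0" "\<And>t. 0 < t \<Longrightarrow> t < t1 \<Longrightarrow>
      norm (f (p + t *\<^sub>R h + t *\<^sub>R k) - f (p + t *\<^sub>R h) - f (p + t *\<^sub>R k) + f p - t\<^sup>2 *\<^sub>R blinfun_apply (A k) h)
        \<le> e / (C + 1) * t\<^sup>2 * ((2 * norm h + norm k) * norm h)"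
      using second_difference_estimate[OF U f' A e', of h k] by blast
    obtain t2 where t2: "t2 > 0" "\<And>t. 0 < t \<Longrightarrow> t < t2 \<Longrightarrow>
      norm (f (p + t *\<^sub>R k + t *\<^sub>R h) - f (p + t *\<^sub>R k) - f (p + t *\<^sub>R h) + f p - t\<^sup>2 *\<^sub>R blinfun_apply (A h) k)
        \<le> e / (C + 1) * t\<^sup>2 * ((2 * norm k + norm h) * norm k)"
      using second_difference_estimate[OF U f' A e', of k h] by blast
    define t where "t = min t1 t2 / 2"
    have t: "0 < t" "t < t1" "t < t2" using t1(1) t2(1) by (auto simp: t_def)
    have "t\<^sup>2 * norm (blinfun_apply (A h) k - blinfun_apply (A k) h)
      = norm ((f (p + t *\<^sub>R h + t *\<^sub>R k) - f (p + t *\<^sub>R h) - f (p + t *\<^sub>R k) + f p - t\<^sup>2 *\<^sub>R blinfun_apply (A k) h)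
        - (f (p + t *\<^sub>R k + t *\<^sub>R h) - f (p + t *\<^sub>R k) - f (p + t *\<^sub>R h) + f p - t\<^sup>2 *\<^sub>R blinfun_apply (A h) k))"
    proof -
      have "t\<^sup>2 * norm (blinfun_apply (A h) k - blinfun_apply (A k) h)
          = norm (t\<^sup>2 *\<^sub>R (blinfun_apply (A h) k - blinfun_apply (A k) h))" by simp
      also have "t\<^sup>2 *\<^sub>R (blinfun_apply (A h) k - blinfun_apply (A k) h) =
          (f (p + t *\<^sub>R h + t *\<^sub>R k) - f (p + t *\<^sub>R h) - f (p + t *\<^sub>R k) + f p - t\<^sup>2 *\<^sub>R blinfun_apply (A k) h)
        - (f (p + t *\<^sub>R k + t *\<^sub>R h) - f (p + t *\<^sub>R k) - f (p + t *\<^sub>R h) + f p - t\<^sup>2 *\<^sub>R blinfun_apply (A h) k)"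
        by (simp add: scaleR_diff_right add_ac)
      finally show ?thesis .
    qed
    also have "\<dots> \<le> e / (C + 1) * t\<^sup>2 * ((2 * norm h + norm k) * norm h)
        + e / (C + 1) * t\<^sup>2 * ((2 * norm k + norm h) * norm k)"
      by (rule order_trans[OF norm_triangle_ineq4 add_mono[OF t1(2)[OF t(1,2)] t2(2)[OF t(1,3)]]])
    also have "\<dots> = t\<^sup>2 * (e / (C + 1) * C)"
    proof -
      have "E * t\<^sup>2 * a + E * t\<^sup>2 * b = t\<^sup>2 * (E * (a + b))" for E a b :: real
        by (simp add: algebra_simps)
      from this[of "e / (C + 1)" "(2 * norm h + norm k) * norm h" "(2 * norm k + norm h) * norm k"]
      show ?thesis by (simp only: C_def[symmetric])
    qed
    finally have "norm (blinfun_apply (A h) k - blinfun_apply (A k) h) \<le> e / (C + 1) * C"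
      by (rule mult_left_le_imp_le) (use t in simp)
    also have "\<dots> \<le> e / (C + 1) * (C + 1)" using e' by (intro mult_left_mono) auto
    finally show ?thesis using C by simp
  qed
  then have "norm (blinfun_apply (A h) k - blinfun_apply (A k) h) \<le> 0" by (rule field_le_epsilon[of _ 0, simplified])
  then show ?thesis by simp
qed

text \<open>
  An open subset of a normed space with a metric and a symmetric form \<open>G\<close> such that \<open>D Y (X) + G X Y\<close> is
  compatible with the metric.  Compatibility is demanded for differentiable fields \<open>Y\<close>, \<open>Z\<close> and not only for
  constant ones, which spares a separate argument that \<open>g\<close> itself is differentiable.  Nondegeneracy is the
  weak one (no vector is orthogonal to all others): the existence of the connection comes from \<open>G\<close> and
  not from an inversion of the metric, so weak nondegeneracy only has to give uniqueness.
\<close>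

locale metric_with_christoffel_form =
  fixes U :: "'a::real_normed_vector set" and g :: "'a \<Rightarrow> 'a \<Rightarrow> 'a \<Rightarrow> real" and G :: "'a \<Rightarrow> 'a \<Rightarrow>\<^sub>L 'a \<Rightarrow>\<^sub>L 'a"
  assumes open_U: "open U"
    and smooth_G: "smooth_on U G"
    and G_commute: "p \<in> U \<Longrightarrow> blinfun_apply (blinfun_apply (G p) x) y = blinfun_apply (blinfun_apply (G p) y) x"
    and g_linear: "p \<in> U \<Longrightarrow> linear (\<lambda>x. g p x y)"
    and g_commute: "p \<in> U \<Longrightarrow> g p x y = g p y x"
    and g_nondegenerate: "p \<in> U \<Longrightarrow> (\<And>z. g p w z = 0) \<Longrightarrow> w = 0"
    and g_has_derivative: "p \<in> U \<Longrightarrow> (Y has_derivative Y') (at p) \<Longrightarrow> (Z has_derivative Z') (at p) \<Longrightarrow>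
      ((\<lambda>q. g q (Y q) (Z q)) has_derivative
        (\<lambda>h. g p (Y' h + blinfun_apply (blinfun_apply (G p) h) (Y p)) (Z p)
           + g p (Y p) (Z' h + blinfun_apply (blinfun_apply (G p) h) (Z p)))) (at p)"
begin

definition nabla :: "('a \<Rightarrow> 'a) \<Rightarrow> ('a \<Rightarrow> 'a) \<Rightarrow> 'a \<Rightarrow> 'a"
  where "nabla X Y p = dir_deriv X Y p + blinfun_apply (blinfun_apply (G p) (X p)) (Y p)"

lemma dir_deriv_eq: "(f has_derivative f') (at p) \<Longrightarrow> dir_deriv X f p = f' (X p)"
  unfolding dir_deriv_def using frechet_derivative_at by metis

lemma dir_deriv_linear: "smooth_on U f \<Longrightarrow> p \<in> U \<Longrightarrow> linear (frechet_derivative f (at p))"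
  by (rule linear_frechet_derivative[OF smooth_on_differentiable[OF _ open_U]])

lemma smooth_has_derivative:
  "smooth_on U f \<Longrightarrow> p \<in> U \<Longrightarrow> (f has_derivative frechet_derivative f (at p)) (at p)"
  using smooth_on_differentiable[OF _ open_U] frechet_derivative_works by blast

lemma smooth_dir_deriv:
  assumes "smooth_on U X" "smooth_on U f"
  shows "smooth_on U (dir_deriv X f)"
proof -
  obtain f' where f': "smooth_on U f'" "\<And>x. x \<in> U \<Longrightarrow> (f has_derivative blinfun_apply (f' x)) (at x)"
    using smooth_on_derivative[OF assms(2) open_U] by blast
  show ?thesis
    by (rule smooth_on_cong[OF smooth_on_bounded_bilinear[OF open_U bounded_bilinear_blinfun_apply f'(1) assms(1)] open_U])
      (simp add: dir_deriv_eq[OF f'(2)])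
qed

lemma smooth_nabla:
  assumes "smooth_on U X" "smooth_on U Y"
  shows "smooth_on U (nabla X Y)"
  unfolding nabla_def
  by (intro smooth_on_add smooth_dir_deriv open_U assms smooth_G
      smooth_on_bounded_bilinear[OF open_U bounded_bilinear_blinfun_apply])

lemma smooth_diff:
  assumes "smooth_on U X" "smooth_on U Y"
  shows "smooth_on U (\<lambda>p. X p - Y p)"
proof -
  have "smooth_on U (\<lambda>p. X p + - Y p)"
    by (intro smooth_on_add open_U assms smooth_on_bounded_linear[of U uminus]
        bounded_linear_minus bounded_linear_ident)
  then show ?thesis by simp
qed

lemma smooth_lie_bracket: "smooth_on U X \<Longrightarrow> smooth_on U Y \<Longrightarrow> smooth_on U (lie_bracket X Y)"
  unfolding lie_bracket_def by (intro smooth_diff smooth_dir_deriv)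

lemma is_levi_civita_nabla: "is_levi_civita U g nabla"
  unfolding is_levi_civita_def
proof (intro conjI allI impI ballI)
  fix X Y :: "'a \<Rightarrow> 'a" assume X: "smooth_on U X" and Y: "smooth_on U Y"
  show "smooth_on U (nabla X Y)" by (rule smooth_nabla[OF X Y])
next
  fix X X' Y :: "'a \<Rightarrow> 'a" and p
  assume "smooth_on U Y" "p \<in> U"
  then show "nabla (\<lambda>q. X q + X' q) Y p = nabla X Y p + nabla X' Y p"
    using linear_add[OF dir_deriv_linear] by (simp add: nabla_def dir_deriv_def blinfun.bilinear_simps)
next
  fix X Y :: "'a \<Rightarrow> 'a" and f :: "'a \<Rightarrow> real" and p
  assume "smooth_on U Y" "p \<in> U"
  then show "nabla (\<lambda>q. f q *\<^sub>R X q) Y p = f p *\<^sub>R nabla X Y p"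
    using linear_scale[OF dir_deriv_linear]
    by (simp add: nabla_def dir_deriv_def blinfun.bilinear_simps scaleR_add_right)
next
  fix X Y Y' :: "'a \<Rightarrow> 'a" and p
  assume "smooth_on U Y" "smooth_on U Y'" "p \<in> U"
  then show "nabla X (\<lambda>q. Y q + Y' q) p = nabla X Y p + nabla X Y' p"
    using dir_deriv_eq[OF has_derivative_add[OF smooth_has_derivative smooth_has_derivative]]
    by (simp add: nabla_def dir_deriv_def blinfun.bilinear_simps)
next
  fix X Y :: "'a \<Rightarrow> 'a" and f :: "'a \<Rightarrow> real" and p
  assume "smooth_on U f" "smooth_on U Y" "p \<in> U"
  then show "nabla X (\<lambda>q. f q *\<^sub>R Y q) p = dir_deriv X f p *\<^sub>R Y p + f p *\<^sub>R nabla X Y p"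
    using dir_deriv_eq[OF has_derivative_scaleR[OF smooth_has_derivative smooth_has_derivative]]
    by (simp add: nabla_def dir_deriv_def blinfun.bilinear_simps scaleR_add_right add_ac)
next
  fix X Y :: "'a \<Rightarrow> 'a" and p
  assume "p \<in> U"
  then show "nabla X Y p - nabla Y X p = lie_bracket X Y p"
    using G_commute[of p "X p" "Y p"] by (simp add: nabla_def lie_bracket_def)
next
  fix X Y Z :: "'a \<Rightarrow> 'a" and p
  assume "smooth_on U Y" "smooth_on U Z" "p \<in> U"
  then show "dir_deriv X (\<lambda>q. g q (Y q) (Z q)) p = g p (nabla X Y p) (Z p) + g p (Y p) (nabla X Z p)"
    using dir_deriv_eq[OF g_has_derivative[OF _ smooth_has_derivative smooth_has_derivative]]
    by (simp add: nabla_def dir_deriv_def)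
qed

lemma levi_civita_compatible:
  "is_levi_civita U g N \<Longrightarrow> smooth_on U X \<Longrightarrow> smooth_on U Y \<Longrightarrow> smooth_on U Z \<Longrightarrow> p \<in> U \<Longrightarrow>
    dir_deriv X (\<lambda>q. g q (Y q) (Z q)) p = g p (N X Y p) (Z p) + g p (Y p) (N X Z p)"
  unfolding is_levi_civita_def by blast

lemma levi_civita_torsion_free:
  "is_levi_civita U g N \<Longrightarrow> smooth_on U X \<Longrightarrow> smooth_on U Y \<Longrightarrow> p \<in> U \<Longrightarrow>
    N X Y p - N Y X p = lie_bracket X Y p"
  unfolding is_levi_civita_def by blast

text \<open>
  The difference \<open>d\<close> of two Levi-Civita connections is symmetric by freeness of torsion, and \<open>g (d X Y) Z\<close> is
  antisymmetric in \<open>Y\<close> and \<open>Z\<close> by compatibility.  A trilinear form that is symmetric in the first two and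
  antisymmetric in the last two arguments vanishes.
\<close>

lemma levi_civita_unique:
  assumes N: "is_levi_civita U g N" and X: "smooth_on U X" and Y: "smooth_on U Y" and p: "p \<in> U"
  shows "N X Y p = nabla X Y p"
proof -
  define d where "d X Y = N X Y p - nabla X Y p" for X Y
  have diff: "g p (x - x') y = g p x y - g p x' y" for x x' y
    using linear_diff[OF g_linear[OF p]] by simp
  have sym: "d X Y = d Y X" if "smooth_on U X" "smooth_on U Y" for X Y
  proof -
    have "N X Y p - N Y X p = nabla X Y p - nabla Y X p"
      using levi_civita_torsion_free[OF N that p] levi_civita_torsion_free[OF is_levi_civita_nabla that p]
      by simp
    then show ?thesis by (simp add: d_def algebra_simps)
  qed
  have anti: "g p (d X Y) (Z p) = - g p (d X Z) (Y p)"
    if "smooth_on U X" "smooth_on U Y" "smooth_on U Z" for X Y Z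
  proof -
    have "g p (N X Y p) (Z p) + g p (Y p) (N X Z p) = g p (nabla X Y p) (Z p) + g p (Y p) (nabla X Z p)"
      using levi_civita_compatible[OF N that p] levi_civita_compatible[OF is_levi_civita_nabla that p]
      by simp
    then show ?thesis
      using g_commute[OF p, of "Y p"] by (simp add: d_def diff)
  qed
  have "g p (d X Y) z = 0" for z
  proof -
    let ?Z = "\<lambda>_ :: 'a. z"
    have Z: "smooth_on U ?Z" by (rule smooth_on_const[OF open_U])
    have "g p (d X Y) (?Z p) = - g p (d ?Z X) (Y p)" using anti[OF X Y Z] sym[OF X Z] by simp
    also have "\<dots> = g p (d Y ?Z) (X p)" using anti[OF Z X Y] sym[OF Y Z] by simp
    also have "\<dots> = - g p (d X Y) (?Z p)" using anti[OF Y Z X] sym[OF X Y] by simp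
    finally show ?thesis by simp
  qed
  then have "d X Y = 0" by (rule g_nondegenerate[OF p])
  then show ?thesis by (simp add: d_def)
qed

text \<open>
  The connection sees only values on \<open>U\<close>, as \<open>U\<close> is open.  This matters for iterated derivatives, since
  the Levi-Civita connection is pinned down only there.
\<close>

lemma nabla_cong:
  assumes "\<And>q. q \<in> U \<Longrightarrow> Y q = Y' q" "smooth_on U Y'" "p \<in> U"
  shows "nabla X Y p = nabla X Y' p"
proof -
  have "(Y has_derivative frechet_derivative Y' (at p)) (at p)"
    by (rule has_derivative_transform_within_open[OF smooth_has_derivative[OF assms(2,3)] open_U assms(3)])
      (simp add: assms(1))
  then show ?thesis
    by (simp add: nabla_def dir_deriv_eq assms(1)[OF assms(3)] dir_deriv_eq[OF smooth_has_derivative[OF assms(2,3)]])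
qed

lemma curvature_op_levi_civita:
  assumes N: "is_levi_civita U g N" and X: "smooth_on U X" and Y: "smooth_on U Y" and Z: "smooth_on U Z"
    and p: "p \<in> U"
  shows "curvature_op N X Y Z p = curvature_op nabla X Y Z p"
proof -
  have NS: "smooth_on U (N X Y)" if "smooth_on U X" "smooth_on U Y" for X Y
    by (rule conjunct1[OF N[unfolded is_levi_civita_def], rule_format, OF that])
  have second: "N X (N Y Z) p = nabla X (nabla Y Z) p" if "smooth_on U X" "smooth_on U Y" for X Y
    using levi_civita_unique[OF N that(1) NS[OF that(2) Z] p]
      nabla_cong[OF levi_civita_unique[OF N that(2) Z] smooth_nabla[OF that(2) Z] p, of X]
    by (rule trans)
  show ?thesis
    unfolding curvature_op_def second[OF X Y] second[OF Y X]
      levi_civita_unique[OF N smooth_lie_bracket[OF X Y] Z p] ..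
qed

text \<open>
  All terms with derivatives of the fields cancel: the second derivative of \<open>Z\<close> by symmetry, those with a
  derivative of \<open>X\<close> or \<open>Y\<close> against the bracket, and those with a first derivative of \<open>Z\<close> because they are symmetric
  in \<open>X\<close> and \<open>Y\<close>.  What is left depends only on the values of the fields at \<open>p\<close>.
\<close>

lemma curvature_op_nabla:
  assumes X: "smooth_on U X" and Y: "smooth_on U Y" and Z: "smooth_on U Z"
    and p: "p \<in> U" and G': "(G has_derivative G') (at p)"
  shows "curvature_op nabla X Y Z p =
    blinfun_apply (blinfun_apply (G' (X p)) (Y p)) (Z p) - blinfun_apply (blinfun_apply (G' (Y p)) (X p)) (Z p)
    + blinfun_apply (blinfun_apply (G p) (X p)) (blinfun_apply (blinfun_apply (G p) (Y p)) (Z p))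
    - blinfun_apply (blinfun_apply (G p) (Y p)) (blinfun_apply (blinfun_apply (G p) (X p)) (Z p))"
proof -
  obtain Z' where Z': "smooth_on U Z'" "\<And>x. x \<in> U \<Longrightarrow> (Z has_derivative blinfun_apply (Z' x)) (at x)"
    using smooth_on_derivative[OF Z open_U] by blast
  define DX where "DX = frechet_derivative X (at p)"
  define DY where "DY = frechet_derivative Y (at p)"
  define A where "A = frechet_derivative Z' (at p)"
  have DX: "(X has_derivative DX) (at p)" and DY: "(Y has_derivative DY) (at p)" and A: "(Z' has_derivative A) (at p)"
    unfolding DX_def DY_def A_def using X Y Z'(1) p by (auto intro: smooth_has_derivative)
  have second: "nabla V (nabla W Z) p =
      blinfun_apply (Z' p) (W' (V p)) + blinfun_apply (A (V p)) (W p)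
      + (blinfun_apply (blinfun_apply (G p) (W p)) (blinfun_apply (Z' p) (V p))
         + (blinfun_apply (blinfun_apply (G p) (W' (V p))) (Z p) + blinfun_apply (blinfun_apply (G' (V p)) (W p)) (Z p)))
      + blinfun_apply (blinfun_apply (G p) (V p))
          (blinfun_apply (Z' p) (W p) + blinfun_apply (blinfun_apply (G p) (W p)) (Z p))"
    if W: "smooth_on U W" and W': "(W has_derivative W') (at p)" for V W W'
  proof -
    let ?N = "\<lambda>q. blinfun_apply (Z' q) (W q) + blinfun_apply (blinfun_apply (G q) (W q)) (Z q)"
    have eq: "nabla W Z q = ?N q" if "q \<in> U" for q
      by (simp add: nabla_def dir_deriv_eq[OF Z'(2)[OF that]])
    have sm: "smooth_on U ?N"
      by (intro smooth_on_add open_U W Z Z' smooth_G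
          smooth_on_bounded_bilinear[OF open_U bounded_bilinear_blinfun_apply])
    have der: "(?N has_derivative (\<lambda>h. blinfun_apply (Z' p) (W' h) + blinfun_apply (A h) (W p)
      + (blinfun_apply (blinfun_apply (G p) (W p)) (blinfun_apply (Z' p) h)
         + blinfun_apply (blinfun_apply (G p) (W' h) + blinfun_apply (G' h) (W p)) (Z p)))) (at p)"
      by (intro has_derivative_add blinfun.FDERIV A W' G' Z'(2)[OF p])
    have "nabla V (nabla W Z) p = nabla V ?N p"
      by (rule nabla_cong[OF eq sm p])
    also have "\<dots> = dir_deriv V ?N p + blinfun_apply (blinfun_apply (G p) (V p)) (?N p)"
      by (rule nabla_def)
    finally show ?thesis
      by (simp add: dir_deriv_eq[OF der] blinfun.add_left)
  qed
  have "nabla (lie_bracket X Y) Z p =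
      blinfun_apply (Z' p) (DY (X p) - DX (Y p)) + blinfun_apply (blinfun_apply (G p) (DY (X p) - DX (Y p))) (Z p)"
    by (simp add: nabla_def dir_deriv_eq[OF Z'(2)[OF p]] lie_bracket_def dir_deriv_eq[OF DX] dir_deriv_eq[OF DY])
  moreover have "blinfun_apply (A (X p)) (Y p) = blinfun_apply (A (Y p)) (X p)"
    by (rule symmetric_second_derivative[OF open_U p Z'(2) A])
  ultimately show ?thesis
    unfolding curvature_op_def second[OF Y DY] second[OF X DX]
    by (simp add: blinfun.add_left blinfun.add_right blinfun.diff_left blinfun.diff_right)
qed

lemma curvature_tensor_eq:
  assumes p: "p \<in> U" and G': "(G has_derivative G') (at p)"
  shows "curvature_tensor U g p x y z =
    blinfun_apply (blinfun_apply (G' x) y) z - blinfun_apply (blinfun_apply (G' y) x) z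
    + blinfun_apply (blinfun_apply (G p) x) (blinfun_apply (blinfun_apply (G p) y) z)
    - blinfun_apply (blinfun_apply (G p) y) (blinfun_apply (blinfun_apply (G p) x) z)" (is "_ = ?R")
  unfolding curvature_tensor_def
proof (rule the_equality)
  have N: "is_levi_civita U g (levi_civita U g)"
    unfolding levi_civita_def by (rule someI[of "is_levi_civita U g", OF is_levi_civita_nabla])
  show *: "\<forall>X Y Z. smooth_on U X \<longrightarrow> smooth_on U Y \<longrightarrow> smooth_on U Z \<longrightarrow> X p = x \<longrightarrow> Y p = y \<longrightarrow> Z p = z \<longrightarrow>
      curvature_op (levi_civita U g) X Y Z p = ?R"
    using curvature_op_levi_civita[OF N _ _ _ p] curvature_op_nabla[OF _ _ _ p G'] by auto
  show "w = ?R" if "\<forall>X Y Z. smooth_on U X \<longrightarrow> smooth_on U Y \<longrightarrow> smooth_on U Z \<longrightarrow> X p = x \<longrightarrow> Y p = y \<longrightarrow> Z p = z \<longrightarrow>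
      curvature_op (levi_civita U g) X Y Z p = w" for w
    using that[rule_format, OF smooth_on_const smooth_on_const smooth_on_const refl refl refl, OF open_U open_U open_U]
      *[rule_format, OF smooth_on_const smooth_on_const smooth_on_const refl refl refl, OF open_U open_U open_U]
    by simp
qed

end

section \<open>Hilbert-Schmidt operators and adjoints\<close>

text \<open>
  Completing the square.  With \<open>c e = cinner v e\<close> this is Bessel's inequality, and for arbitrary \<open>c\<close> it says that
  this choice gives the best approximation of \<open>v\<close>.
\<close>

lemma norm_diff_sum_basis:
  fixes v :: "'h::complex_hilbert_space"
  assumes B: "orthonormal_set B" and F: "finite F" "F \<subseteq> B"
  shows "(norm (v - (\<Sum>e\<in>F. c e *\<^sub>C e)))\<^sup>2 =
    (norm v)\<^sup>2 - (\<Sum>e\<in>F. (cmod (cinner v e))\<^sup>2) + (\<Sum>e\<in>F. (cmod (cinner v e - c e))\<^sup>2)"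
proof -
  define w where "w = (\<Sum>e\<in>F. c e *\<^sub>C e)"
  have we: "cinner w y = (\<Sum>e\<in>F. c e * cinner e y)" for y
    unfolding w_def
    by (simp add: linear_sum[OF bounded_linear.linear[OF bounded_linear_cinner_left]] cinner_scaleC_left)
  have "cinner w e = c e" if e: "e \<in> F" for e
  proof -
    have "cinner w e = (\<Sum>f\<in>F. if f = e then c e else 0)"
      unfolding we using B F e by (intro sum.cong) (auto simp: orthonormal_set_def subset_iff)
    then show ?thesis using F e by simp
  qed
  then have ce: "cinner e w = cnj (c e)" if "e \<in> F" for e
    using that cinner_commute[of e w] by simp
  have ww: "w \<bullet> w = (\<Sum>e\<in>F. (cmod (c e))\<^sup>2)"
    unfolding inner_eq_Re_cinner we Re_sum
    by (intro sum.cong refl) (metis ce Re_complex_of_real complex_norm_square)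
  have wv: "w \<bullet> v = (\<Sum>e\<in>F. Re (c e * cnj (cinner v e)))"
    unfolding inner_eq_Re_cinner we Re_sum
    by (intro sum.cong refl) (metis cinner_commute)
  have sq: "(cmod (a - b))\<^sup>2 = (cmod a)\<^sup>2 - 2 * Re (b * cnj a) + (cmod b)\<^sup>2" for a b :: complex
    by (simp only: cmod_power2) (simp add: power2_eq_square algebra_simps)
  have "(norm (v - w))\<^sup>2 = (norm v)\<^sup>2 - 2 * (w \<bullet> v) + w \<bullet> w"
    by (simp add: power2_norm_eq_inner inner_diff_left inner_diff_right inner_commute)
  then show ?thesis
    by (simp only: w_def[symmetric] ww wv sq sum.distrib sum_subtractf sum_distrib_left[symmetric])
qed

text \<open>
  Density of the span yields a finite combination \<open>w\<close> of basis vectors close to \<open>v\<close>; by the minimality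
  in \<open>norm_diff_sum_basis\<close> every larger finite part of the basis is at least as close.
\<close>

lemma parseval:
  fixes v :: "'h::complex_hilbert_space"
  assumes "orthonormal_basis B"
  shows "((\<lambda>e. (cmod (cinner v e))\<^sup>2) has_sum (norm v)\<^sup>2) B"
  unfolding has_sum_def
proof (rule tendstoI)
  have on: "orthonormal_set B" and dense: "closure (complex_span.span B) = UNIV"
    using assms by (auto simp: orthonormal_basis_def)
  fix r :: real assume r: "r > 0"
  have "v \<in> closure (complex_span.span B)" using dense by simp
  then obtain w where w: "w \<in> complex_span.span B" "dist w v < sqrt r"
    using r unfolding closure_approachable by (metis real_sqrt_gt_zero)
  then obtain t c where t: "finite t" "t \<subseteq> B" "w = (\<Sum>a\<in>t. c a *\<^sub>C a)"
    unfolding complex_span.span_explicit by auto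
  have close: "(norm (v - w))\<^sup>2 < r"
    using w(2) r by (metis dist_commute dist_norm norm_ge_zero real_sqrt_ge_0_iff real_sqrt_less_iff
        real_sqrt_pow2 real_sqrt_unique less_imp_le real_less_rsqrt real_le_rsqrt not_le)
  show "\<forall>\<^sub>F F in finite_subsets_at_top B. dist (\<Sum>e\<in>F. (cmod (cinner v e))\<^sup>2) ((norm v)\<^sup>2) < r"
    unfolding eventually_finite_subsets_at_top
  proof (intro exI[of _ t] conjI t allI impI)
    fix F assume F: "finite F \<and> t \<subseteq> F \<and> F \<subseteq> B"
    then have w: "w = (\<Sum>e\<in>F. (if e \<in> t then c e else 0) *\<^sub>C e)"
      unfolding t(3) by (intro sum.mono_neutral_cong_left) auto
    have "0 \<le> (norm v)\<^sup>2 - (\<Sum>e\<in>F. (cmod (cinner v e))\<^sup>2)"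
      using norm_diff_sum_basis[OF on, of F v "\<lambda>e. cinner v e"] F
      by (metis (no_types, lifting) add.right_neutral diff_self norm_zero power_zero_numeral
          sum.neutral zero_le_power2)
    moreover have "(norm v)\<^sup>2 - (\<Sum>e\<in>F. (cmod (cinner v e))\<^sup>2) \<le> (norm (v - w))\<^sup>2"
      unfolding w using norm_diff_sum_basis[OF on, of F v "\<lambda>e. if e \<in> t then c e else 0"] F
      by (simp add: sum_nonneg)
    ultimately show "dist (\<Sum>e\<in>F. (cmod (cinner v e))\<^sup>2) ((norm v)\<^sup>2) < r"
      using close by (simp add: dist_real_def)
  qed
qed

text \<open>
  Adjunction as a relation: operators built from self-adjoint ones have explicit adjoints, which can then be
  carried along through sums and products.
\<close>

definition adjoint_pair :: "('h::complex_hilbert_space \<Rightarrow>\<^sub>L 'h) \<Rightarrow> ('h \<Rightarrow>\<^sub>L 'h) \<Rightarrow> bool"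
  where "adjoint_pair a b \<longleftrightarrow> (\<forall>x y. cinner (a x) y = cinner x (b y))"

lemma cinner_eqI:
  fixes u v :: "'h::complex_hilbert_space"
  assumes "\<And>x. cinner x u = cinner x v"
  shows "u = v"
proof -
  have "cinner (u - v) (u - v) = 0" using assms by (simp add: cinner_diff_right)
  then show ?thesis by (simp add: cinner_self)
qed

lemma adjoint_pair_sym: "adjoint_pair a b \<Longrightarrow> adjoint_pair b a"
  unfolding adjoint_pair_def by (metis cinner_commute)

lemma adjoint_pair_inner: "adjoint_pair a b \<Longrightarrow> a x \<bullet> y = x \<bullet> b y"
  by (simp add: adjoint_pair_def inner_eq_Re_cinner)

lemma adjoint_pair_unique: "adjoint_pair a b \<Longrightarrow> adjoint_pair a c \<Longrightarrow> b = c"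
  unfolding adjoint_pair_def by (intro blinfun_eqI cinner_eqI) metis

lemma op_adjoint_eq: "adjoint_pair a b \<Longrightarrow> op_adjoint a = b"
  unfolding op_adjoint_def using adjoint_pair_unique
  by (intro the_equality) (auto simp: adjoint_pair_def[symmetric])

lemma adjoint_pair_self: "adjoint_pair a a \<longleftrightarrow> self_adjoint a"
  by (simp add: adjoint_pair_def self_adjoint_def)

lemma adjoint_pair_add: "adjoint_pair a b \<Longrightarrow> adjoint_pair c d \<Longrightarrow> adjoint_pair (a + c) (b + d)"
  by (simp add: adjoint_pair_def blinfun.add_left cinner_add_left cinner_add_right)

lemma adjoint_pair_diff: "adjoint_pair a b \<Longrightarrow> adjoint_pair c d \<Longrightarrow> adjoint_pair (a - c) (b - d)"
  by (simp add: adjoint_pair_def blinfun.diff_left cinner_diff_left cinner_diff_right)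

lemma adjoint_pair_scaleR: "adjoint_pair a b \<Longrightarrow> adjoint_pair (r *\<^sub>R a) (r *\<^sub>R b)"
  by (simp add: adjoint_pair_def blinfun.scaleR_left cinner_scaleR_left cinner_scaleR_right)

lemma adjoint_pair_compose: "adjoint_pair a b \<Longrightarrow> adjoint_pair c d \<Longrightarrow> adjoint_pair (a o\<^sub>L c) (d o\<^sub>L b)"
  by (simp add: adjoint_pair_def)

lemma adjoint_pair_scalar_op: "adjoint_pair (scalar_op (of_real r)) (scalar_op (of_real r))"
  by (simp add: adjoint_pair_def scalar_op.rep_eq cinner_scaleC_left cinner_scaleC_right)

lemma adjoint_pair_complex_linear: "adjoint_pair a b \<Longrightarrow> complex_linear_op a"
proof -
  assume ab: "adjoint_pair a b"
  have "a (c *\<^sub>C x) = c *\<^sub>C a x" for c x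
    by (rule cinner_eqI)
      (use adjoint_pair_sym[OF ab] in \<open>metis adjoint_pair_def cinner_scaleC_right\<close>)
  then show ?thesis by (simp add: complex_linear_op_def)
qed

text \<open>
  Both sides are the sum of the \<open>\<bar>\<langle>a e, f\<rangle>\<bar>\<^sup>2\<close> over all pairs of basis vectors, by Parseval's identity.
\<close>

lemma adjoint_square_has_sum:
  assumes B: "orthonormal_basis B" and ab: "adjoint_pair a b"
    and S: "((\<lambda>e. (norm (a e))\<^sup>2) has_sum S) B"
  shows "((\<lambda>e. (norm (b e))\<^sup>2) has_sum S) B"
proof -
  have 1: "((\<lambda>f. (cmod (cinner (a e) f))\<^sup>2) has_sum (norm (a e))\<^sup>2) B" for e
    by (rule parseval[OF B])
  have "((\<lambda>(e, f). (cmod (cinner (a e) f))\<^sup>2) has_sum S) (B \<times> B)"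
  proof (rule has_sum_SigmaI)
    show "(\<lambda>(e, f). (cmod (cinner (a e) f))\<^sup>2) summable_on B \<times> B"
      by (rule summable_on_SigmaI[where g = "\<lambda>e. (norm (a e))\<^sup>2"])
        (use S 1 in \<open>auto simp: summable_on_def\<close>)
  qed (use S 1 in auto)
  then have "((\<lambda>(f, e). (cmod (cinner (a e) f))\<^sup>2) has_sum S) (B \<times> B)"
    by (subst (asm) has_sum_swap) simp
  moreover have "((\<lambda>e. (cmod (cinner (a e) f))\<^sup>2) has_sum (norm (b f))\<^sup>2) B" for f
  proof -
    have "cmod (cinner (a e) f) = cmod (cinner (b f) e)" for e
      using ab by (metis adjoint_pair_def cinner_commute complex_mod_cnj)
    then show ?thesis using parseval[OF B, of "b f"] by simp
  qed
  ultimately show ?thesis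
    using has_sum_SigmaD[where f = "\<lambda>(f, e). (cmod (cinner (a e) f))\<^sup>2" and A = B and B = "\<lambda>_. B"]
    by (simp only: prod.case)
qed

lemma hilbert_schmidt_adjoint:
  assumes "hilbert_schmidt a" "adjoint_pair a b"
  shows "hilbert_schmidt b"
  using assms adjoint_square_has_sum[OF _ assms(2)] adjoint_pair_complex_linear[OF adjoint_pair_sym[OF assms(2)]]
  unfolding hilbert_schmidt_def summable_on_def by blast

lemma hilbert_schmidt_compose_left:
  assumes "complex_linear_op c" "hilbert_schmidt a"
  shows "hilbert_schmidt (c o\<^sub>L a)"
  unfolding hilbert_schmidt_def
proof (intro conjI allI impI)
  show "complex_linear_op (c o\<^sub>L a)"
    using assms by (simp add: hilbert_schmidt_def complex_linear_op_def)
  fix B :: "'a set" assume "orthonormal_basis B"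
  then have "(\<lambda>e. (norm (a e))\<^sup>2) summable_on B" using assms by (simp add: hilbert_schmidt_def)
  then have "(\<lambda>e. (norm c)\<^sup>2 * (norm (a e))\<^sup>2) summable_on B" by (rule summable_on_cmult_right)
  then show "(\<lambda>e. (norm ((c o\<^sub>L a) e))\<^sup>2) summable_on B"
    by (rule summable_on_comparison_test)
      (simp_all add: power_mult_distrib[symmetric] power_mono norm_blinfun)
qed

text \<open>
  Through the adjoint, \<open>(a c)\<^sup>* = c\<^sup>* a\<^sup>*\<close>, this is \<open>hilbert_schmidt_compose_left\<close>.
\<close>

lemma hilbert_schmidt_compose_right:
  assumes "adjoint_pair c d" "hilbert_schmidt a" "adjoint_pair a b"
  shows "hilbert_schmidt (a o\<^sub>L c)"
proof -
  have "hilbert_schmidt (d o\<^sub>L b)"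
    using assms adjoint_pair_sym by (intro hilbert_schmidt_compose_left adjoint_pair_complex_linear[of d c]
        hilbert_schmidt_adjoint[of a b]) auto
  then show ?thesis
    by (rule hilbert_schmidt_adjoint[OF _ adjoint_pair_sym[OF adjoint_pair_compose[OF assms(3,1)]]])
qed

text \<open>
  The real part of \<open>tr (a b\<^sup>*)\<close>.
\<close>

definition hs_inner :: "('h::complex_hilbert_space \<Rightarrow>\<^sub>L 'h) \<Rightarrow> ('h \<Rightarrow>\<^sub>L 'h) \<Rightarrow> real"
  where "hs_inner a b = (\<Sum>\<^sub>\<infinity>e\<in>(SOME B. orthonormal_basis B). a e \<bullet> b e)"

lemma some_orthonormal_basis: "orthonormal_basis (SOME B :: 'h::complex_hilbert_space set. orthonormal_basis B)"
  by (rule someI_ex[OF ex_orthonormal_basis])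

lemma hilbert_schmidt_summable_inner:
  "hilbert_schmidt a \<Longrightarrow> hilbert_schmidt b \<Longrightarrow> orthonormal_basis B \<Longrightarrow> (\<lambda>e. a e \<bullet> b e) summable_on B"
  using summable_on_Re[OF summable_on_cinner[of a B b]]
  by (simp add: hilbert_schmidt_def inner_eq_Re_cinner)

lemma hs_inner_commute: "hs_inner a b = hs_inner b a"
  by (simp add: hs_inner_def inner_commute)

lemma hs_inner_add_left:
  "hilbert_schmidt a \<Longrightarrow> hilbert_schmidt b \<Longrightarrow> hilbert_schmidt c \<Longrightarrow> hs_inner (a + b) c = hs_inner a c + hs_inner b c"
  unfolding hs_inner_def
  by (simp add: blinfun.add_left inner_add_left infsum_add hilbert_schmidt_summable_inner some_orthonormal_basis)

lemma hs_inner_scaleR_left: "hs_inner (r *\<^sub>R a) b = r * hs_inner a b"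
  unfolding hs_inner_def by (simp add: blinfun.scaleR_left infsum_cmult_right')

lemma hs_inner_diff_left:
  "hilbert_schmidt a \<Longrightarrow> hilbert_schmidt b \<Longrightarrow> hilbert_schmidt c \<Longrightarrow> hs_inner (a - b) c = hs_inner a c - hs_inner b c"
  using hs_inner_add_left[of "a - b" b c] by (simp add: hilbert_schmidt_diff)

lemma hs_inner_diff_right:
  "hilbert_schmidt a \<Longrightarrow> hilbert_schmidt b \<Longrightarrow> hilbert_schmidt c \<Longrightarrow> hs_inner c (a - b) = hs_inner c a - hs_inner c b"
  using hs_inner_diff_left[of a b c] by (simp add: hs_inner_commute)

lemma hs_inner_add_right:
  "hilbert_schmidt a \<Longrightarrow> hilbert_schmidt b \<Longrightarrow> hilbert_schmidt c \<Longrightarrow> hs_inner c (a + b) = hs_inner c a + hs_inner c b"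
  using hs_inner_add_left[of a b c] by (simp add: hs_inner_commute)

lemma hs_inner_self: "hs_inner a a = (\<Sum>\<^sub>\<infinity>e\<in>(SOME B. orthonormal_basis B). (norm (a e))\<^sup>2)"
  by (simp add: hs_inner_def power2_norm_eq_inner)

lemma hs_inner_nonneg: "0 \<le> hs_inner a a"
  unfolding hs_inner_def by (intro infsum_nonneg) simp

lemma hs_inner_adjoint_self:
  assumes "hilbert_schmidt a" "adjoint_pair a b"
  shows "hs_inner a a = hs_inner b b"
proof -
  have "(\<lambda>e. (norm (a e))\<^sup>2) summable_on (SOME B. orthonormal_basis B)"
    using assms(1) some_orthonormal_basis unfolding hilbert_schmidt_def by blast
  then have "((\<lambda>e. (norm (a e))\<^sup>2) has_sum hs_inner a a) (SOME B. orthonormal_basis B)"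
    unfolding hs_inner_self by (rule has_sum_infsum)
  from adjoint_square_has_sum[OF some_orthonormal_basis assms(2) this] show ?thesis
    unfolding hs_inner_self[of b] by (simp add: infsumI)
qed

lemma norm_le_hs_inner:
  assumes "hilbert_schmidt a" "adjoint_pair a b"
  shows "(norm a)\<^sup>2 \<le> hs_inner a a"
proof -
  let ?B = "SOME B :: 'a set. orthonormal_basis B"
  have hb: "hilbert_schmidt b" by (rule hilbert_schmidt_adjoint[OF assms])
  have "norm a \<le> sqrt (hs_inner a a)"
  proof (rule norm_blinfun_bound)
    fix x
    have 1: "((\<lambda>e. (cmod (cinner (a x) e))\<^sup>2) has_sum (norm (a x))\<^sup>2) ?B"
      by (rule parseval[OF some_orthonormal_basis])
    have 2: "((\<lambda>e. (norm x)\<^sup>2 * (norm (b e))\<^sup>2) has_sum ((norm x)\<^sup>2 * hs_inner b b)) ?B"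
      unfolding hs_inner_self using hb some_orthonormal_basis
      by (intro has_sum_cmult_right has_sum_infsum) (auto simp: hilbert_schmidt_def)
    have "cmod (cinner (a x) e) \<le> norm x * norm (b e)" for e
      using assms(2) by (simp add: adjoint_pair_def cmod_cinner_le)
    then have "(norm (a x))\<^sup>2 \<le> (norm x)\<^sup>2 * hs_inner b b"
      by (intro has_sum_mono[OF 1 2]) (simp add: power_mult_distrib[symmetric] power_mono)
    then have "(norm (a x))\<^sup>2 \<le> (sqrt (hs_inner a a) * norm x)\<^sup>2"
      using hs_inner_adjoint_self[OF assms] hs_inner_nonneg[of a] by (simp add: power_mult_distrib mult.commute)
    then show "norm (a x) \<le> sqrt (hs_inner a a) * norm x"
      by (rule power2_le_imp_le) (simp add: hs_inner_nonneg)
  qed (simp add: hs_inner_nonneg)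
  then show ?thesis
    using hs_inner_nonneg[of a] by (metis norm_ge_zero power_mono real_sqrt_pow2)
qed

lemma hs_inner_eq_0_iff:
  assumes "hilbert_schmidt a" "adjoint_pair a b"
  shows "hs_inner a a = 0 \<longleftrightarrow> a = 0"
proof
  show "a = 0" if "hs_inner a a = 0"
    using norm_le_hs_inner[OF assms] that by simp
qed (simp add: hs_inner_def)

text \<open>
  By polarization it is enough to compare square norms.
\<close>

lemma hs_inner_adjoint:
  assumes a: "hilbert_schmidt a" "adjoint_pair a a'" and b: "hilbert_schmidt b" "adjoint_pair b b'"
  shows "hs_inner a b = hs_inner a' b'"
proof -
  have pol: "4 * hs_inner a b = hs_inner (a + b) (a + b) - hs_inner (a - b) (a - b)"
    if "hilbert_schmidt a" "hilbert_schmidt b" for a b :: "'a \<Rightarrow>\<^sub>L 'a"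
    using that by (simp add: hs_inner_add_left hs_inner_add_right hs_inner_diff_left hs_inner_diff_right
        hilbert_schmidt_add hilbert_schmidt_diff hs_inner_commute)
  have ha: "hilbert_schmidt a'" "hilbert_schmidt b'" using hilbert_schmidt_adjoint a b by blast+
  show ?thesis
    using pol[OF a(1) b(1)] pol[OF ha]
      hs_inner_adjoint_self[OF hilbert_schmidt_add[OF a(1) b(1)] adjoint_pair_add[OF a(2) b(2)]]
      hs_inner_adjoint_self[OF hilbert_schmidt_diff[OF a(1) b(1)] adjoint_pair_diff[OF a(2) b(2)]]
    by simp
qed

lemma hs_inner_compose_left:
  "adjoint_pair c d \<Longrightarrow> hs_inner (c o\<^sub>L a) b = hs_inner a (d o\<^sub>L b)"
  by (simp add: hs_inner_def adjoint_pair_inner)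

text \<open>
  Together with \<open>hs_inner_compose_left\<close> this replaces the cyclicity of the trace.
\<close>

lemma hs_inner_compose_right:
  assumes c: "adjoint_pair c d" and a: "hilbert_schmidt a" "adjoint_pair a a'"
    and b: "hilbert_schmidt b" "adjoint_pair b b'"
  shows "hs_inner (a o\<^sub>L c) b = hs_inner a (b o\<^sub>L d)"
proof -
  have "hs_inner (a o\<^sub>L c) b = hs_inner (d o\<^sub>L a') b'"
    by (rule hs_inner_adjoint[OF hilbert_schmidt_compose_right[OF c a] adjoint_pair_compose[OF a(2) c] b])
  also have "\<dots> = hs_inner a' (c o\<^sub>L b')"
    by (rule hs_inner_compose_left[OF adjoint_pair_sym[OF c]])
  also have "\<dots> = hs_inner a (b o\<^sub>L d)"
    by (rule hs_inner_adjoint[OF a hilbert_schmidt_compose_right[OF adjoint_pair_sym[OF c] b]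
        adjoint_pair_compose[OF b(2) adjoint_pair_sym[OF c]], symmetric])
  finally show ?thesis .
qed

lemma hs_inner_compose_self_le:
  assumes "complex_linear_op c" "hilbert_schmidt a"
  shows "hs_inner (c o\<^sub>L a) (c o\<^sub>L a) \<le> (norm c)\<^sup>2 * hs_inner a a"
proof -
  have "hilbert_schmidt (c o\<^sub>L a)" by (rule hilbert_schmidt_compose_left[OF assms])
  then show ?thesis
    unfolding hs_inner_self using assms(2) some_orthonormal_basis
    by (subst infsum_cmult_right'[symmetric], intro infsum_mono summable_on_cmult_right)
      (auto simp: hilbert_schmidt_def power_mult_distrib[symmetric] intro!: power_mono norm_blinfun)
qed

section \<open>Inverses and square roots of positive operators\<close>

instance complex_hilbert_space \<subseteq> banach ..

text \<open>
  The two one-sided inverses are the fixed points of \<open>X \<mapsto> 1 + W X\<close> and \<open>Y \<mapsto> 1 + Y W\<close>.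
\<close>

lemma one_minus_contraction_invertible:
  fixes W :: "'h::banach \<Rightarrow>\<^sub>L 'h"
  assumes "norm W < 1"
  shows "invertible_op (id_blinfun - W)"
proof -
  have "\<exists>!X. id_blinfun + (W o\<^sub>L X) = X"
  proof (rule banach_fix_type)
    show "\<forall>X Y. dist (id_blinfun + (W o\<^sub>L X)) (id_blinfun + (W o\<^sub>L Y)) \<le> norm W * dist X Y"
      by (metis add_diff_cancel_left bounded_bilinear.diff_right bounded_bilinear_blinfun_compose dist_norm
          norm_blinfun_compose)
  qed (use assms in auto)
  then obtain X where X: "X = id_blinfun + (W o\<^sub>L X)" by metis
  have "\<exists>!X. id_blinfun + (X o\<^sub>L W) = X"
  proof (rule banach_fix_type)
    show "\<forall>X Y. dist (id_blinfun + (X o\<^sub>L W)) (id_blinfun + (Y o\<^sub>L W)) \<le> norm W * dist X Y"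
      by (metis add_diff_cancel_left bounded_bilinear.diff_left bounded_bilinear_blinfun_compose dist_norm
          norm_blinfun_compose mult.commute)
  qed (use assms in auto)
  then obtain Y where Y: "Y = id_blinfun + (Y o\<^sub>L W)" by metis
  have Xx: "X x = x + W (X x)" and Yx: "Y x = x + Y (W x)" for x
    using arg_cong[OF X, of "\<lambda>Z. blinfun_apply Z x"] arg_cong[OF Y, of "\<lambda>Z. blinfun_apply Z x"]
    by (simp_all add: blinfun.add_left)
  have 1: "(id_blinfun - W) o\<^sub>L X = id_blinfun"
    by (rule blinfun_eqI) (simp add: blinfun.diff_left diff_eq_eq Xx[symmetric])
  have 2: "Y o\<^sub>L (id_blinfun - W) = id_blinfun"
    by (rule blinfun_eqI) (simp add: blinfun.diff_left blinfun.diff_right diff_eq_eq Yx[symmetric])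
  have "X = Y"
    by (rule blinfun_eqI) (metis 1 2 blinfun_apply_blinfun_compose blinfun_apply_id_blinfun)
  then show ?thesis using 1 2 unfolding invertible_op_def by blast
qed

lemma positive_form_cauchy_schwarz:
  fixes A :: "'h::real_inner \<Rightarrow>\<^sub>L 'h"
  assumes sym: "\<And>x y. A x \<bullet> y = x \<bullet> A y" and pos: "\<And>x. 0 \<le> A x \<bullet> x"
  shows "(A x \<bullet> y)\<^sup>2 \<le> (A x \<bullet> x) * (A y \<bullet> y)"
proof -
  define a b c where "a = A x \<bullet> x" and "b = A x \<bullet> y" and "c = A y \<bullet> y"
  have q: "0 \<le> a + 2 * b * t + c * t\<^sup>2" for t
  proof -
    have "A (x + t *\<^sub>R y) \<bullet> (x + t *\<^sub>R y) = a + 2 * b * t + c * t\<^sup>2"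
      using sym[of y x] by (simp add: a_def b_def c_def blinfun.add_right blinfun.scaleR_right inner_add_left inner_add_right
          power2_eq_square algebra_simps inner_commute)
    then show ?thesis using pos by metis
  qed
  have "b\<^sup>2 \<le> a * c"
  proof (cases "c = 0")
    case True
    have "b = 0"
    proof (rule ccontr)
      assume "b \<noteq> 0"
      then show False using q[of "- (a + 1) / (2 * b)"] True by simp
    qed
    then show ?thesis using True by simp
  next
    case False
    then have c: "c > 0" using pos[of y] by (simp add: c_def)
    have "0 \<le> (a + 2 * b * (- b / c) + c * (- b / c)\<^sup>2) * c"
      using q[of "- b / c"] c by simp
    also have "\<dots> = a * c - b\<^sup>2" using c by (simp add: field_simps power2_eq_square)
    finally show ?thesis by simp
  qed
  then show ?thesis by (simp add: a_def b_def c_def)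
qed

text \<open>
  The Cauchy-Schwarz inequality for the form \<open>A x \<bullet> y\<close>, applied to \<open>x\<close> and \<open>A x\<close>.
\<close>

lemma positive_form_norm_le:
  fixes A :: "'h::real_inner \<Rightarrow>\<^sub>L 'h"
  assumes sym: "\<And>x y. A x \<bullet> y = x \<bullet> A y" and pos: "\<And>x. 0 \<le> A x \<bullet> x"
    and c: "c \<ge> 0" "\<And>x. A x \<bullet> x \<le> c * (norm x)\<^sup>2"
  shows "(norm (A x))\<^sup>2 \<le> c * (A x \<bullet> x)" and "norm A \<le> c"
proof -
  show 1: "(norm (A x))\<^sup>2 \<le> c * (A x \<bullet> x)" for x
  proof (cases "A x = 0")
    case False
    have "(norm (A x))\<^sup>2 * (norm (A x))\<^sup>2 = (A x \<bullet> A x)\<^sup>2"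
      by (simp only: power2_norm_eq_inner power2_eq_square[of "A x \<bullet> A x"])
    also have "\<dots> \<le> (A x \<bullet> x) * (A (A x) \<bullet> A x)"
      by (rule positive_form_cauchy_schwarz[OF sym pos])
    also have "\<dots> \<le> (A x \<bullet> x) * (c * (norm (A x))\<^sup>2)"
      by (intro mult_left_mono c pos)
    also have "\<dots> = (c * (A x \<bullet> x)) * (norm (A x))\<^sup>2" by simp
    finally have "(norm (A x))\<^sup>2 * (norm (A x))\<^sup>2 \<le> (c * (A x \<bullet> x)) * (norm (A x))\<^sup>2" .
    then show ?thesis by (rule mult_right_le_imp_le) (use False in simp)
  qed (use c pos in auto)
  show "norm A \<le> c"
  proof (rule norm_blinfun_bound)
    fix x
    have "(norm (A x))\<^sup>2 \<le> c * (c * (norm x)\<^sup>2)"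
      using 1[of x] c by (meson mult_left_mono order_trans)
    then have "(norm (A x))\<^sup>2 \<le> (c * norm x)\<^sup>2" by (simp add: power2_eq_square mult_ac)
    then show "norm (A x) \<le> c * norm x" by (rule power2_le_imp_le) (use c in simp)
  qed (use c in simp)
qed

lemma positive_op_inner: "positive_op A \<Longrightarrow> 0 \<le> A x \<bullet> x"
  by (simp add: positive_op_def inner_eq_Re_cinner complex_nonneg_Reals_iff)

lemma positive_opI:
  assumes "self_adjoint A" "\<And>x. 0 \<le> A x \<bullet> x"
  shows "positive_op A"
  unfolding positive_op_def complex_nonneg_Reals_iff
proof (intro allI conjI)
  fix x
  show "0 \<le> Re (cinner (A x) x)" using assms(2)[of x] by (simp add: inner_eq_Re_cinner)
  have "cinner (A x) x = cnj (cinner (A x) x)"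
    using assms(1) cinner_commute[of "A x" x] by (simp add: self_adjoint_def)
  then show "Im (cinner (A x) x) = 0" by (metis complex_cnj_cancel_iff complex_is_Real_iff Reals_cnj_iff)
qed

text \<open>
  If \<open>A x \<bullet> x\<close> is small then so is \<open>A x\<close>, by \<open>positive_form_norm_le\<close>, and hence \<open>x\<close>.
\<close>

lemma positive_invertible_lower_bound:
  fixes A :: "'h::complex_hilbert_space \<Rightarrow>\<^sub>L 'h"
  assumes "self_adjoint A" "positive_op A" "invertible_op A"
  obtains \<epsilon> where "\<epsilon> > 0" "\<And>x. \<epsilon> * (norm x)\<^sup>2 \<le> A x \<bullet> x"
proof -
  obtain B where B: "B o\<^sub>L A = id_blinfun" using assms(3) by (auto simp: invertible_op_def)
  have sym: "A x \<bullet> y = x \<bullet> A y" for x y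
    using assms(1) by (simp add: adjoint_pair_inner adjoint_pair_self)
  have up: "A x \<bullet> x \<le> norm A * (norm x)\<^sup>2" for x
  proof -
    have "A x \<bullet> x \<le> norm (A x) * norm x" by (rule norm_cauchy_schwarz)
    also have "\<dots> \<le> (norm A * norm x) * norm x" by (intro mult_right_mono norm_blinfun) simp
    finally show ?thesis by (simp add: power2_eq_square mult_ac)
  qed
  define K where "K = (norm B)\<^sup>2 * norm A + 1"
  have K: "K > 0" by (simp add: K_def add_nonneg_pos)
  have "(norm x)\<^sup>2 \<le> K * (A x \<bullet> x)" for x
  proof -
    have "norm x = norm (B (A x))" by (metis B blinfun_apply_blinfun_compose blinfun_apply_id_blinfun)
    also have "\<dots> \<le> norm B * norm (A x)" by (rule norm_blinfun)
    finally have "(norm x)\<^sup>2 \<le> (norm B * norm (A x))\<^sup>2" by (intro power_mono) auto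
    also have "\<dots> \<le> (norm B)\<^sup>2 * (norm A * (A x \<bullet> x))"
      unfolding power_mult_distrib
      by (intro mult_left_mono positive_form_norm_le(1) sym positive_op_inner[OF assms(2)] up) auto
    also have "\<dots> \<le> K * (A x \<bullet> x)"
      using positive_op_inner[OF assms(2), of x] by (simp add: K_def algebra_simps)
    finally show ?thesis .
  qed
  then show ?thesis using K that[of "1 / K"] by (simp add: field_simps)
qed

text \<open>
  \<open>(1 - Y)\<^sup>2 = 1 - T\<close> is equivalent to \<open>Y = (T + Y\<^sup>2) / 2\<close>, and the right-hand side is a contraction of the closed
  set of self-adjoint operators of norm at most \<open>c\<close>.
\<close>

lemma self_adjoint_contraction_sqrt:
  fixes T :: "'h::complex_hilbert_space \<Rightarrow>\<^sub>L 'h"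
  assumes T: "self_adjoint T" "norm T \<le> c" and c: "c < 1"
  shows "\<exists>S. self_adjoint S \<and> S o\<^sub>L S = id_blinfun - T"
proof -
  have c0: "c \<ge> 0" using T(2) norm_ge_zero order_trans by blast
  define M where "M = {Y :: 'h \<Rightarrow>\<^sub>L 'h. self_adjoint Y \<and> norm Y \<le> c}"
  define f where "f Y = (1/2) *\<^sub>R (T + (Y o\<^sub>L Y))" for Y
  have "\<exists>!Y\<in>M. f Y = Y"
  proof (rule Banach_fix[OF _ _ c0 c])
    have "M = (\<Inter>x. \<Inter>y. {Y :: 'h \<Rightarrow>\<^sub>L 'h. cinner (Y x) y - cinner x (Y y) = 0}) \<inter> {Y. norm Y \<le> c}"
      by (auto simp: M_def self_adjoint_def)
    moreover have "closed {Y :: 'h \<Rightarrow>\<^sub>L 'h. cinner (Y x) y - cinner x (Y y) = 0}" for x y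
    proof -
      have "cinner x (Y y) = cnj (cinner (Y y) x)" for Y :: "'h \<Rightarrow>\<^sub>L 'h" by (rule cinner_commute)
      moreover have "continuous_on UNIV (\<lambda>Y :: 'h \<Rightarrow>\<^sub>L 'h. cinner (Y x) y)" for x y
        by (rule continuous_on_compose2[OF linear_continuous_on[OF bounded_linear_cinner_left], of UNIV])
          (auto intro!: continuous_intros)
      ultimately show ?thesis
        by (intro closed_Collect_eq) (auto intro!: continuous_intros)
    qed
    moreover have "closed {Y :: 'h \<Rightarrow>\<^sub>L 'h. norm Y \<le> c}"
      by (intro closed_Collect_le continuous_intros)
    ultimately have "closed M"
      by (simp only:) (intro closed_Int closed_INT ballI)
    then show "complete M" by (simp add: complete_eq_closed)
    have "0 \<in> M" by (simp add: M_def self_adjoint_zero c0)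
    then show "M \<noteq> {}" by blast
    show "f ` M \<subseteq> M"
    proof
      fix Z assume "Z \<in> f ` M"
      then obtain Y where Y: "self_adjoint Y" "norm Y \<le> c" "Z = f Y" by (auto simp: M_def)
      have "self_adjoint (Y o\<^sub>L Y)" using Y(1) by (simp add: self_adjoint_def)
      then have "self_adjoint Z" unfolding Y(3) f_def by (intro self_adjoint_scaleR self_adjoint_add T)
      moreover have "norm Z \<le> c"
      proof -
        have "norm (T + (Y o\<^sub>L Y)) \<le> c + norm Y * norm Y"
          by (intro order_trans[OF norm_triangle_ineq] add_mono T norm_blinfun_compose)
        also have "\<dots> \<le> c + c * 1"
          using Y(2) c c0 by (intro add_left_mono mult_mono) auto
        finally show ?thesis unfolding Y(3) f_def by simp
      qed
      ultimately show "Z \<in> M" by (simp add: M_def)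
    qed
    fix Y Z assume "Y \<in> M" "Z \<in> M"
    then have YZ: "norm Y \<le> c" "norm Z \<le> c" by (auto simp: M_def)
    have "f Y - f Z = (1/2) *\<^sub>R ((Y o\<^sub>L (Y - Z)) + ((Y - Z) o\<^sub>L Z))"
      by (rule blinfun_eqI) (simp add: f_def blinfun.bilinear_simps algebra_simps)
    then have "dist (f Y) (f Z) = (1/2) * norm ((Y o\<^sub>L (Y - Z)) + ((Y - Z) o\<^sub>L Z))"
      by (simp add: dist_norm)
    also have "\<dots> \<le> (1/2) * (norm Y * norm (Y - Z) + norm (Y - Z) * norm Z)"
      by (intro mult_left_mono order_trans[OF norm_triangle_ineq] add_mono norm_blinfun_compose) auto
    also have "\<dots> \<le> (1/2) * (c * norm (Y - Z) + norm (Y - Z) * c)"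
      using YZ by (intro mult_left_mono add_mono mult_right_mono) auto
    finally show "dist (f Y) (f Z) \<le> c * dist Y Z" by (simp add: dist_norm)
  qed
  then obtain Y where Y: "self_adjoint Y" "f Y = Y" by (auto simp: M_def)
  have 2: "T + (Y o\<^sub>L Y) = 2 *\<^sub>R Y"
  proof -
    have "2 *\<^sub>R f Y = T + (Y o\<^sub>L Y)" by (simp add: f_def)
    then show ?thesis using Y(2) by simp
  qed
  have "self_adjoint (id_blinfun - Y)"
    using Y(1) by (simp add: self_adjoint_def blinfun.diff_left cinner_diff_left cinner_diff_right)
  moreover have "(id_blinfun - Y) o\<^sub>L (id_blinfun - Y) = id_blinfun - T"
  proof (rule blinfun_eqI)
    fix x
    have "T x + Y (Y x) = 2 *\<^sub>R Y x"
      using arg_cong[OF 2, of "\<lambda>Z. blinfun_apply Z x"] by (simp add: blinfun.bilinear_simps)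
    then show "blinfun_apply ((id_blinfun - Y) o\<^sub>L (id_blinfun - Y)) x = blinfun_apply (id_blinfun - T) x"
      by (simp add: blinfun.bilinear_simps algebra_simps scaleR_2)
  qed
  ultimately show ?thesis by blast
qed

text \<open>
  After division by a large \<open>M\<close>, the operator \<open>A\<close> is \<open>1 - T\<close> with \<open>T\<close> a positive contraction of norm less than 1; here the
  lower bound of \<open>A\<close> enters.  Besides the square root also its inverse is returned.
\<close>

lemma positive_invertible_sqrt:
  fixes A :: "'h::complex_hilbert_space \<Rightarrow>\<^sub>L 'h"
  assumes A: "self_adjoint A" "positive_op A" "invertible_op A"
  obtains S R where "self_adjoint S" "self_adjoint R" "S o\<^sub>L S = A" "S o\<^sub>L R = id_blinfun" "R o\<^sub>L S = id_blinfun"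
proof -
  obtain \<epsilon> where eps: "\<epsilon> > 0" "\<And>x. \<epsilon> * (norm x)\<^sup>2 \<le> A x \<bullet> x"
    using positive_invertible_lower_bound[OF A] by blast
  define M where "M = norm A + \<epsilon>"
  have M: "M > 0" "\<epsilon> \<le> M" using eps by (auto simp: M_def add_nonneg_pos)
  define c where "c = 1 - \<epsilon> / M"
  have c: "0 \<le> c" "c < 1" using M eps by (auto simp: c_def field_simps)
  define T where "T = id_blinfun - (1/M) *\<^sub>R A"
  have sT: "self_adjoint T"
    using A(1) by (simp add: self_adjoint_def T_def blinfun.diff_left blinfun.scaleR_left cinner_diff_left
        cinner_diff_right cinner_scaleR_left cinner_scaleR_right)
  have Tx: "T x \<bullet> x = (norm x)\<^sup>2 - (A x \<bullet> x) / M" for x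
    by (simp add: T_def blinfun.diff_left blinfun.scaleR_left inner_diff_left power2_norm_eq_inner)
  have "norm T \<le> c"
  proof (rule positive_form_norm_le(2))
    show "T x \<bullet> y = x \<bullet> T y" for x y
      using sT by (simp add: adjoint_pair_inner adjoint_pair_self)
    show "0 \<le> T x \<bullet> x" for x
    proof -
      have "A x \<bullet> x \<le> norm (A x) * norm x" by (rule norm_cauchy_schwarz)
      also have "\<dots> \<le> (norm A * norm x) * norm x" by (intro mult_right_mono norm_blinfun) simp
      also have "\<dots> \<le> (M * norm x) * norm x" using eps by (intro mult_right_mono) (auto simp: M_def)
      finally show ?thesis using M by (simp add: Tx field_simps power2_eq_square)
    qed
    show "T x \<bullet> x \<le> c * (norm x)\<^sup>2" for x
      using eps(2)[of x] M by (simp add: Tx c_def field_simps)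
  qed (rule c)
  then obtain S where S: "self_adjoint S" "S o\<^sub>L S = id_blinfun - T"
    using self_adjoint_contraction_sqrt[OF sT _ c(2)] by blast
  define S' where "S' = sqrt M *\<^sub>R S"
  have SS: "S' o\<^sub>L S' = A"
  proof (rule blinfun_eqI)
    fix x
    have "S (S x) = (1/M) *\<^sub>R A x"
      using arg_cong[OF S(2), of "\<lambda>Z. blinfun_apply Z x"] by (simp add: T_def blinfun.bilinear_simps)
    then show "blinfun_apply (S' o\<^sub>L S') x = A x"
      using M by (simp add: S'_def blinfun.bilinear_simps)
  qed
  have sS: "self_adjoint S'" unfolding S'_def by (rule self_adjoint_scaleR[OF S(1)])
  obtain B where AB: "A o\<^sub>L B = id_blinfun" and BA: "B o\<^sub>L A = id_blinfun"
    using A(3) by (auto simp: invertible_op_def)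
  have [simp]: "A (B x) = x" "B (A x) = x" "S' (S' x) = A x" for x
    using AB BA SS by (metis blinfun_apply_blinfun_compose blinfun_apply_id_blinfun)+
  have comm: "B (S' x) = S' (B x)" for x
  proof -
    have "S' (A (B x)) = A (S' (B x))" by (metis \<open>\<And>x. S' (S' x) = A x\<close>)
    then show ?thesis by (metis \<open>\<And>x. A (B x) = x\<close> \<open>\<And>x. B (A x) = x\<close>)
  qed
  define R where "R = B o\<^sub>L S'"
  have SR: "S' o\<^sub>L R = id_blinfun" and RS: "R o\<^sub>L S' = id_blinfun"
    by (rule blinfun_eqI; simp add: R_def comm)+
  have "self_adjoint R"
    unfolding self_adjoint_def
  proof (intro allI)
    fix x y
    have "cinner (R x) y = cinner (R x) (S' (R y))"
      by (metis SR blinfun_apply_blinfun_compose blinfun_apply_id_blinfun)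
    also have "\<dots> = cinner (S' (R x)) (R y)" using sS by (simp add: self_adjoint_def)
    also have "\<dots> = cinner x (R y)" by (metis SR blinfun_apply_blinfun_compose blinfun_apply_id_blinfun)
    finally show "cinner (R x) y = cinner x (R y)" .
  qed
  then show ?thesis using that[OF sS _ SS SR RS] by blast
qed

section \<open>The algebra of Hilbert-Schmidt operators plus real scalars\<close>

definition hs_adjointable :: "('h::complex_hilbert_space \<Rightarrow>\<^sub>L 'h) \<Rightarrow> bool"
  where "hs_adjointable a \<longleftrightarrow> hilbert_schmidt a \<and> (\<exists>b. adjoint_pair a b)"

lemma hs_adjointableI: "hilbert_schmidt a \<Longrightarrow> adjoint_pair a b \<Longrightarrow> hs_adjointable a"
  by (auto simp: hs_adjointable_def)

lemma hs_adjointable_adjoint: "hs_adjointable a \<Longrightarrow> adjoint_pair a b \<Longrightarrow> hs_adjointable b"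
  unfolding hs_adjointable_def using adjoint_pair_sym hilbert_schmidt_adjoint by blast

lemma hs_adjointable_zero: "hs_adjointable 0"
  by (rule hs_adjointableI[OF hilbert_schmidt_zero, of 0]) (simp add: adjoint_pair_def)

lemma hs_adjointable_add: "hs_adjointable a \<Longrightarrow> hs_adjointable b \<Longrightarrow> hs_adjointable (a + b)"
  unfolding hs_adjointable_def using adjoint_pair_add hilbert_schmidt_add by blast

lemma hs_adjointable_scaleR: "hs_adjointable a \<Longrightarrow> hs_adjointable (r *\<^sub>R a)"
  unfolding hs_adjointable_def using adjoint_pair_scaleR hilbert_schmidt_scaleR by blast

lemma hs_adjointable_compose_left:
  "adjoint_pair c d \<Longrightarrow> hs_adjointable a \<Longrightarrow> hs_adjointable (c o\<^sub>L a)"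
  unfolding hs_adjointable_def
  using adjoint_pair_compose hilbert_schmidt_compose_left adjoint_pair_complex_linear by blast

lemma hs_adjointable_compose_right:
  "adjoint_pair c d \<Longrightarrow> hs_adjointable a \<Longrightarrow> hs_adjointable (a o\<^sub>L c)"
  unfolding hs_adjointable_def
  using adjoint_pair_compose hilbert_schmidt_compose_right by blast

lemma hs_adjointable_self_adjoint: "hilbert_schmidt a \<Longrightarrow> self_adjoint a \<Longrightarrow> hs_adjointable a"
  using hs_adjointableI[of a a] by (simp add: adjoint_pair_self)

abbreviation real_op :: "real \<Rightarrow> 'h::complex_hilbert_space \<Rightarrow>\<^sub>L 'h"
  where "real_op r \<equiv> scalar_op (complex_of_real r)"

lemma real_op_apply: "real_op r x = r *\<^sub>R x"
  by (simp add: scalar_op.rep_eq scaleC_of_real)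

lemma scalar_op_1: "scalar_op 1 = id_blinfun"
  using real_op_apply[of 1] by (intro blinfun_eqI) simp

text \<open>
  Products such as \<open>x p\<^sup>-\<^sup>1\<close> of self-adjoint operators are no longer self-adjoint; this is the algebra in
  which they live.
\<close>

definition hs_alg_ops :: "('h::separable_hilbert_space \<Rightarrow>\<^sub>L 'h) set"
  where "hs_alg_ops = {a + real_op r | a r. hs_adjointable a}"

lemma hs_alg_opsI: "hs_adjointable a \<Longrightarrow> a + real_op r \<in> hs_alg_ops"
  by (auto simp: hs_alg_ops_def)

lemma hs_alg_opsE:
  assumes "A \<in> hs_alg_ops"
  obtains a b r where "A = a + real_op r" "hs_adjointable a" "adjoint_pair a b"
  using assms unfolding hs_alg_ops_def hs_adjointable_def by blast

lemma hs_alg_ops_real_op: "real_op r \<in> hs_alg_ops"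
  using hs_alg_opsI[OF hs_adjointable_zero, of r] by simp

lemma hs_alg_ops_add: "A \<in> hs_alg_ops \<Longrightarrow> B \<in> hs_alg_ops \<Longrightarrow> A + B \<in> hs_alg_ops"
proof -
  assume "A \<in> hs_alg_ops" "B \<in> hs_alg_ops"
  then obtain a r b s where "A = a + real_op r" "hs_adjointable a" "B = b + real_op s" "hs_adjointable b"
    by (metis hs_alg_opsE)
  then show ?thesis
    using hs_alg_opsI[OF hs_adjointable_add, of a b "r + s"] by (simp add: scalar_op_add[symmetric] add_ac)
qed

lemma hs_alg_ops_scaleR: "A \<in> hs_alg_ops \<Longrightarrow> t *\<^sub>R A \<in> hs_alg_ops"
proof -
  assume "A \<in> hs_alg_ops"
  then obtain a r where "A = a + real_op r" "hs_adjointable a" by (metis hs_alg_opsE)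
  then show ?thesis
    using hs_alg_opsI[OF hs_adjointable_scaleR, of a t "t * r"] by (simp add: scaleR_add_right scalar_op_scaleR)
qed

lemma compose_plus_real_op:
  "(a + real_op r) o\<^sub>L (b + real_op s) = ((a o\<^sub>L b) + s *\<^sub>R a + r *\<^sub>R b) + real_op (r * s)"
  by (rule blinfun_eqI)
    (simp add: real_op_apply blinfun.bilinear_simps scaleR_add_right del: of_real_mult)

lemma hs_alg_ops_compose: "A \<in> hs_alg_ops \<Longrightarrow> B \<in> hs_alg_ops \<Longrightarrow> A o\<^sub>L B \<in> hs_alg_ops"
proof -
  assume "A \<in> hs_alg_ops" "B \<in> hs_alg_ops"
  then obtain a a' r b s where *: "A = a + real_op r" "hs_adjointable a" "adjoint_pair a a'"
      "B = b + real_op s" "hs_adjointable b"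
    by (metis hs_alg_opsE)
  show ?thesis
    unfolding *(1,4) compose_plus_real_op
    by (intro hs_alg_opsI hs_adjointable_add hs_adjointable_scaleR hs_adjointable_compose_left[OF *(3)] *)
qed

lemma adjoint_pair_plus_real_op: "adjoint_pair a b \<Longrightarrow> adjoint_pair (a + real_op r) (b + real_op r)"
  by (rule adjoint_pair_add[OF _ adjoint_pair_scalar_op])

lemma hs_alg_ops_adjoint: "A \<in> hs_alg_ops \<Longrightarrow> adjoint_pair A (op_adjoint A) \<and> op_adjoint A \<in> hs_alg_ops"
proof -
  assume "A \<in> hs_alg_ops"
  then obtain a b r where *: "A = a + real_op r" "hs_adjointable a" "adjoint_pair a b"
    by (metis hs_alg_opsE)
  have "adjoint_pair A (b + real_op r)" unfolding *(1) by (rule adjoint_pair_plus_real_op[OF *(3)])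
  then show ?thesis
    using op_adjoint_eq[of A] hs_alg_opsI[OF hs_adjointable_adjoint[OF *(2,3)]] by simp
qed

typedef (overloaded) 'h hs_alg = "hs_alg_ops :: ('h::separable_hilbert_space \<Rightarrow>\<^sub>L 'h) set"
  morphisms alg_op Abs_hs_alg
  using hs_alg_ops_real_op by blast

setup_lifting type_definition_hs_alg

instantiation hs_alg :: (separable_hilbert_space) real_algebra_1
begin

lift_definition zero_hs_alg :: "'a hs_alg" is 0
  using hs_alg_ops_real_op[of 0] by (simp add: scalar_op_zero)

lift_definition one_hs_alg :: "'a hs_alg" is id_blinfun
  using hs_alg_ops_real_op[of 1] by (simp add: scalar_op_1)

lift_definition plus_hs_alg :: "'a hs_alg \<Rightarrow> 'a hs_alg \<Rightarrow> 'a hs_alg" is "(+)"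
  by (rule hs_alg_ops_add)

lift_definition uminus_hs_alg :: "'a hs_alg \<Rightarrow> 'a hs_alg" is uminus
  using hs_alg_ops_scaleR[of _ "- 1"] by simp

lift_definition minus_hs_alg :: "'a hs_alg \<Rightarrow> 'a hs_alg \<Rightarrow> 'a hs_alg" is "(-)"
  using hs_alg_ops_add[OF _ hs_alg_ops_scaleR[of _ "- 1"]] by simp

lift_definition times_hs_alg :: "'a hs_alg \<Rightarrow> 'a hs_alg \<Rightarrow> 'a hs_alg" is "(o\<^sub>L)"
  by (rule hs_alg_ops_compose)

lift_definition scaleR_hs_alg :: "real \<Rightarrow> 'a hs_alg \<Rightarrow> 'a hs_alg" is scaleR
  by (rule hs_alg_ops_scaleR)

instance
proof
  show "(0 :: 'a hs_alg) \<noteq> 1"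
  proof
    assume "(0 :: 'a hs_alg) = 1"
    then have "alg_op (0 :: 'a hs_alg) = alg_op 1" by simp
    then have "(0 :: 'a \<Rightarrow>\<^sub>L 'a) = scalar_op 1"
      by (simp add: zero_hs_alg.rep_eq one_hs_alg.rep_eq scalar_op_1)
    then have "(1 :: complex) = 0"
      using hilbert_schmidt_zero by (intro hilbert_schmidt_scalar_op[where 'h = 'a]) simp
    then show False by simp
  qed
qed (transfer, auto intro!: blinfun_eqI simp: blinfun.bilinear_simps algebra_simps)+

end

instantiation hs_alg :: (separable_hilbert_space) real_inner
begin

definition inner_hs_alg :: "'a hs_alg \<Rightarrow> 'a hs_alg \<Rightarrow> real"
  where "inner_hs_alg A B = 4 * hs_inner (hs_part (alg_op A)) (hs_part (alg_op B))
    + Re (scalar_part (alg_op A)) * Re (scalar_part (alg_op B))"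

definition norm_hs_alg :: "'a hs_alg \<Rightarrow> real"
  where "norm_hs_alg x = sqrt (x \<bullet> x)"

definition sgn_hs_alg :: "'a hs_alg \<Rightarrow> 'a hs_alg"
  where "sgn_hs_alg x = x /\<^sub>R norm x"

definition dist_hs_alg :: "'a hs_alg \<Rightarrow> 'a hs_alg \<Rightarrow> real"
  where "dist_hs_alg x y = norm (x - y)"

definition uniformity_hs_alg :: "('a hs_alg \<times> 'a hs_alg) filter"
  where "uniformity_hs_alg = (INF e\<in>{0 <..}. principal {(x, y). dist x y < e})"

definition open_hs_alg :: "'a hs_alg set \<Rightarrow> bool"
  where "open_hs_alg U = (\<forall>x\<in>U. eventually (\<lambda>(x', y). x' = x \<longrightarrow> y \<in> U) uniformity)"

lemma inner_hs_alg_eq: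
  assumes "alg_op A = a + real_op r" "hs_adjointable a" "alg_op B = b + real_op s" "hs_adjointable b"
  shows "A \<bullet> B = 4 * hs_inner a b + r * s"
  using assms by (simp add: inner_hs_alg_def hs_adjointable_def hs_part_eq scalar_part_eq)

lemma hs_alg_cases:
  obtains a b r where "alg_op A = a + real_op r" "hs_adjointable a" "adjoint_pair a b"
  using alg_op[of A] by (rule hs_alg_opsE)

instance
proof
  fix x y z :: "'a hs_alg" and t :: real
  obtain a a' r where x: "alg_op x = a + real_op r" "hs_adjointable a" "adjoint_pair a a'"
    by (rule hs_alg_cases)
  obtain b b' s where y: "alg_op y = b + real_op s" "hs_adjointable b" "adjoint_pair b b'"
    by (rule hs_alg_cases)
  obtain c c' u where z: "alg_op z = c + real_op u" "hs_adjointable c" "adjoint_pair c c'"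
    by (rule hs_alg_cases)
  show "dist x y = norm (x - y)" by (rule dist_hs_alg_def)
  show "sgn x = x /\<^sub>R norm x" by (rule sgn_hs_alg_def)
  show "norm x = sqrt (x \<bullet> x)" by (rule norm_hs_alg_def)
  show "x \<bullet> y = y \<bullet> x"
    by (simp add: inner_hs_alg_def hs_inner_commute mult.commute)
  have xy: "alg_op (x + y) = (a + b) + real_op (r + s)"
    by (simp add: plus_hs_alg.rep_eq x y scalar_op_add[symmetric])
  show "(x + y) \<bullet> z = x \<bullet> z + y \<bullet> z"
    unfolding inner_hs_alg_eq[OF xy hs_adjointable_add[OF x(2) y(2)] z(1,2)]
      inner_hs_alg_eq[OF x(1,2) z(1,2)] inner_hs_alg_eq[OF y(1,2) z(1,2)]
    using x(2) y(2) z(2) by (simp add: hs_adjointable_def hs_inner_add_left algebra_simps)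
  have tx: "alg_op (t *\<^sub>R x) = (t *\<^sub>R a) + real_op (t * r)"
    by (simp add: scaleR_hs_alg.rep_eq x scalar_op_scaleR scaleR_add_right)
  show "(t *\<^sub>R x) \<bullet> y = t * (x \<bullet> y)"
    unfolding inner_hs_alg_eq[OF tx hs_adjointable_scaleR[OF x(2)] y(1,2)] inner_hs_alg_eq[OF x(1,2) y(1,2)]
    by (simp add: hs_inner_scaleR_left algebra_simps)
  show "0 \<le> x \<bullet> x"
    unfolding inner_hs_alg_eq[OF x(1,2) x(1,2)] by (simp add: hs_inner_nonneg)
  show "x \<bullet> x = 0 \<longleftrightarrow> x = 0"
  proof
    assume "x \<bullet> x = 0"
    then have "hs_inner a a = 0" "r = 0"
      using hs_inner_nonneg[of a] zero_le_square[of r] unfolding inner_hs_alg_eq[OF x(1,2) x(1,2)]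
      by (smt (verit) mult_eq_0_iff)+
    then have "a = 0" using hs_inner_eq_0_iff[OF _ x(3)] x(2) by (simp add: hs_adjointable_def)
    then have "alg_op x = alg_op 0"
      using x(1) \<open>r = 0\<close> by (simp add: zero_hs_alg.rep_eq scalar_op_zero)
    then show "x = 0" by (simp add: alg_op_inject)
  next
    assume "x = 0"
    then have "alg_op x = 0 + real_op 0" by (simp add: zero_hs_alg.rep_eq scalar_op_zero)
    from inner_hs_alg_eq[OF this hs_adjointable_zero this hs_adjointable_zero]
    show "x \<bullet> x = 0" by (simp add: hs_inner_def)
  qed
qed (simp_all only: uniformity_hs_alg_def open_hs_alg_def)

end

lift_definition star :: "'h::separable_hilbert_space hs_alg \<Rightarrow> 'h hs_alg" is op_adjoint
  using hs_alg_ops_adjoint by blast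

lemma adjoint_pair_star: "adjoint_pair (alg_op A) (alg_op (star A))"
  using hs_alg_ops_adjoint[OF alg_op[of A]] by (simp add: star.rep_eq)

lemma star_eqI: "adjoint_pair (alg_op A) (alg_op B) \<Longrightarrow> star A = B"
  using adjoint_pair_unique[OF adjoint_pair_star] alg_op_inject by metis

lemma star_mult: "star (A * B) = star B * star A"
  by (intro star_eqI) (simp add: times_hs_alg.rep_eq adjoint_pair_compose adjoint_pair_star)

lemma star_add: "star (A + B) = star A + star B"
  by (intro star_eqI) (simp add: plus_hs_alg.rep_eq adjoint_pair_add adjoint_pair_star)

lemma star_scaleR: "star (r *\<^sub>R A) = r *\<^sub>R star A"
  by (intro star_eqI) (simp add: scaleR_hs_alg.rep_eq adjoint_pair_scaleR adjoint_pair_star)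

lemma star_cases:
  obtains a b r where "alg_op A = a + real_op r" "alg_op (star A) = b + real_op r"
    "hs_adjointable a" "hs_adjointable b" "adjoint_pair a b"
proof -
  obtain a b r where *: "alg_op A = a + real_op r" "hs_adjointable a" "adjoint_pair a b"
    by (rule hs_alg_cases)
  have "alg_op (star A) = b + real_op r"
    using adjoint_pair_unique[OF adjoint_pair_star[of A]] adjoint_pair_plus_real_op[OF *(3), of r]
    by (simp add: *(1))
  then show ?thesis using that * hs_adjointable_adjoint by blast
qed

text \<open>
  The scalar part is real and thus fixed by the adjunction, and the Hilbert-Schmidt part is handled by
  \<open>hs_inner_adjoint\<close>.
\<close>

lemma inner_star: "star A \<bullet> star B = A \<bullet> (B :: 'h::separable_hilbert_space hs_alg)"
proof -
  obtain a a' r where A: "alg_op A = a + real_op r" "alg_op (star A) = a' + real_op r"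
    "hs_adjointable a" "hs_adjointable a'" "adjoint_pair a a'" by (rule star_cases)
  obtain b b' s where B: "alg_op B = b + real_op s" "alg_op (star B) = b' + real_op s"
    "hs_adjointable b" "hs_adjointable b'" "adjoint_pair b b'" by (rule star_cases)
  have "hs_inner a b = hs_inner a' b'"
    using hs_inner_adjoint[OF _ A(5) _ B(5)] A(3) B(3) by (simp add: hs_adjointable_def)
  then show ?thesis
    by (simp add: inner_hs_alg_eq[OF A(1,3) B(1,3)] inner_hs_alg_eq[OF A(2,4) B(2,4)])
qed

text \<open>
  In \<open>\<langle>A, B\<rangle>\<^sub>2\<close> the traces have weight 4 and the scalars are paired among themselves, so \<open>\<langle>C A, B\<rangle> = \<langle>A, C\<^sup>* B\<rangle>\<close> fails
  in general when scalar parts are present.  Commutators have scalar part 0 and do not see the scalar parts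
  of their entries, so for them the identity holds.  All the geometry rests on this form of invariance.
\<close>

lemma inner_commutator:
  fixes A B C :: "'h::separable_hilbert_space hs_alg"
  shows "(C * A - A * C) \<bullet> B = A \<bullet> (star C * B - B * star C)"
proof -
  obtain a a' r where A: "alg_op A = a + real_op r" "alg_op (star A) = a' + real_op r"
    "hs_adjointable a" "hs_adjointable a'" "adjoint_pair a a'" by (rule star_cases)
  obtain b b' s where B: "alg_op B = b + real_op s" "alg_op (star B) = b' + real_op s"
    "hs_adjointable b" "hs_adjointable b'" "adjoint_pair b b'" by (rule star_cases)
  obtain c c' u where C: "alg_op C = c + real_op u" "alg_op (star C) = c' + real_op u"
    "hs_adjointable c" "hs_adjointable c'" "adjoint_pair c c'" by (rule star_cases)
  note c' = adjoint_pair_sym[OF C(5)]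
  have comm: "alg_op (X * Y - Y * X) = ((x o\<^sub>L y) + (- 1) *\<^sub>R (y o\<^sub>L x)) + real_op 0"
    if "alg_op X = x + real_op p" "alg_op Y = y + real_op q" for X Y :: "'h hs_alg" and x y p q
    unfolding minus_hs_alg.rep_eq times_hs_alg.rep_eq that compose_plus_real_op
    by (simp add: mult.commute[of p q] scalar_op_zero add_ac)
  have hs: "hs_adjointable ((x o\<^sub>L y) + (- 1) *\<^sub>R (y o\<^sub>L x))"
    if "adjoint_pair x x'" "hs_adjointable y" for x x' y :: "'h \<Rightarrow>\<^sub>L 'h"
    using that by (intro hs_adjointable_add hs_adjointable_scaleR hs_adjointable_compose_left hs_adjointable_compose_right)
  have HS: "hilbert_schmidt x" if "hs_adjointable x" for x :: "'h \<Rightarrow>\<^sub>L 'h"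
    using that by (simp add: hs_adjointable_def)
  have "hs_inner ((c o\<^sub>L a) - (a o\<^sub>L c)) b = hs_inner a ((c' o\<^sub>L b) - (b o\<^sub>L c'))"
    using hs_inner_compose_left[OF C(5), of a b] hs_inner_compose_right[OF C(5) HS[OF A(3)] A(5) HS[OF B(3)] B(5)]
      HS[OF hs_adjointable_compose_left[OF C(5) A(3)]] HS[OF hs_adjointable_compose_right[OF C(5) A(3)]]
      HS[OF hs_adjointable_compose_left[OF c' B(3)]] HS[OF hs_adjointable_compose_right[OF c' B(3)]]
      HS[OF A(3)] HS[OF B(3)]
    by (simp add: hs_inner_diff_left hs_inner_diff_right)
  then show ?thesis
    by (simp add: inner_hs_alg_eq[OF comm[OF C(1) A(1)] hs[OF C(5) A(3)] B(1,3)]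
        inner_hs_alg_eq[OF A(1,3) comm[OF C(2) B(1)] hs[OF c' B(3)]])
qed

lemma Re_inner2: "Re (inner2 (alg_op A) (alg_op B)) = A \<bullet> B"
proof -
  obtain a a' r where A: "alg_op A = a + real_op r" "alg_op (star A) = a' + real_op r"
    "hs_adjointable a" "hs_adjointable a'" "adjoint_pair a a'" by (rule star_cases)
  obtain b b' s where B: "alg_op B = b + real_op s" "alg_op (star B) = b' + real_op s"
    "hs_adjointable b" "hs_adjointable b'" "adjoint_pair b b'" by (rule star_cases)
  have HS: "hilbert_schmidt a" "hilbert_schmidt b" "hilbert_schmidt a'" "hilbert_schmidt b'"
    using A B by (auto simp: hs_adjointable_def)
  let ?B = "SOME B :: 'a set. orthonormal_basis B"
  have s: "(\<lambda>e. cinner (b' e) (a' e)) summable_on ?B"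
    using HS some_orthonormal_basis unfolding hilbert_schmidt_def by (intro summable_on_cinner) blast+
  have "Re (op_trace (a o\<^sub>L b')) = hs_inner b' a'"
    unfolding op_trace_def hs_inner_def inner_eq_Re_cinner infsum_Re[OF s]
    using A(5) by (simp add: adjoint_pair_def)
  also have "\<dots> = hs_inner a b"
    using hs_inner_adjoint[OF HS(1) A(5) HS(2) B(5)] by (simp add: hs_inner_commute)
  finally show ?thesis
    by (simp add: inner2_def A B inner_hs_alg_eq[OF A(1,3) B(1,3)] hs_part_eq[OF HS(1)] hs_part_eq[OF HS(2)]
        scalar_part_eq[OF HS(1)] scalar_part_eq[OF HS(2)] op_adjoint_eq[OF B(5)])
qed

lemma norm_alg_op_le: "norm (alg_op A) \<le> 2 * norm (A :: 'h::separable_hilbert_space hs_alg)"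
proof -
  obtain a b r where A: "alg_op A = a + real_op r" "hs_adjointable a" "adjoint_pair a b"
    by (rule hs_alg_cases)
  have n: "(norm A)\<^sup>2 = 4 * hs_inner a a + r * r"
    by (simp add: power2_norm_eq_inner inner_hs_alg_eq[OF A(1,2) A(1,2)])
  have a: "(norm a)\<^sup>2 \<le> hs_inner a a"
    using norm_le_hs_inner[OF _ A(3)] A(2) by (simp add: hs_adjointable_def)
  have "norm (real_op r :: 'h \<Rightarrow>\<^sub>L 'h) \<le> \<bar>r\<bar>"
    by (rule norm_blinfun_bound) (simp_all add: real_op_apply)
  then have 1: "norm (alg_op A) \<le> norm a + \<bar>r\<bar>"
    unfolding A(1) by (rule order_trans[OF norm_triangle_ineq add_left_mono])
  have "(norm a + \<bar>r\<bar>)\<^sup>2 \<le> 2 * (norm a)\<^sup>2 + 2 * r\<^sup>2"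
    using zero_le_power2[of "norm a - \<bar>r\<bar>"] by (simp add: power2_eq_square algebra_simps)
  also have "\<dots> \<le> (2 * norm A)\<^sup>2"
    using a n hs_inner_nonneg[of a] zero_le_square[of r] unfolding power_mult_distrib power2_eq_square
    by linarith
  finally have "norm a + \<bar>r\<bar> \<le> 2 * norm A" by (rule power2_le_imp_le) simp
  with 1 show ?thesis by linarith
qed

text \<open>
  The constant is crude.  Up to constants, the Hilbert-Schmidt part of \<open>(a + r) (b + s)\<close> has square norm at most
  \<open>N a * N b + s\<^sup>2 * N a + r\<^sup>2 * N b\<close>.
\<close>

lemma norm_mult_hs_alg_le: "norm (A * B) \<le> 3 * norm A * norm (B :: 'h::separable_hilbert_space hs_alg)"
proof -
  obtain a a' r where A: "alg_op A = a + real_op r" "hs_adjointable a" "adjoint_pair a a'"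
    by (rule hs_alg_cases)
  obtain b b' s where B: "alg_op B = b + real_op s" "hs_adjointable b" "adjoint_pair b b'"
    by (rule hs_alg_cases)
  define N where "N x = hs_inner x x" for x :: "'h \<Rightarrow>\<^sub>L 'h"
  have N0: "0 \<le> N x" for x by (simp add: N_def hs_inner_nonneg)
  have Nadd: "N (x + y) \<le> 2 * N x + 2 * N y" if "hs_adjointable x" "hs_adjointable y" for x y
  proof -
    have "N (x + y) + N (x - y) = 2 * N x + 2 * N y"
      using that by (simp add: N_def hs_adjointable_def hs_inner_add_left hs_inner_add_right hs_inner_diff_left
          hs_inner_diff_right hilbert_schmidt_add hilbert_schmidt_diff)
    then show ?thesis using N0[of "x - y"] by linarith
  qed
  have Nsc: "N (t *\<^sub>R x) = t\<^sup>2 * N x" for t x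
    using hs_inner_commute[of x "t *\<^sub>R x"] by (simp add: N_def hs_inner_scaleR_left power2_eq_square)
  have ab: "hs_adjointable (a o\<^sub>L b)" by (rule hs_adjointable_compose_left[OF A(3) B(2)])
  have "(norm a)\<^sup>2 \<le> N a"
    using norm_le_hs_inner[OF _ A(3)] A(2) by (simp add: hs_adjointable_def N_def)
  then have Nab: "N (a o\<^sub>L b) \<le> N a * N b"
    using hs_inner_compose_self_le[OF adjoint_pair_complex_linear[OF A(3)], of b] B(2) N0[of b]
    unfolding N_def[symmetric] hs_adjointable_def by (meson mult_right_mono order_trans)
  have op: "alg_op (A * B) = ((a o\<^sub>L b) + s *\<^sub>R a + r *\<^sub>R b) + real_op (r * s)"
    by (simp only: times_hs_alg.rep_eq A(1) B(1) compose_plus_real_op)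
  have hs: "hs_adjointable ((a o\<^sub>L b) + s *\<^sub>R a)" "hs_adjointable (s *\<^sub>R a)" "hs_adjointable (r *\<^sub>R b)"
    by (intro hs_adjointable_add hs_adjointable_scaleR ab A B)+
  have "N ((a o\<^sub>L b) + s *\<^sub>R a + r *\<^sub>R b) \<le> 4 * (N a * N b) + 4 * (s\<^sup>2 * N a) + 2 * (r\<^sup>2 * N b)"
    using Nadd[OF hs(1,3)] Nadd[OF ab hs(2)] Nab by (simp add: Nsc)
  moreover have "(norm (A * B))\<^sup>2 = 4 * N ((a o\<^sub>L b) + s *\<^sub>R a + r *\<^sub>R b) + r\<^sup>2 * s\<^sup>2"
    unfolding power2_norm_eq_inner
    using inner_hs_alg_eq[OF op hs_adjointable_add[OF hs(1,3)] op hs_adjointable_add[OF hs(1,3)]]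
    by (simp add: N_def power2_eq_square[of r] power2_eq_square[of s])
  moreover have "9 * ((norm A)\<^sup>2 * (norm B)\<^sup>2)
      = 144 * (N a * N b) + 36 * (s\<^sup>2 * N a) + 36 * (r\<^sup>2 * N b) + 9 * (r\<^sup>2 * s\<^sup>2)"
  proof -
    have "(norm A)\<^sup>2 = 4 * N a + r\<^sup>2" "(norm B)\<^sup>2 = 4 * N b + s\<^sup>2"
      by (simp_all only: power2_norm_eq_inner inner_hs_alg_eq[OF A(1,2) A(1,2)]
          inner_hs_alg_eq[OF B(1,2) B(1,2)] N_def power2_eq_square[of r] power2_eq_square[of s])
    then show ?thesis by (simp add: algebra_simps)
  qed
  moreover have "0 \<le> N a * N b" "0 \<le> s\<^sup>2 * N a" "0 \<le> r\<^sup>2 * N b" "0 \<le> r\<^sup>2 * s\<^sup>2"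
    by (intro mult_nonneg_nonneg N0 zero_le_power2)+
  ultimately have "(norm (A * B))\<^sup>2 \<le> 9 * ((norm A)\<^sup>2 * (norm B)\<^sup>2)"
    by linarith
  also have "\<dots> = (3 * norm A * norm B)\<^sup>2" by (simp add: power_mult_distrib)
  finally show ?thesis by (rule power2_le_imp_le) simp
qed

lemma bounded_bilinear_mult_hs_alg:
  "bounded_bilinear ((*) :: 'h::separable_hilbert_space hs_alg \<Rightarrow> 'h hs_alg \<Rightarrow> 'h hs_alg)"
  by standard (auto simp: algebra_simps intro!: exI[of _ 3] norm_mult_hs_alg_le[THEN order_trans])

lemma hs_real_ops_subset: "hs_real_ops \<subseteq> hs_alg_ops"
  unfolding hs_real_ops_def hs_alg_ops_def using hs_adjointable_self_adjoint by blast

text \<open>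
  The isometric inclusion of the model space of the manifold into the algebra.
\<close>

definition alg_of :: "'h::separable_hilbert_space hs_real \<Rightarrow> 'h hs_alg"
  where "alg_of x = Abs_hs_alg (op_of x)"

lemma alg_op_alg_of: "alg_op (alg_of x) = op_of x"
  unfolding alg_of_def using hs_real_ops_subset op_of by (intro Abs_hs_alg_inverse) blast

lemma alg_of_inject: "alg_of x = alg_of y \<longleftrightarrow> x = y"
  by (metis alg_op_alg_of op_of_inject)

lemma linear_alg_of: "linear alg_of"
  by (intro linearI; rule alg_op_inject[THEN iffD1])
    (simp_all add: alg_op_alg_of plus_hs_alg.rep_eq plus_hs_real.rep_eq scaleR_hs_alg.rep_eq scaleR_hs_real.rep_eq)

lemmas alg_of_add = linear_add[OF linear_alg_of]
  and alg_of_diff = linear_diff[OF linear_alg_of]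
  and alg_of_scaleR = linear_scale[OF linear_alg_of]
  and alg_of_0 = linear_0[OF linear_alg_of]
  and alg_of_minus = linear_neg[OF linear_alg_of]

lemma inner_alg_of: "alg_of x \<bullet> alg_of y = x \<bullet> y"
  unfolding Re_inner2[symmetric] alg_op_alg_of inner_hs_real_def ..

lemma norm_alg_of: "norm (alg_of x) = norm x"
  by (simp add: norm_eq_sqrt_inner inner_alg_of)

lemma bounded_linear_alg_of: "bounded_linear alg_of"
  using linear_alg_of by (intro bounded_linear.intro bounded_linear_axioms.intro exI[of _ 1]) (simp_all add: norm_alg_of)

lemma star_alg_of: "star (alg_of x) = alg_of x"
proof (rule star_eqI)
  obtain a r where "op_of x = a + real_op r" "self_adjoint a" by (rule hs_real_cases)
  then show "adjoint_pair (alg_op (alg_of x)) (alg_op (alg_of x))"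
    using adjoint_pair_plus_real_op[of a a r] by (simp only: alg_op_alg_of adjoint_pair_self)
qed

lemma self_adjoint_op_of: "self_adjoint (op_of x)"
  using adjoint_pair_star[of "alg_of x"] by (simp add: star_alg_of alg_op_alg_of adjoint_pair_self)

lemma star_fixed_iff: "star A = A \<longleftrightarrow> A \<in> range alg_of"
proof
  assume fixed: "star A = A"
  obtain a b r where A: "alg_op A = a + real_op r" "alg_op (star A) = b + real_op r"
    "hs_adjointable a" "hs_adjointable b" "adjoint_pair a b" by (rule star_cases)
  then have "b = a" using fixed by simp
  then have "alg_op A \<in> hs_real_ops"
    unfolding hs_real_ops_def using A by (auto simp: adjoint_pair_self hs_adjointable_def)
  then have "alg_of (Abs_hs_real (alg_op A)) = A"
    by (intro alg_op_inject[THEN iffD1]) (simp add: alg_op_alg_of Abs_hs_real_inverse)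
  then show "A \<in> range alg_of" by (metis rangeI)
qed (auto simp: star_alg_of)

section \<open>Positive invertible operators\<close>

text \<open>
  If \<open>S\<^sup>2 = j\<close> and \<open>M = S K S\<close>, then \<open>j K = S M S\<^sup>-\<^sup>1\<close> and \<open>K j = S\<^sup>-\<^sup>1 M S\<close>.  The inner product of these two is
  that of \<open>M\<close> with itself, as \<open>S\<close> can be moved from one argument to the other.  This gives both the definiteness
  of the metric and the sign of the curvature.  In the proof \<open>D\<close> is the Hilbert-Schmidt part of \<open>M\<close>.
\<close>

lemma inner_mult_positive:
  fixes j :: "'h::separable_hilbert_space hs_real" and K :: "'h hs_alg"
  assumes j: "j \<in> Sigma_manifold"
  shows "0 \<le> (alg_of j * K) \<bullet> (K * alg_of j)"
    and "(alg_of j * K) \<bullet> (K * alg_of j) = 0 \<Longrightarrow> alg_of j * K = 0"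
proof -
  obtain S R where SR: "self_adjoint S" "self_adjoint R" "S o\<^sub>L S = op_of j"
      "S o\<^sub>L R = id_blinfun" "R o\<^sub>L S = id_blinfun"
    using j positive_invertible_sqrt[OF self_adjoint_op_of] unfolding Sigma_manifold_def by blast
  then have S: "adjoint_pair S S" and R: "adjoint_pair R R" by (simp_all add: adjoint_pair_self)
  have [simp]: "S (R v) = v" "R (S v) = v" for v
    using SR(4,5) by (metis blinfun_apply_blinfun_compose blinfun_apply_id_blinfun)+
  define k where "k = alg_op K"
  obtain a a' \<mu> where a: "alg_op (alg_of j * K) = a + real_op \<mu>" "hs_adjointable a" "adjoint_pair a a'"
    by (rule hs_alg_cases)
  define D where "D = (R o\<^sub>L a) o\<^sub>L S"
  have D: "hs_adjointable D" "adjoint_pair D (S o\<^sub>L (a' o\<^sub>L R))"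
    unfolding D_def
    by (intro hs_adjointable_compose_right[OF S] hs_adjointable_compose_left[OF R] a
        adjoint_pair_compose R S)+
  have jk: "S (S (k v)) = a v + \<mu> *\<^sub>R v" for v
    using arg_cong[OF a(1), of "\<lambda>Z. blinfun_apply Z v"]
    by (simp add: times_hs_alg.rep_eq alg_op_alg_of SR(3)[symmetric] k_def blinfun.add_left real_op_apply)
  have kj: "alg_op (K * alg_of j) = ((R o\<^sub>L D) o\<^sub>L S) + real_op \<mu>"
  proof (rule blinfun_eqI)
    fix v
    have "a (S (S v)) = S (S (k (S (S v)))) - \<mu> *\<^sub>R S (S v)" using jk[of "S (S v)"] by simp
    then have "R (R (a (S (S v)))) = k (S (S v)) - \<mu> *\<^sub>R v"
      by (simp add: blinfun.diff_right blinfun.scaleR_right)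
    then show "alg_op (K * alg_of j) v = (((R o\<^sub>L D) o\<^sub>L S) + real_op \<mu>) v"
      by (simp add: times_hs_alg.rep_eq alg_op_alg_of SR(3)[symmetric] k_def blinfun.add_left real_op_apply D_def)
  qed
  have a_D: "a = S o\<^sub>L (D o\<^sub>L R)"
    by (rule blinfun_eqI) (simp add: D_def)
  have DR: "hs_adjointable (D o\<^sub>L R)" "hs_adjointable (D o\<^sub>L S)"
    by (intro hs_adjointable_compose_right[OF R] hs_adjointable_compose_right[OF S] D)+
  have RDS: "hs_adjointable ((R o\<^sub>L D) o\<^sub>L S)"
    by (intro hs_adjointable_compose_right[OF S] hs_adjointable_compose_left[OF R] D)
  have "hs_inner a ((R o\<^sub>L D) o\<^sub>L S) = hs_inner (D o\<^sub>L R) (S o\<^sub>L ((R o\<^sub>L D) o\<^sub>L S))"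
    unfolding a_D by (rule hs_inner_compose_left[OF S])
  also have "S o\<^sub>L ((R o\<^sub>L D) o\<^sub>L S) = D o\<^sub>L S" by (rule blinfun_eqI) simp
  also have "hs_inner (D o\<^sub>L R) (D o\<^sub>L S) = hs_inner D ((D o\<^sub>L S) o\<^sub>L R)"
    using D DR by (intro hs_inner_compose_right[OF R _ D(2) _ adjoint_pair_compose[OF D(2) S]])
      (auto simp: hs_adjointable_def)
  also have "(D o\<^sub>L S) o\<^sub>L R = D" by (rule blinfun_eqI) simp
  finally have eq: "(alg_of j * K) \<bullet> (K * alg_of j) = 4 * hs_inner D D + \<mu> * \<mu>"
    using inner_hs_alg_eq[OF a(1,2) kj RDS] by simp
  then show "0 \<le> (alg_of j * K) \<bullet> (K * alg_of j)" by (simp add: hs_inner_nonneg)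
  assume "(alg_of j * K) \<bullet> (K * alg_of j) = 0"
  then have "4 * hs_inner D D + \<mu> * \<mu> = 0" using eq by simp
  then have "hs_inner D D = 0" "\<mu> = 0"
    using hs_inner_nonneg[of D] zero_le_square[of \<mu>] by (smt (verit) mult_eq_0_iff)+
  then have "D = 0" using hs_inner_eq_0_iff[OF _ D(2)] D(1) by (simp add: hs_adjointable_def)
  then have "a = 0" unfolding a_D by (intro blinfun_eqI) simp
  then have "alg_op (alg_of j * K) = alg_op 0"
    using a(1) \<open>\<mu> = 0\<close> by (simp add: zero_hs_alg.rep_eq scalar_op_zero)
  then show "alg_of j * K = 0" by (simp add: alg_op_inject)
qed

definition sigma_inv :: "'h::separable_hilbert_space hs_real \<Rightarrow> 'h hs_real"
  where "sigma_inv p = Abs_hs_real (op_inverse (op_of p))"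

lemma op_inverse_eq:
  assumes "a o\<^sub>L b = id_blinfun" "b o\<^sub>L a = id_blinfun"
  shows "op_inverse a = b"
  unfolding op_inverse_def
proof (rule the_equality)
  fix c assume c: "a o\<^sub>L c = id_blinfun \<and> c o\<^sub>L a = id_blinfun"
  then show "c = b"
    using assms by (intro blinfun_eqI) (metis blinfun_apply_blinfun_compose blinfun_apply_id_blinfun)
qed (use assms in auto)

text \<open>
  The inverse of \<open>a + r\<close> is \<open>1 / r - (1 / r) (a + r)\<^sup>-\<^sup>1 a\<close>, and \<open>r \<noteq> 0\<close> because otherwise \<open>1 = (a + r)\<^sup>-\<^sup>1 a\<close> would be
  Hilbert-Schmidt.
\<close>

lemma op_inverse_in_hs_real_ops:
  fixes p :: "'h::separable_hilbert_space hs_real"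
  assumes p: "p \<in> Sigma_manifold"
  shows "op_of p o\<^sub>L op_inverse (op_of p) = id_blinfun" "op_inverse (op_of p) o\<^sub>L op_of p = id_blinfun"
    and "op_inverse (op_of p) \<in> hs_real_ops"
proof -
  obtain b where b: "op_of p o\<^sub>L b = id_blinfun" "b o\<^sub>L op_of p = id_blinfun"
    using p by (auto simp: Sigma_manifold_def invertible_op_def)
  have inv: "op_inverse (op_of p) = b" by (rule op_inverse_eq[OF b])
  show "op_of p o\<^sub>L op_inverse (op_of p) = id_blinfun" "op_inverse (op_of p) o\<^sub>L op_of p = id_blinfun"
    by (simp_all add: inv b)
  have pb: "op_of p (b v) = v" "b (op_of p v) = v" for v
    using b by (metis blinfun_apply_blinfun_compose blinfun_apply_id_blinfun)+
  have sb: "self_adjoint b"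
    unfolding self_adjoint_def
  proof (intro allI)
    fix x y
    have "cinner (b x) y = cinner (b x) (op_of p (b y))" by (simp add: pb)
    also have "\<dots> = cinner (op_of p (b x)) (b y)" using self_adjoint_op_of[of p] by (simp add: self_adjoint_def)
    finally show "cinner (b x) y = cinner x (b y)" by (simp add: pb)
  qed
  then have ab: "adjoint_pair b b" by (simp add: adjoint_pair_self)
  obtain a r where a: "op_of p = a + real_op r" "hilbert_schmidt a" "self_adjoint a"
    by (rule hs_real_cases)
  have ba: "hilbert_schmidt (b o\<^sub>L a)"
    by (rule hilbert_schmidt_compose_left[OF adjoint_pair_complex_linear[OF ab] a(2)])
  have bv: "b (a v) + r *\<^sub>R b v = v" for v
    using pb(2)[of v] by (simp add: a(1) blinfun.add_left blinfun.add_right blinfun.scaleR_right real_op_apply)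
  have "r \<noteq> 0"
  proof
    assume "r = 0"
    then have "b o\<^sub>L a = scalar_op 1"
      using bv by (intro blinfun_eqI) (simp add: scalar_op_1)
    then have "(1 :: complex) = 0"
      using ba by (intro hilbert_schmidt_scalar_op[where 'h = 'h]) simp
    then show False by simp
  qed
  define c where "c = (- 1 / r) *\<^sub>R (b o\<^sub>L a)"
  have bc: "b = c + real_op (1 / r)"
  proof (rule blinfun_eqI)
    fix v
    have "r *\<^sub>R b v = v - b (a v)" using bv[of v] by (simp add: algebra_simps)
    then have "b v = (1 / r) *\<^sub>R (v - b (a v))" using \<open>r \<noteq> 0\<close> by (metis divide_self_if real_vector.scale_one scaleR_scaleR times_divide_eq_left mult_1)
    then show "b v = (c + real_op (1 / r)) v"
      by (simp add: c_def blinfun.add_left blinfun.diff_left blinfun.scaleR_left blinfun.minus_left real_op_apply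
          scaleR_diff_right del: of_real_divide)
  qed
  have "hilbert_schmidt c" unfolding c_def by (rule hilbert_schmidt_scaleR[OF ba])
  moreover have "self_adjoint c"
  proof -
    have "adjoint_pair (b - real_op (1 / r)) (b - real_op (1 / r))"
      by (rule adjoint_pair_diff[OF ab adjoint_pair_scalar_op])
    then show ?thesis by (simp add: bc adjoint_pair_self)
  qed
  ultimately show "op_inverse (op_of p) \<in> hs_real_ops"
    unfolding inv hs_real_ops_def using bc by blast
qed

lemma op_of_sigma_inv: "p \<in> Sigma_manifold \<Longrightarrow> op_of (sigma_inv p) = op_inverse (op_of p)"
  unfolding sigma_inv_def by (intro Abs_hs_real_inverse op_inverse_in_hs_real_ops)

lemma sigma_inv_mult:
  assumes "p \<in> Sigma_manifold"
  shows "alg_of p * alg_of (sigma_inv p) = 1" "alg_of (sigma_inv p) * alg_of p = 1"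
  using op_inverse_in_hs_real_ops(1,2)[OF assms]
  by (intro alg_op_inject[THEN iffD1];
      simp add: times_hs_alg.rep_eq one_hs_alg.rep_eq alg_op_alg_of op_of_sigma_inv[OF assms])+

lemma sigma_inv_in_Sigma:
  fixes p :: "'h::separable_hilbert_space hs_real"
  assumes p: "p \<in> Sigma_manifold"
  shows "sigma_inv p \<in> Sigma_manifold"
proof -
  note inv = op_inverse_in_hs_real_ops[OF p, folded op_of_sigma_inv[OF p]]
  have "0 \<le> op_of (sigma_inv p) x \<bullet> x" for x
  proof -
    have "op_of p (op_of (sigma_inv p) x) = x"
      using inv(1) by (metis blinfun_apply_blinfun_compose blinfun_apply_id_blinfun)
    then show ?thesis
      using p positive_op_inner[of "op_of p" "op_of (sigma_inv p) x"]
      by (simp add: Sigma_manifold_def inner_commute)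
  qed
  then have "positive_op (op_of (sigma_inv p))" by (rule positive_opI[OF self_adjoint_op_of])
  then show ?thesis using inv unfolding Sigma_manifold_def invertible_op_def by blast
qed

text \<open>
  If \<open>q\<close> is close to \<open>p\<close> in operator norm, then positivity is kept by the lower bound of \<open>p\<close>, and invertibility
  because \<open>p\<^sup>-\<^sup>1 q = 1 - p\<^sup>-\<^sup>1 (p - q)\<close> differs from 1 by a contraction.
\<close>

lemma open_Sigma: "open (Sigma_manifold :: 'h::separable_hilbert_space hs_real set)"
  unfolding open_dist
proof
  fix p :: "'h hs_real" assume p: "p \<in> Sigma_manifold"
  define i where "i = op_inverse (op_of p)"
  note inv = op_inverse_in_hs_real_ops(1,2)[OF p, folded i_def]
  obtain \<epsilon> where eps: "\<epsilon> > 0" "\<And>x. \<epsilon> * (norm x)\<^sup>2 \<le> op_of p x \<bullet> x"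
    using positive_invertible_lower_bound[OF self_adjoint_op_of] p unfolding Sigma_manifold_def by blast
  (* The factors 2 compensate for \<open>norm_alg_op_le\<close>: then \<open>norm w < \<epsilon>\<close> and \<open>norm (i w) < 1\<close>. *)
  define d where "d = min (\<epsilon> / 2) (1 / (2 * (norm i + 1)))"
  have d: "d > 0" using eps by (auto simp: d_def add_nonneg_pos)
  have "q \<in> Sigma_manifold" if q: "dist q p < d" for q
  proof -
    define w where "w = op_of p - op_of q"
    have w: "w = alg_op (alg_of p - alg_of q)" by (simp add: w_def minus_hs_alg.rep_eq alg_op_alg_of)
    have "norm w \<le> 2 * norm (alg_of p - alg_of q)" unfolding w by (rule norm_alg_op_le)
    also have "\<dots> = 2 * dist q p"
      by (simp add: alg_of_diff[symmetric] norm_alg_of dist_norm norm_minus_commute)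
    finally have nw: "norm w < 2 * d" using q by simp
    have "positive_op (op_of q)"
    proof (rule positive_opI[OF self_adjoint_op_of])
      fix x
      have "w x \<bullet> x \<le> norm (w x) * norm x" by (rule norm_cauchy_schwarz)
      also have "\<dots> \<le> (norm w * norm x) * norm x" by (intro mult_right_mono norm_blinfun) simp
      also have "\<dots> \<le> (\<epsilon> * norm x) * norm x" using nw by (intro mult_right_mono) (auto simp: d_def)
      finally have "w x \<bullet> x \<le> \<epsilon> * (norm x)\<^sup>2" by (simp add: power2_eq_square mult_ac)
      then have "w x \<bullet> x \<le> op_of p x \<bullet> x" using eps(2)[of x] by linarith
      then show "0 \<le> op_of q x \<bullet> x" by (simp add: w_def blinfun.diff_left inner_diff_left)
    qed
    moreover have "invertible_op (op_of q)"
    proof -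
      have "norm (i o\<^sub>L w) \<le> norm i * norm w" by (rule norm_blinfun_compose)
      also have "\<dots> \<le> (norm i + 1) * norm w" by (intro mult_right_mono) auto
      also have "\<dots> < (norm i + 1) * (2 * (1 / (2 * (norm i + 1))))"
        using nw by (intro mult_strict_left_mono) (auto simp: d_def add_nonneg_pos)
      also have "\<dots> = 1" by (simp add: add_nonneg_eq_0_iff)
      finally have "invertible_op (id_blinfun - (i o\<^sub>L w))" by (rule one_minus_contraction_invertible)
      then obtain X where X: "(id_blinfun - (i o\<^sub>L w)) o\<^sub>L X = id_blinfun" "X o\<^sub>L (id_blinfun - (i o\<^sub>L w)) = id_blinfun"
        unfolding invertible_op_def by blast
      have pi: "op_of p (i v) = v" "i (op_of p v) = v" for v
        using inv by (metis blinfun_apply_blinfun_compose blinfun_apply_id_blinfun)+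
      have Z: "id_blinfun - (i o\<^sub>L w) = i o\<^sub>L op_of q"
        by (rule blinfun_eqI) (simp add: w_def blinfun.diff_left blinfun.diff_right pi)
      have X1: "i (op_of q (X v)) = v" and X2: "X (i (op_of q v)) = v" for v
        using X unfolding Z by (metis blinfun_apply_blinfun_compose blinfun_apply_id_blinfun)+
      have "op_of q o\<^sub>L (X o\<^sub>L i) = id_blinfun"
        by (rule blinfun_eqI) (simp, metis X1 pi(1))
      moreover have "(X o\<^sub>L i) o\<^sub>L op_of q = id_blinfun"
        by (rule blinfun_eqI) (simp add: X2)
      ultimately show ?thesis unfolding invertible_op_def by blast
    qed
    ultimately show ?thesis by (simp add: Sigma_manifold_def)
  qed
  then show "\<exists>e>0. \<forall>y. dist y p < e \<longrightarrow> y \<in> Sigma_manifold" using d by blast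
qed

lemma Sigma_metric_eq:
  assumes "p \<in> Sigma_manifold"
  shows "Sigma_metric p x y = (alg_of x * alg_of (sigma_inv p)) \<bullet> (alg_of (sigma_inv p) * alg_of y)"
  unfolding Sigma_metric_def Re_inner2[symmetric] times_hs_alg.rep_eq alg_op_alg_of op_of_sigma_inv[OF assms] ..

section \<open>The connection and the curvature of the manifold\<close>

lemma bounded_bilinear_Blinfun:
  fixes t :: "'a::real_normed_vector \<Rightarrow> 'b::real_normed_vector \<Rightarrow> 'c::real_normed_vector \<Rightarrow> 'd::real_normed_vector"
  assumes 1: "\<And>b c. linear (\<lambda>a. t a b c)" and 2: "\<And>a c. linear (\<lambda>b. t a b c)" and 3: "\<And>a b. linear (\<lambda>c. t a b c)"
    and K: "\<And>a b c. norm (t a b c) \<le> K * norm a * norm b * norm c"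
  shows "blinfun_apply (Blinfun (t a b)) c = t a b c"
    and "bounded_bilinear (\<lambda>a b. Blinfun (t a b))"
proof -
  have "bounded_linear (t a b)" for a b
    using 3[of a b] K[of a b]
    by (intro bounded_linear.intro bounded_linear_axioms.intro exI[of _ "K * norm a * norm b"]) (auto simp: mult_ac)
  then show app: "blinfun_apply (Blinfun (t a b)) c = t a b c" for a b c
    by (simp add: bounded_linear_Blinfun_apply)
  show "bounded_bilinear (\<lambda>a b. Blinfun (t a b))"
  proof
    show "Blinfun (t (a + a') b) = Blinfun (t a b) + Blinfun (t a' b)" for a a' b
      by (rule blinfun_eqI) (simp add: app blinfun.add_left linear_add[OF 1])
    show "Blinfun (t a (b + b')) = Blinfun (t a b) + Blinfun (t a b')" for a b b'
      by (rule blinfun_eqI) (simp add: app blinfun.add_left linear_add[OF 2])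
    show "Blinfun (t (r *\<^sub>R a) b) = r *\<^sub>R Blinfun (t a b)" for r a b
      by (rule blinfun_eqI) (simp add: app blinfun.scaleR_left linear_scale[OF 1])
    show "Blinfun (t a (r *\<^sub>R b)) = r *\<^sub>R Blinfun (t a b)" for r a b
      by (rule blinfun_eqI) (simp add: app blinfun.scaleR_left linear_scale[OF 2])
    show "\<exists>K. \<forall>a b. norm (Blinfun (t a b)) \<le> norm a * norm b * K"
    proof (intro exI allI norm_blinfun_bound)
      show "norm (blinfun_apply (Blinfun (t a b)) c) \<le> norm a * norm b * \<bar>K\<bar> * norm c" for a b c
      proof -
        have "K * (norm a * norm b * norm c) \<le> \<bar>K\<bar> * (norm a * norm b * norm c)"
          by (intro mult_right_mono) auto
        then show ?thesis using K[of a b c] by (simp add: app mult_ac)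
      qed
    qed simp
  qed
qed

lemma bounded_linear_Blinfun:
  assumes "bounded_bilinear B"
  shows "blinfun_apply (Blinfun (B a)) b = B a b"
    and "bounded_linear (\<lambda>a. Blinfun (B a))"
proof -
  show app: "blinfun_apply (Blinfun (B a)) b = B a b" for a b
    by (simp add: bounded_linear_Blinfun_apply bounded_bilinear.bounded_linear_right[OF assms])
  show "bounded_linear (\<lambda>a. Blinfun (B a))"
    using transfer_bounded_bilinear_bounded_linearI[of B "\<lambda>a. Blinfun (B a)"] assms by (simp add: app)
qed

text \<open>
  \<open>(x q y + y q x) / 2\<close>, the combination of products that stays in the space of self-adjoint operators.  The
  derivative of the inverse and the Christoffel form are both instances of it.
\<close>

definition jordan_triple ::
    "'h::separable_hilbert_space hs_real \<Rightarrow> 'h hs_real \<Rightarrow> 'h hs_real \<Rightarrow> 'h hs_real"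
  where "jordan_triple x q y =
    inv alg_of ((1/2) *\<^sub>R (alg_of x * alg_of q * alg_of y + alg_of y * alg_of q * alg_of x))"

lemma alg_of_jordan_triple:
  "alg_of (jordan_triple x q y) =
    (1/2) *\<^sub>R (alg_of x * alg_of q * alg_of y + alg_of y * alg_of q * alg_of x)"
proof -
  have "(1/2) *\<^sub>R (alg_of x * alg_of q * alg_of y + alg_of y * alg_of q * alg_of x) \<in> range alg_of"
    unfolding star_fixed_iff[symmetric]
    by (simp add: star_scaleR star_add star_mult star_alg_of mult.assoc add.commute)
  then show ?thesis unfolding jordan_triple_def by (rule f_inv_into_f)
qed

lemma jordan_triple_commute: "jordan_triple x q y = jordan_triple y q x"
  by (simp add: jordan_triple_def add.commute)

lemma linear_jordan_triple:
  "linear (\<lambda>x. jordan_triple x q y)" "linear (\<lambda>q. jordan_triple x q y)" "linear (\<lambda>y. jordan_triple x q y)"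
  by (intro linearI alg_of_inject[THEN iffD1];
      simp add: alg_of_jordan_triple alg_of_add alg_of_scaleR algebra_simps scaleR_add_right)+

lemma norm_jordan_triple_le: "norm (jordan_triple x q y) \<le> 9 * norm x * norm q * norm y"
proof -
  have m: "norm (A * B * C) \<le> 9 * norm A * norm B * norm C" for A B C :: "'a hs_alg"
  proof -
    have "norm (A * B * C) \<le> 3 * norm (A * B) * norm C" by (rule norm_mult_hs_alg_le)
    also have "\<dots> \<le> 3 * (3 * norm A * norm B) * norm C"
      by (intro mult_right_mono mult_left_mono norm_mult_hs_alg_le) auto
    finally show ?thesis by (simp add: mult_ac)
  qed
  have "norm (alg_of x * alg_of q * alg_of y + alg_of y * alg_of q * alg_of x)
      \<le> 9 * norm (alg_of x) * norm (alg_of q) * norm (alg_of y)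
        + 9 * norm (alg_of y) * norm (alg_of q) * norm (alg_of x)"
    by (rule order_trans[OF norm_triangle_ineq add_mono[OF m m]])
  moreover have "norm (jordan_triple x q y)
      = (1/2) * norm (alg_of x * alg_of q * alg_of y + alg_of y * alg_of q * alg_of x)"
    unfolding norm_alg_of[symmetric, of "jordan_triple x q y"] alg_of_jordan_triple by simp
  ultimately show ?thesis by (simp add: norm_alg_of mult_ac)
qed

text \<open>
  Write \<open>J = q\<^sup>-\<^sup>1\<close>, \<open>I = p\<^sup>-\<^sup>1\<close> and \<open>h = q - p\<close>.  From \<open>J - I = - J h I\<close>, used twice, \<open>J - I + I h I = J h I h I\<close>.  Used
  once it also bounds \<open>J\<close> in terms of \<open>I\<close> for small \<open>h\<close>, so the right-hand side is of second order in \<open>h\<close>.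
\<close>

lemma sigma_inv_has_derivative:
  fixes p :: "'h::separable_hilbert_space hs_real"
  assumes p: "p \<in> Sigma_manifold"
  shows "(sigma_inv has_derivative (\<lambda>h. - jordan_triple (sigma_inv p) h (sigma_inv p))) (at p)"
proof -
  define I where "I = alg_of (sigma_inv p)"
  define N where "N = norm I"
  have N0: "N \<ge> 0" by (simp add: N_def)
  have bl: "bounded_linear (\<lambda>h. - jordan_triple (sigma_inv p) h (sigma_inv p))"
    using linear_jordan_triple(2) norm_jordan_triple_le[of "sigma_inv p" _ "sigma_inv p"]
    by (intro bounded_linear_minus bounded_linear.intro bounded_linear_axioms.intro
        exI[of _ "9 * norm (sigma_inv p) * norm (sigma_inv p)"]) (auto simp: mult_ac)
  obtain r where r: "r > 0" "ball p r \<subseteq> Sigma_manifold"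
    using open_Sigma p openE by blast
  show ?thesis
    unfolding has_derivative_at_alt
  proof (intro conjI bl allI impI)
    fix e :: real assume e: "e > 0"
    (* The second bound makes \<open>norm J \<le> 2 * N\<close>, the third makes \<open>162 * N ^ 3 * H \<le> e\<close>, where
         \<open>162 = 2 * 3 ^ 4\<close> comes from four products in the algebra and the bound on \<open>J\<close>. *)
    define d where "d = min r (min (1 / (18 * N + 1)) (e / (162 * N ^ 3 + 1)))"
    have d: "d > 0" using r e N0 by (simp add: d_def add_nonneg_pos)
    show "\<exists>d>0. \<forall>q. norm (q - p) < d \<longrightarrow>
      norm (sigma_inv q - sigma_inv p - - jordan_triple (sigma_inv p) (q - p) (sigma_inv p)) \<le> e * norm (q - p)"
    proof (intro exI[of _ d] conjI d allI impI)
      fix q assume q: "norm (q - p) < d"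
      then have qS: "q \<in> Sigma_manifold"
        using r(2) by (auto simp: d_def ball_def dist_norm norm_minus_commute)
      define J where "J = alg_of (sigma_inv q)"
      define h where "h = alg_of (q - p)"
      define H where "H = norm h"
      have H: "H = norm (q - p)" "H \<ge> 0" by (simp_all add: H_def h_def norm_alg_of)
      have JI: "J - I = - (J * h * I)"
        using sigma_inv_mult[OF p] sigma_inv_mult[OF qS]
        by (simp add: J_def I_def h_def alg_of_diff algebra_simps)
      have m: "norm (J * h * I) \<le> 9 * norm J * H * N"
      proof -
        have "norm (J * h * I) \<le> 3 * norm (J * h) * norm I" by (rule norm_mult_hs_alg_le)
        also have "\<dots> \<le> 3 * (3 * norm J * norm h) * norm I"
          by (intro mult_right_mono mult_left_mono norm_mult_hs_alg_le) auto
        finally show ?thesis by (simp add: H_def N_def)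
      qed
      have "18 * N * H \<le> 1"
      proof -
        have "H < 1 / (18 * N + 1)" using q by (simp add: H d_def)
        then have "H * (18 * N + 1) < 1" using N0 by (simp add: pos_less_divide_eq add_nonneg_pos)
        then show ?thesis using H(2) by (simp add: algebra_simps)
      qed
      have "norm J \<le> norm I + norm (J - I)"
        by (metis add.commute diff_add_cancel norm_triangle_ineq)
      also have "\<dots> \<le> N + 9 * norm J * H * N" using m by (simp add: JI N_def)
      also have "9 * norm J * H * N = (1/2) * norm J * (18 * N * H)" by simp
      also have "\<dots> \<le> (1/2) * norm J * 1" using \<open>18 * N * H \<le> 1\<close> by (intro mult_left_mono) auto
      finally have J: "norm J \<le> 2 * N" by simp
      have "alg_of (sigma_inv q - sigma_inv p - - jordan_triple (sigma_inv p) (q - p) (sigma_inv p))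
          = J - I + I * h * I"
        by (simp add: alg_of_diff alg_of_add alg_of_jordan_triple J_def I_def h_def)
      also have "\<dots> = (J * h * I) * h * I"
      proof -
        have "J - I + I * h * I = - (J * h * I) + I * h * I" by (simp only: JI)
        also have "\<dots> = - ((J - I) * h * I)" by (simp add: algebra_simps)
        also have "\<dots> = (J * h * I) * h * I" by (simp only: JI) simp
        finally show ?thesis .
      qed
      finally have "norm (sigma_inv q - sigma_inv p - - jordan_triple (sigma_inv p) (q - p) (sigma_inv p))
          = norm ((J * h * I) * h * I)"
        by (metis norm_alg_of)
      also have "\<dots> \<le> 3 * (3 * norm (J * h * I) * H) * N"
        unfolding H_def N_def
        by (intro order_trans[OF norm_mult_hs_alg_le] mult_right_mono mult_left_mono norm_mult_hs_alg_le) auto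
      also have "\<dots> \<le> 3 * (3 * (9 * (2 * N) * H * N) * H) * N"
      proof -
        have "norm (J * h * I) \<le> 9 * (2 * N) * H * N"
          using m J H N0 by (meson mult_left_mono mult_right_mono order_trans zero_le_numeral)
        then show ?thesis using H N0 by (intro mult_right_mono mult_left_mono) auto
      qed
      also have "\<dots> = (162 * N ^ 3 * H) * H" by (simp add: power3_eq_cube)
      also have "\<dots> \<le> e * H"
      proof (rule mult_right_mono)
        have "H < e / (162 * N ^ 3 + 1)" using q by (simp add: H d_def)
        then have "H * (162 * N ^ 3 + 1) < e" using N0 by (simp add: pos_less_divide_eq add_nonneg_pos)
        then show "162 * N ^ 3 * H \<le> e" using H(2) by (simp add: algebra_simps)
      qed (rule H)
      finally show "norm (sigma_inv q - sigma_inv p - - jordan_triple (sigma_inv p) (q - p) (sigma_inv p))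
          \<le> e * norm (q - p)" by (simp add: H)
    qed
  qed
qed

lemma neg_jordan_triple_Blinfun:
  fixes q r w x :: "'h::separable_hilbert_space hs_real"
  shows "blinfun_apply (Blinfun (\<lambda>v. - jordan_triple q v r)) w = - jordan_triple q w r"
    and "bounded_bilinear (\<lambda>q r :: 'h hs_real. Blinfun (\<lambda>v. - jordan_triple q v r))"
    and "blinfun_apply (Blinfun (\<lambda>y. - jordan_triple x q y)) w = - jordan_triple x q w"
    and "bounded_bilinear (\<lambda>q x :: 'h hs_real. Blinfun (\<lambda>y. - jordan_triple x q y))"
proof -
  note lin = linear_jordan_triple[THEN linear_compose_neg]
  have K: "norm (- jordan_triple a c b) \<le> 9 * norm a * norm b * norm c"
    "norm (- jordan_triple b a c) \<le> 9 * norm a * norm b * norm c" for a b c :: "'h hs_real"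
    using norm_jordan_triple_le[of a c b] norm_jordan_triple_le[of b a c] by (simp_all add: mult_ac)
  note 1 = bounded_bilinear_Blinfun[of "\<lambda>q r v. - jordan_triple q v r", OF lin(1) lin(3) lin(2) K(1)]
  note 2 = bounded_bilinear_Blinfun[of "\<lambda>q x y. - jordan_triple x q y", OF lin(2) lin(1) lin(3) K(2)]
  show "blinfun_apply (Blinfun (\<lambda>v. - jordan_triple q v r)) w = - jordan_triple q w r" by (rule 1)
  show "bounded_bilinear (\<lambda>q r :: 'h hs_real. Blinfun (\<lambda>v. - jordan_triple q v r))" by (rule 1)
  show "blinfun_apply (Blinfun (\<lambda>y. - jordan_triple x q y)) w = - jordan_triple x q w" by (rule 2)
  show "bounded_bilinear (\<lambda>q x :: 'h hs_real. Blinfun (\<lambda>y. - jordan_triple x q y))" by (rule 2)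
qed

lemma smooth_sigma_inv: "smooth_on (Sigma_manifold :: 'h::separable_hilbert_space hs_real set) sigma_inv"
proof (rule smooth_on_quadratic_ode[OF open_Sigma neg_jordan_triple_Blinfun(2)])
  fix p :: "'h hs_real" assume "p \<in> Sigma_manifold"
  then show "(sigma_inv has_derivative
      blinfun_apply (Blinfun (\<lambda>v. - jordan_triple (sigma_inv p) v (sigma_inv p)))) (at p)"
    by (rule has_derivative_eq_rhs[OF sigma_inv_has_derivative])
      (simp add: neg_jordan_triple_Blinfun(1) fun_eq_iff)
qed

text \<open>
  The Christoffel form as a function of the inverse: at \<open>p\<close> it is \<open>- (x p\<^sup>-\<^sup>1 y + y p\<^sup>-\<^sup>1 x) / 2\<close>, which is
  \<open>christoffel (sigma_inv p)\<close>.  In this form it is linear, so it inherits smoothness from the inverse.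
\<close>

definition christoffel :: "'h::separable_hilbert_space hs_real \<Rightarrow> 'h hs_real \<Rightarrow>\<^sub>L 'h hs_real \<Rightarrow>\<^sub>L 'h hs_real"
  where "christoffel q = Blinfun (\<lambda>x. Blinfun (\<lambda>y. - jordan_triple x q y))"

lemma christoffel_apply: "blinfun_apply (blinfun_apply (christoffel q) x) y = - jordan_triple x q y"
  unfolding christoffel_def
  by (simp add: bounded_linear_Blinfun(1)[OF neg_jordan_triple_Blinfun(4)] neg_jordan_triple_Blinfun(3))

lemma bounded_linear_christoffel: "bounded_linear christoffel"
  unfolding christoffel_def by (rule bounded_linear_Blinfun(2)[OF neg_jordan_triple_Blinfun(4)])

text \<open>
  Differentiating the two inverses in \<open>\<langle>Y p\<^sup>-\<^sup>1, p\<^sup>-\<^sup>1 Z\<rangle>\<close> produces \<open>h p\<^sup>-\<^sup>1\<close> on the right of \<open>Y p\<^sup>-\<^sup>1\<close> and \<open>p\<^sup>-\<^sup>1 h\<close> on the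
  left of \<open>p\<^sup>-\<^sup>1 Z\<close>, whereas the Christoffel form contains the symmetrized products.  The difference is a sum of
  two commutator terms that cancel by \<open>inner_commutator\<close>.
\<close>

lemma Sigma_metric_has_derivative:
  fixes p :: "'h::separable_hilbert_space hs_real" and Y Z :: "'h hs_real \<Rightarrow> 'h hs_real"
  assumes p: "p \<in> Sigma_manifold" and Y: "(Y has_derivative Y') (at p)" and Z: "(Z has_derivative Z') (at p)"
  shows "((\<lambda>q. Sigma_metric q (Y q) (Z q)) has_derivative
    (\<lambda>h. Sigma_metric p (Y' h - jordan_triple h (sigma_inv p) (Y p)) (Z p)
       + Sigma_metric p (Y p) (Z' h - jordan_triple h (sigma_inv p) (Z p)))) (at p)"
proof -
  define I where "I = alg_of (sigma_inv p)"
  define y where "y = alg_of (Y p)"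
  define z where "z = alg_of (Z p)"
  have alg: "((\<lambda>q. alg_of (f q)) has_derivative (\<lambda>h. alg_of (f' h))) (at p)"
    if "(f has_derivative f') (at p)" for f f'
    by (rule bounded_linear.has_derivative[OF bounded_linear_alg_of that])
  have i': "((\<lambda>q. alg_of (sigma_inv q)) has_derivative (\<lambda>h. - (I * alg_of h * I))) (at p)"
    by (rule has_derivative_eq_rhs[OF alg[OF sigma_inv_has_derivative[OF p]]])
      (simp add: fun_eq_iff alg_of_minus alg_of_jordan_triple I_def)
  note prod = bounded_bilinear.FDERIV[OF bounded_bilinear_mult_hs_alg]
  have "((\<lambda>q. (alg_of (Y q) * alg_of (sigma_inv q)) \<bullet> (alg_of (sigma_inv q) * alg_of (Z q))) has_derivative
     (\<lambda>h. (y * I) \<bullet> (I * alg_of (Z' h) + (- (I * alg_of h * I)) * z)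
        + (y * (- (I * alg_of h * I)) + alg_of (Y' h) * I) \<bullet> (I * z))) (at p)"
    unfolding I_def y_def z_def
    by (intro has_derivative_inner prod alg[OF Y] alg[OF Z] i'[unfolded I_def])
  then have "((\<lambda>q. Sigma_metric q (Y q) (Z q)) has_derivative
     (\<lambda>h. (y * I) \<bullet> (I * alg_of (Z' h) + (- (I * alg_of h * I)) * z)
        + (y * (- (I * alg_of h * I)) + alg_of (Y' h) * I) \<bullet> (I * z))) (at p)"
    by (rule has_derivative_transform_within_open[OF _ open_Sigma p]) (simp add: Sigma_metric_eq)
  then show ?thesis
  proof (rule has_derivative_eq_rhs, intro ext)
    fix h :: "'h hs_real"
    define H where "H = alg_of h"
    have "((H * I) * (y * I) - (y * I) * (H * I)) \<bullet> (I * z) = (y * I) \<bullet> ((I * H) * (I * z) - (I * z) * (I * H))"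
      using inner_commutator[of "H * I" "y * I" "I * z"]
      by (simp add: star_mult H_def I_def star_alg_of)
    then show "(y * I) \<bullet> (I * alg_of (Z' h) + (- (I * alg_of h * I)) * z)
        + (y * (- (I * alg_of h * I)) + alg_of (Y' h) * I) \<bullet> (I * z) =
       Sigma_metric p (Y' h - jordan_triple h (sigma_inv p) (Y p)) (Z p)
       + Sigma_metric p (Y p) (Z' h - jordan_triple h (sigma_inv p) (Z p))"
      unfolding Sigma_metric_eq[OF p] alg_of_diff alg_of_jordan_triple I_def[symmetric] y_def[symmetric]
        z_def[symmetric] H_def[symmetric]
      by (simp add: algebra_simps inner_add_left inner_add_right inner_diff_left inner_diff_right)
  qed
qed

lemma Sigma_metric_linear: "p \<in> Sigma_manifold \<Longrightarrow> linear (\<lambda>x. Sigma_metric p x y)"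
  by (intro linearI)
    (simp_all add: Sigma_metric_eq alg_of_add alg_of_scaleR distrib_right inner_add_left)

lemma Sigma_metric_commute: "p \<in> Sigma_manifold \<Longrightarrow> Sigma_metric p x y = Sigma_metric p y x"
  using inner_star[of "alg_of x * alg_of (sigma_inv p)" "alg_of (sigma_inv p) * alg_of y"]
  by (simp add: Sigma_metric_eq star_mult star_alg_of inner_commute)

lemma Sigma_metric_nondegenerate:
  assumes p: "p \<in> Sigma_manifold" and w: "Sigma_metric p w w = 0"
  shows "w = 0"
proof -
  have "(alg_of (sigma_inv p) * alg_of w) \<bullet> (alg_of w * alg_of (sigma_inv p)) = 0"
    using w by (simp add: Sigma_metric_eq[OF p] inner_commute)
  then have "alg_of (sigma_inv p) * alg_of w = 0"
    by (rule inner_mult_positive(2)[OF sigma_inv_in_Sigma[OF p]])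
  then have "alg_of p * alg_of (sigma_inv p) * alg_of w = 0" by (simp add: mult.assoc)
  then have "alg_of w = alg_of 0" by (simp add: sigma_inv_mult[OF p] alg_of_0)
  then show ?thesis by (simp add: alg_of_inject)
qed

interpretation Sigma: metric_with_christoffel_form Sigma_manifold Sigma_metric "\<lambda>p. christoffel (sigma_inv p)"
proof (rule metric_with_christoffel_form.intro)
  show "smooth_on Sigma_manifold (\<lambda>p. christoffel (sigma_inv p))"
    by (rule smooth_on_bounded_linear[OF open_Sigma bounded_linear_christoffel smooth_sigma_inv])
  show "w = 0" if "p \<in> Sigma_manifold" "\<And>z. Sigma_metric p w z = 0" for p w
    using Sigma_metric_nondegenerate that by blast
  show "blinfun_apply (blinfun_apply (christoffel (sigma_inv p)) x) y
      = blinfun_apply (blinfun_apply (christoffel (sigma_inv p)) y) x" for p x y :: "'a hs_real"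
    unfolding christoffel_apply by (simp add: jordan_triple_commute[of x])
  show "((\<lambda>q. Sigma_metric q (Y q) (Z q)) has_derivative
      (\<lambda>h. Sigma_metric p (Y' h + blinfun_apply (blinfun_apply (christoffel (sigma_inv p)) h) (Y p)) (Z p)
         + Sigma_metric p (Y p) (Z' h + blinfun_apply (blinfun_apply (christoffel (sigma_inv p)) h) (Z p)))) (at p)"
    if "p \<in> Sigma_manifold" "(Y has_derivative Y') (at p)" "(Z has_derivative Z') (at p)"
    for p :: "'a hs_real" and Y Y' Z Z'
    using Sigma_metric_has_derivative[OF that] by (simp add: christoffel_apply)
qed (fact open_Sigma Sigma_metric_linear Sigma_metric_commute)+

text \<open>
  Multiplied by \<open>p\<^sup>-\<^sup>1\<close> from the right this reads \<open>- [[a, b], c] / 4\<close> for \<open>a = x p\<^sup>-\<^sup>1\<close>, \<open>b = y p\<^sup>-\<^sup>1\<close>, \<open>c = z p\<^sup>-\<^sup>1\<close>, the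
  curvature of a symmetric space.
\<close>

lemma alg_of_curvature_tensor:
  fixes p x y z :: "'h::separable_hilbert_space hs_real"
  assumes p: "p \<in> Sigma_manifold"
  defines "I \<equiv> alg_of (sigma_inv p)"
  shows "alg_of (curvature_tensor Sigma_manifold Sigma_metric p x y z) = (1/4) *\<^sub>R
    (alg_of y * I * alg_of x * I * alg_of z + alg_of z * I * alg_of x * I * alg_of y
     - alg_of x * I * alg_of y * I * alg_of z - alg_of z * I * alg_of y * I * alg_of x)"
proof -
  have der: "((\<lambda>q. christoffel (sigma_inv q)) has_derivative
      (\<lambda>h. christoffel (- jordan_triple (sigma_inv p) h (sigma_inv p)))) (at p)"
    by (rule bounded_linear.has_derivative[OF bounded_linear_christoffel sigma_inv_has_derivative[OF p]])
  show ?thesis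
    unfolding Sigma.curvature_tensor_eq[OF p der] christoffel_apply
    by (simp add: alg_of_diff alg_of_add alg_of_minus alg_of_jordan_triple I_def[symmetric]
        algebra_simps scaleR_add_right scaleR_diff_right)
qed

text \<open>
  The curvature formula turns the sectional curvature into \<open>\<langle>[b, c], a\<^sup>*\<rangle> / 4\<close> with \<open>a = x p\<^sup>-\<^sup>1\<close>, \<open>b = y p\<^sup>-\<^sup>1\<close> and
  \<open>c = [a, b]\<close>.  Moving \<open>b\<close> to the other side gives \<open>\<langle>c, c\<^sup>*\<rangle> / 4\<close>.  In general \<open>c\<close> is not
  skew-adjoint, so this is not simply minus a square; but \<open>c = k p\<^sup>-\<^sup>1\<close> with \<open>k\<close> skew-adjoint, hence
  \<open>c\<^sup>* = - p\<^sup>-\<^sup>1 k\<close>, and \<open>inner_mult_positive\<close> gives the sign.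
\<close>

theorem proposition3p3:
  fixes p x y :: "'h::separable_hilbert_space hs_real"
  assumes "p \<in> Sigma_manifold"
    and "Sigma_metric p x x = 1" and "Sigma_metric p y y = 1" and "Sigma_metric p x y = 0"
  shows "sectional_curvature Sigma_manifold Sigma_metric p x y \<le> 0"
proof -
  define I where "I = alg_of (sigma_inv p)"
  define X where "X = alg_of x"
  define Y where "Y = alg_of y"
  define K where "K = X * I * Y - Y * I * X"
  define C where "C = K * I"
  have star [simp]: "star I = I" "star X = X" "star Y = Y"
    by (simp_all add: I_def X_def Y_def star_alg_of)
  have "sectional_curvature Sigma_manifold Sigma_metric p x y = (1/4) *
      (((Y * I) * C - C * (Y * I)) \<bullet> (I * X))"
    unfolding sectional_curvature_def Sigma_metric_eq[OF assms(1)] alg_of_curvature_tensor[OF assms(1)]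
      I_def[symmetric] X_def[symmetric] Y_def[symmetric] C_def K_def
    by (simp add: algebra_simps inner_add_left inner_diff_left)
  also have "((Y * I) * C - C * (Y * I)) \<bullet> (I * X) = C \<bullet> ((I * Y) * (I * X) - (I * X) * (I * Y))"
    using inner_commutator[of "Y * I" C "I * X"] by (simp add: star_mult)
  also have "(I * Y) * (I * X) - (I * X) * (I * Y) = - (I * K)"
    by (simp add: K_def algebra_simps)
  also have "(1/4) * (C \<bullet> - (I * K)) = - (1/4) * ((I * K) \<bullet> (K * I))"
    by (simp add: C_def inner_commute)
  also have "\<dots> \<le> 0"
    using inner_mult_positive(1)[OF sigma_inv_in_Sigma[OF assms(1)], of K] by (simp add: I_def)
  finally show ?thesis .
qed

end
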